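(* Let $m\le n$ be positive integers. (i) Let $p$ be a prime, $s$ a positive integer, and $0=a_0\le a_1\le\cdots\le a_s\le a_{s+1}=m$ a sequence of integers. Let ${\boldsymbol a}=(a_1,a_2,\dots,a_s)$ and let $D_{\boldsymbol a}\in\mathbb{S}$ be (mod $p^s$) the $n\times m$ diagonal matrix with exactly $a_i-a_{i-1}$ diagonal entries equal to $p^{i-1}$, i.e., with exactly $a_i$ diagonal entries that are not multiples of $p^i$, for $1\le i\le s$ (the remaining $m-a_s$ diagonal entries being $0$ mod $p^s$). Then $$\mu_{p^s}(\{D_{\boldsymbol a}\})=p^{-\sum_{i=1}^{s}(n-a_i)(m-a_i)}\cdot\frac{[p,n][p,m]}{[p,n-a_s][p,m-a_s]\prod_{i=1}^{s}[p,a_i-a_{i-1}]}.$$ (ii) Let $\mathcal{P}$ be a finite set of pairs $(p,s)$ with $p$ a prime and $s$ a positive integer, and let $P_{\mathcal P}=\prod_{(p,s)\in\mathcal P}p^s$. For any $\mathcal{S}\subseteq\mathbb{S}$, $$\mu_{P_{\mathcal P}}(\mathcal{S})=\sum_{D\in\mathcal{S}\ (\mathrm{mod}\ P_{\mathcal P})}\mu_{P_{\mathcal P}}(\{D\})$$ and $$\lim_{k\to\infty}\mu^{(k)}_{P_{\mathcal P}}(\mathcal{S})=\mu_{P_{\mathcal P}}(\mathcal{S})=\prod_{(p,s)\in\mathcal{P}}\mu_{p^s}(\mathcal{S}).$$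
   Context: $[p,0]=1$ and $[p,\ell]=\prod_{j=1}^{\ell}(1-p^{-j})$ for positive integers $\ell$. For a positive integer $k$, $\mathbb{Z}_{(k)}=\{-k,-k+1,\dots,k\}$. The Smith normal form (SNF) of an $n\times m$ matrix $M$ over $\mathbb{Z}$ or $\mathbb{Z}/q\mathbb{Z}$ is the diagonal matrix $PMQ$ ($P,Q$ invertible) with diagonal entries $d_1\mid d_2\mid\cdots\mid d_m$ (trailing entries may be $0$); the entries are unique up to units, and are taken nonnegative over $\mathbb{Z}$. The SNF of the zero matrix is itself. $\mathbb{S}$ is the set of $n\times m$ diagonal integer matrices whose diagonal entries $(d_1,\dots,d_m)$ are nonnegative with $d_{i+1}$ a multiple of $d_i$ for $1\le i\le m-1$. For a positive integer $q$ and $\mathcal{S}\subseteq\mathbb{S}$, "$\mathrm{SNF}(M)\in\mathcal{S}\ (\mathrm{mod}\ q)$" means that some $D\in\mathcal{S}$ has, mod $q$, the same diagonal entries as $\mathrm{SNF}(M)$ up to multiplication of entries by units of $\mathbb{Z}/q\mathbb{Z}$. $\mu_q(\mathcal{S})$ is the probability that $\mathrm{SNF}(M)\in\mathcal{S}\ (\mathrm{mod}\ q)$ when $M$ is an $n\times m$ matrix with independent entries uniform on $\mathbb{Z}/q\mathbb{Z}$, and $\mu_q^{(k)}(\mathcal{S})$ is the same probability when the entries of $M$ are independent and uniform on $\mathbb{Z}_{(k)}$. A sum over $D\in\mathcal{S}\ (\mathrm{mod}\ q)$ runs over the distinct classes mod $q$, up to multiplication of entries by units, of elements of $\mathcal{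S}$.
   Formalization: The last equality of (ii) fails for n=m=1, S={(0),(1)}, P={(2,1),(3,1)}; it is proved for distinct primes and S whose classes mod P_P are all combinations of its classes mod the p^s. For any S and distinct primes, μ is shown to be the sum over D of the products of μ_{p^s}({D}). *)

theory Defs
  imports "HOL-Probability.Product_PMF" "Jordan_Normal_Form.Matrix"
    "HOL-Number_Theory.Cong" "HOL-Computational_Algebra.Primes"
begin

definition qbracket :: "nat \<Rightarrow> nat \<Rightarrow> real" where
  "qbracket p l = (\<Prod>j=1..l. (1 - real p powi (- int j)))"

text \<open>Diagonal integer matrices in Smith normal form; used with \<open>m \<le> n\<close>.\<close>

definition snf_mats :: "nat \<Rightarrow> nat \<Rightarrow> int mat set" where
  "snf_mats n m = {D \<in> carrier_mat n m. diagonal_mat D \<and>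
     (\<forall>i<m. 0 \<le> D $$ (i,i)) \<and> (\<forall>i. i + 1 < m \<longrightarrow> D $$ (i,i) dvd D $$ (i+1,i+1))}"

definition is_snf :: "nat \<Rightarrow> nat \<Rightarrow> int mat \<Rightarrow> int mat \<Rightarrow> bool" where
  "is_snf n m M D \<longleftrightarrow> D \<in> snf_mats n m \<and>
     (\<exists>P \<in> carrier_mat n n. \<exists>Q \<in> carrier_mat m m.
        invertible_mat P \<and> invertible_mat Q \<and> P * M * Q = D)"

text \<open>Matrices over \<open>\<int>/q\<int>\<close> are represented by integer matrices, equality being entrywise
  congruence modulo \<open>q\<close>.\<close>

definition cong_mat :: "nat \<Rightarrow> int mat \<Rightarrow> int mat \<Rightarrow> bool" where
  "cong_mat q A B \<longleftrightarrow> dim_row A = dim_row B \<and> dim_col A = dim_col B \<and>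
     (\<forall>i<dim_row A. \<forall>j<dim_col A. [A $$ (i,j) = B $$ (i,j)] (mod int q))"

definition invertible_mod :: "nat \<Rightarrow> nat \<Rightarrow> int mat \<Rightarrow> bool" where
  "invertible_mod q d P \<longleftrightarrow> P \<in> carrier_mat d d \<and>
     (\<exists>R \<in> carrier_mat d d. cong_mat q (P * R) (1\<^sub>m d) \<and> cong_mat q (R * P) (1\<^sub>m d))"

text \<open>Here \<open>D\<close> represents a Smith normal form of \<open>M\<close> over \<open>\<int>/q\<int>\<close>; divisibility of its
  diagonal entries is divisibility in \<open>\<int>/q\<int>\<close>.\<close>

definition is_snf_mod :: "nat \<Rightarrow> nat \<Rightarrow> nat \<Rightarrow> int mat \<Rightarrow> int mat \<Rightarrow> bool" where
  "is_snf_mod q n m M D \<longleftrightarrow> D \<in> carrier_mat n m \<and> diagonal_mat D \<and>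
     (\<forall>i. i + 1 < m \<longrightarrow> (\<exists>c. [D $$ (i+1,i+1) = c * D $$ (i,i)] (mod int q))) \<and>
     (\<exists>P Q. invertible_mod q n P \<and> invertible_mod q m Q \<and> cong_mat q (P * M * Q) D)"

definition diag_assoc :: "nat \<Rightarrow> nat \<Rightarrow> int mat \<Rightarrow> int mat \<Rightarrow> bool" where
  "diag_assoc q m D E \<longleftrightarrow>
     (\<forall>i<m. \<exists>u. coprime u (int q) \<and> [D $$ (i,i) = u * E $$ (i,i)] (mod int q))"

definition random_mat :: "nat \<Rightarrow> nat \<Rightarrow> int set \<Rightarrow> int mat pmf" where
  "random_mat n m A =
     map_pmf (mat n m) (Pi_pmf ({..<n} \<times> {..<m}) 0 (\<lambda>_. pmf_of_set A))"

text \<open>A Smith normal form over \<open>\<int>/q\<int>\<close> is only unique up to units, hence the existential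
  quantifiers over \<open>E\<close>. In \<open>mu_mod\<close> it is taken over \<open>\<int>/q\<int>\<close>, in \<open>mu_box\<close> over \<open>\<int>\<close> and
  then reduced modulo \<open>q\<close>.\<close>

definition mu_mod :: "nat \<Rightarrow> nat \<Rightarrow> nat \<Rightarrow> int mat set \<Rightarrow> real" where
  "mu_mod n m q S = measure_pmf.prob (random_mat n m {0..<int q})
     {M. \<exists>E. is_snf_mod q n m M E \<and> (\<exists>D\<in>S. diag_assoc q m D E)}"

definition mu_box :: "nat \<Rightarrow> nat \<Rightarrow> nat \<Rightarrow> nat \<Rightarrow> int mat set \<Rightarrow> real" where
  "mu_box n m k q S = measure_pmf.prob (random_mat n m {- int k..int k})
     {M. \<exists>E. is_snf n m M E \<and> (\<exists>D\<in>S. diag_assoc q m D E)}"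

definition classes_mod :: "nat \<Rightarrow> nat \<Rightarrow> int mat set \<Rightarrow> int mat set set" where
  "classes_mod q m S = S // {(D, E). D \<in> S \<and> E \<in> S \<and> diag_assoc q m D E}"

definition class_rep :: "int mat set \<Rightarrow> int mat" where
  "class_rep C = (SOME D. D \<in> C)"

text \<open>The matrix attached to \<open>0 = a 0 \<le> a 1 \<le> \<dots> \<le> a s \<le> m\<close>, which is specified only modulo
  \<open>p ^ s\<close>.\<close>

definition is_D_a :: "nat \<Rightarrow> nat \<Rightarrow> nat \<Rightarrow> nat \<Rightarrow> (nat \<Rightarrow> nat) \<Rightarrow> int mat \<Rightarrow> bool" where
  "is_D_a n m p s a D \<longleftrightarrow> D \<in> snf_mats n m \<and>
     (\<forall>i\<in>{1..s}. card {j. j < m \<and> [D $$ (j,j) = int p ^ (i - 1)] (mod int (p ^ s))}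
                  = a i - a (i - 1)) \<and>
     card {j. j < m \<and> [D $$ (j,j) = 0] (mod int (p ^ s))} = m - a s"

definition modulus :: "(nat \<times> nat) set \<Rightarrow> nat" where
  "modulus \<P> = (\<Prod>(p,s)\<in>\<P>. p ^ s)"

text \<open>Membership in \<open>S\<close> modulo the full modulus is decided separately modulo each \<open>p ^ s\<close>:
  the set of classes of \<open>S\<close> modulo \<open>modulus \<P>\<close> is the full product of its sets of classes
  modulo the \<open>p ^ s\<close>. The product formula for \<open>mu_mod\<close> of a whole set fails without this: for
  \<open>n = m = 1\<close> and \<open>S = {(0), (1)}\<close> one has \<open>\<mu>\<^sub>2(S) = \<mu>\<^sub>3(S) = 1\<close> but \<open>\<mu>\<^sub>6(S) = 1/2\<close>.
  Every one-element set satisfies it.\<close>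

definition locally_determined :: "nat \<Rightarrow> (nat \<times> nat) set \<Rightarrow> int mat set \<Rightarrow> bool" where
  "locally_determined m \<P> S \<longleftrightarrow>
     (\<forall>F. (\<forall>x\<in>\<P>. F x \<in> S) \<longrightarrow>
       (\<exists>D\<in>S. \<forall>(p,s)\<in>\<P>. diag_assoc (p ^ s) m D (F (p,s))))"

end

theory Submission
  imports Defs "Jordan_Normal_Form.Gauss_Jordan_Elimination" "HOL-Real_Asymp.Real_Asymp"
begin

text \<open>Everything rests on one invariant. Every integer matrix \<open>M\<close> has a Smith normal form over \<open>\<int>\<close>,
  and reducing it modulo \<open>q\<close> gives one over \<open>\<int>/q\<int>\<close>. Conversely a Smith normal form modulo \<open>q\<close>
  is unique up to units: for every divisor \<open>d\<close> of \<open>q\<close> the number of solutions of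
  \<open>M v \<equiv> 0 (mod d)\<close> is an invariant of the equivalence class, a diagonal form has
  \<open>\<Prod> gcd(d\<^sub>j, d)\<close> of them, and these numbers for all \<open>d\<close> determine each \<open>gcd(d\<^sub>j, q)\<close>
  (\<open>snf_form_unique\<close>). Two integers have the same gcd with \<open>q\<close> iff they differ by a unit
  modulo \<open>q\<close>. Hence the events defining \<open>mu_mod\<close> and \<open>mu_box\<close> are the same condition on the
  numbers \<open>gcd(d\<^sub>j, q)\<close> of the integral Smith form, the \<open>snf_type\<close> of \<open>M\<close>, and this condition
  depends on \<open>M\<close> modulo \<open>q\<close> only.

  The second part of the theorem follows formally. Grouping matrices by type gives the sum over
  classes. Entries uniform on \<open>{-k..k}\<close> become equidistributed modulo \<open>q\<close>, and finitely many
  residue matrices make up the event, whence the limit. A type modulo a product of coprime moduli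
  amounts to a type modulo each factor, because the single integral Smith form is used for all
  moduli; by the Chinese remainder theorem the reductions are independent, so probabilities
  multiply.

  For the formula, let \<open>X(n, m, \<tau>)\<close> be the probability that an \<open>n \<times> m\<close> matrix modulo \<open>q = p\<^sup>s\<close>
  has type \<open>\<tau>\<close>. If no entry of \<open>\<tau>\<close> is a unit, then \<open>M\<close> is \<open>p\<close> times a matrix modulo \<open>p\<^sup>s\<^sup>-\<^sup>1\<close>,
  which costs a factor \<open>p\<^sup>-\<^sup>n\<^sup>m\<close>. If \<open>\<tau>\<close> has \<open>r \<ge> 1\<close> units, count the pairs \<open>(M, v)\<close> with \<open>M\<close> of
  type \<open>\<tau>\<close> and \<open>M v\<close> nonzero modulo \<open>p\<close>. For fixed \<open>M\<close> the proportion of such \<open>v\<close> is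
  \<open>1 - p\<^sup>-\<^sup>r\<close>. For fixed columns \<open>v\<close> and \<open>c\<close> modulo \<open>q\<close>, both nonzero modulo \<open>p\<close>, a
  change of bases turns the condition \<open>M v = c\<close> into the same one for the first unit vectors;
  then \<open>M\<close> consists of a corner \<open>1\<close> with zeros
  below it, an arbitrary rest of the first row, and an \<open>(n-1) \<times> (m-1)\<close> block carrying the
  remaining type \<open>\<tau>'\<close>. So
  \<open>X(n, m, \<tau>) (1 - p\<^sup>-\<^sup>r) = (1 - p\<^sup>-\<^sup>n) (1 - p\<^sup>-\<^sup>m) X(n-1, m-1, \<tau>')\<close>
  (\<open>card_type_mats_remove_unit\<close>). The stated product satisfies both recursions and equals \<open>1\<close>
  for \<open>s = 0\<close>.\<close>

section \<open>Congruence and equivalence of integer matrices\<close>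

lemma cong_mat_refl [simp]: "cong_mat q A A"
  by (simp add: cong_mat_def)

lemma cong_mat_sym: "cong_mat q A B \<Longrightarrow> cong_mat q B A"
  by (simp add: cong_mat_def cong_sym_eq)

lemma cong_mat_trans: "cong_mat q A B \<Longrightarrow> cong_mat q B C \<Longrightarrow> cong_mat q A C"
  unfolding cong_mat_def by (fastforce intro: cong_trans)

lemma cong_mat_dim: "cong_mat q A B \<Longrightarrow> A \<in> carrier_mat n m \<Longrightarrow> B \<in> carrier_mat n m"
  by (auto simp: cong_mat_def)

lemma cong_mat_0_iff: "cong_mat 0 A B \<longleftrightarrow> A = B"
  by (auto simp: cong_mat_def)

lemma cong_mat_dvd: "cong_mat q A B \<Longrightarrow> d dvd q \<Longrightarrow> cong_mat d A B"
  unfolding cong_mat_def using cong_dvd_modulus[of _ _ "int q" "int d"] by simp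

lemma cong_mat_mult:
  assumes "cong_mat q A A'" "cong_mat q B B'" "dim_col A = dim_row B"
  shows "cong_mat q (A * B) (A' * B')"
  using assms unfolding cong_mat_def
  by (auto simp: scalar_prod_def intro!: cong_sum cong_mult)

lemma cong_mat_transpose: "cong_mat q A B \<Longrightarrow> cong_mat q (transpose_mat A) (transpose_mat B)"
  by (auto simp: cong_mat_def)

lemma invertible_mod_carrier: "invertible_mod q d P \<Longrightarrow> P \<in> carrier_mat d d"
  by (simp add: invertible_mod_def)

lemma invertible_mod_inverse:
  assumes "invertible_mod q d P"
  obtains R where "invertible_mod q d R" "cong_mat q (P * R) (1\<^sub>m d)" "cong_mat q (R * P) (1\<^sub>m d)"
  using assms unfolding invertible_mod_def by blast

lemma invertible_mod_one: "invertible_mod q d (1\<^sub>m d)"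
  unfolding invertible_mod_def by (metis cong_mat_refl left_mult_one_mat one_carrier_mat)

lemma invertible_mod_dvd: "invertible_mod q d P \<Longrightarrow> k dvd q \<Longrightarrow> invertible_mod k d P"
  unfolding invertible_mod_def using cong_mat_dvd by blast

lemma invertible_mod_transpose:
  assumes "invertible_mod q d P"
  shows "invertible_mod q d (transpose_mat P)"
proof -
  from assms obtain R where R: "R \<in> carrier_mat d d" "cong_mat q (P * R) (1\<^sub>m d)"
      "cong_mat q (R * P) (1\<^sub>m d)" and P: "P \<in> carrier_mat d d"
    unfolding invertible_mod_def by blast
  have "cong_mat q (transpose_mat R * transpose_mat P) (1\<^sub>m d)"
    using cong_mat_transpose[OF R(2)] P R(1) by (simp add: transpose_mult)
  moreover have "cong_mat q (transpose_mat P * transpose_mat R) (1\<^sub>m d)"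
    using cong_mat_transpose[OF R(3)] P R(1) by (simp add: transpose_mult)
  ultimately show ?thesis
    unfolding invertible_mod_def using P R(1) by (intro conjI bexI[of _ "transpose_mat R"]) auto
qed

text \<open>The one rearrangement needed to see that inverses multiply in reverse order.\<close>

lemma cong_mat_cancel_middle:
  assumes "A \<in> carrier_mat n k" "B \<in> carrier_mat k k" "C \<in> carrier_mat k k" "D \<in> carrier_mat k m"
    and "cong_mat q (B * C) (1\<^sub>m k)"
  shows "cong_mat q ((A * B) * (C * D)) (A * D)"
proof -
  have "(A * B) * (C * D) = A * ((B * C) * D)"
    using assms(1-4) by (simp add: assoc_mult_mat[of _ n k _ k _ m] assoc_mult_mat[of _ k k _ k _ m])
  moreover have "cong_mat q ((B * C) * D) (1\<^sub>m k * D)"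
    using assms by (intro cong_mat_mult) auto
  ultimately show ?thesis
    using assms by (auto intro!: cong_mat_mult)
qed

lemma invertible_mod_mult:
  assumes "invertible_mod q d P" "invertible_mod q d Q"
  shows "invertible_mod q d (P * Q)"
proof -
  obtain R where R: "invertible_mod q d R" "cong_mat q (P * R) (1\<^sub>m d)" "cong_mat q (R * P) (1\<^sub>m d)"
    using assms(1) by (rule invertible_mod_inverse)
  obtain T where T: "invertible_mod q d T" "cong_mat q (Q * T) (1\<^sub>m d)" "cong_mat q (T * Q) (1\<^sub>m d)"
    using assms(2) by (rule invertible_mod_inverse)
  note c = assms[THEN invertible_mod_carrier] R(1)[THEN invertible_mod_carrier]
    T(1)[THEN invertible_mod_carrier]
  have "cong_mat q ((P * Q) * (T * R)) (P * R)" "cong_mat q ((T * R) * (P * Q)) (T * Q)"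
    using c R T by (auto intro!: cong_mat_cancel_middle)
  then show ?thesis
    unfolding invertible_mod_def using c R T by (metis cong_mat_trans mult_carrier_mat)
qed

lemma invertible_mod_0_iff:
  assumes "P \<in> carrier_mat d d"
  shows "invertible_mod 0 d P \<longleftrightarrow> invertible_mat P"
proof
  assume "invertible_mod 0 d P"
  then show "invertible_mat P"
    unfolding invertible_mod_def cong_mat_0_iff invertible_mat_def inverts_mat_def by auto
next
  assume "invertible_mat P"
  then obtain R where R: "P * R = 1\<^sub>m d" "R * P = 1\<^sub>m (dim_row R)"
    using assms unfolding invertible_mat_def inverts_mat_def by auto
  have "dim_col R = d" using arg_cong[OF R(1), of dim_col] by simp
  moreover have "dim_row R = d" using arg_cong[OF R(2), of dim_col] assms by simp
  ultimately show "invertible_mod 0 d P"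
    unfolding invertible_mod_def cong_mat_0_iff using R assms by (metis carrier_matI)
qed

text \<open>The relation behind both notions of Smith normal form. Congruence modulo \<open>0\<close> is equality, so
  \<open>equiv_mod 0\<close> is equivalence over \<open>\<int>\<close> and \<open>equiv_mod_dvd\<close> contains the passage from \<open>\<int>\<close> to
  \<open>\<int>/q\<int>\<close>.\<close>

definition equiv_mod :: "nat \<Rightarrow> int mat \<Rightarrow> int mat \<Rightarrow> bool" where
  "equiv_mod q A B \<longleftrightarrow> (\<exists>P Q. invertible_mod q (dim_row A) P \<and> invertible_mod q (dim_col A) Q \<and>
     cong_mat q (P * A * Q) B)"

lemma equiv_modI:
  "\<lbrakk>invertible_mod q n P; invertible_mod q m Q; cong_mat q (P * A * Q) B; A \<in> carrier_mat n m\<rbrakk>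
    \<Longrightarrow> equiv_mod q A B"
  unfolding equiv_mod_def by auto

lemma equiv_modE:
  assumes "equiv_mod q A B" "A \<in> carrier_mat n m"
  obtains P Q where "invertible_mod q n P" "invertible_mod q m Q" "cong_mat q (P * A * Q) B"
    "P \<in> carrier_mat n n" "Q \<in> carrier_mat m m"
proof -
  obtain P Q where PQ: "invertible_mod q n P" "invertible_mod q m Q" "cong_mat q (P * A * Q) B"
    using assms unfolding equiv_mod_def by auto
  show ?thesis
    using PQ PQ(1,2)[THEN invertible_mod_carrier] by (rule that)
qed

lemma equiv_mod_carrier:
  assumes "equiv_mod q A B" and A: "A \<in> carrier_mat n m"
  shows "B \<in> carrier_mat n m"
proof -
  obtain P Q where PQ: "cong_mat q (P * A * Q) B" "P \<in> carrier_mat n n" "Q \<in> carrier_mat m m"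
    using assms by (rule equiv_modE)
  show ?thesis
    by (rule cong_mat_dim[OF PQ(1) mult_carrier_mat[OF mult_carrier_mat[OF PQ(2) A] PQ(3)]])
qed

lemma cong_mat_imp_equiv_mod: "cong_mat q A B \<Longrightarrow> equiv_mod q A B"
  by (rule equiv_modI[OF invertible_mod_one invertible_mod_one]) auto

lemma equiv_mod_refl [simp]: "equiv_mod q A A"
  by (rule cong_mat_imp_equiv_mod) simp

lemma equiv_mod_dvd: "equiv_mod q A B \<Longrightarrow> d dvd q \<Longrightarrow> equiv_mod d A B"
  unfolding equiv_mod_def using invertible_mod_dvd cong_mat_dvd by blast

lemma equiv_mod_trans:
  assumes "equiv_mod q A B" "equiv_mod q B C"
  shows "equiv_mod q A C"
proof -
  define n m where "n = dim_row A" and "m = dim_col A"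
  have A: "A \<in> carrier_mat n m" by (simp add: n_def m_def)
  obtain P Q where PQ: "invertible_mod q n P" "invertible_mod q m Q" "cong_mat q (P * A * Q) B"
    "P \<in> carrier_mat n n" "Q \<in> carrier_mat m m"
    using assms(1) A by (rule equiv_modE)
  have B: "B \<in> carrier_mat n m" using assms(1) A by (rule equiv_mod_carrier)
  obtain R T where RT: "invertible_mod q n R" "invertible_mod q m T" "cong_mat q (R * B * T) C"
    "R \<in> carrier_mat n n" "T \<in> carrier_mat m m"
    using assms(2) B by (rule equiv_modE)
  have "(R * P) * A * (Q * T) = R * (P * A * Q) * T"
    using A PQ(4,5) RT(4,5)
    by (simp add: assoc_mult_mat[of _ n n _ n _ m] assoc_mult_mat[of _ n m _ m _ m]
      assoc_mult_mat[of _ n n _ m _ m])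
  moreover have "cong_mat q (R * (P * A * Q) * T) (R * B * T)"
    using A B PQ RT by (intro cong_mat_mult) auto
  ultimately have "cong_mat q ((R * P) * A * (Q * T)) C"
    using RT(3) cong_mat_trans by metis
  then show ?thesis
    using A PQ RT by (intro equiv_modI[of q n "R * P" m "Q * T"] invertible_mod_mult)
qed

lemma equiv_mod_sym:
  assumes "equiv_mod q A B"
  shows "equiv_mod q B A"
proof -
  define n m where "n = dim_row A" and "m = dim_col A"
  have A: "A \<in> carrier_mat n m" by (simp add: n_def m_def)
  obtain P Q where PQ: "invertible_mod q n P" "invertible_mod q m Q" "cong_mat q (P * A * Q) B"
    "P \<in> carrier_mat n n" "Q \<in> carrier_mat m m"
    using assms(1) A by (rule equiv_modE)
  have B: "B \<in> carrier_mat n m" using assms(1) A by (rule equiv_mod_carrier)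
  obtain R where R: "invertible_mod q n R" "cong_mat q (P * R) (1\<^sub>m n)" "cong_mat q (R * P) (1\<^sub>m n)"
    using PQ(1) by (rule invertible_mod_inverse)
  obtain T where T: "invertible_mod q m T" "cong_mat q (Q * T) (1\<^sub>m m)" "cong_mat q (T * Q) (1\<^sub>m m)"
    using PQ(2) by (rule invertible_mod_inverse)
  note c = R(1)[THEN invertible_mod_carrier] T(1)[THEN invertible_mod_carrier]
  have "cong_mat q (R * B * T) (R * (P * A * Q) * T)"
    using A B PQ c by (intro cong_mat_mult cong_mat_refl cong_mat_sym[OF PQ(3)]) auto
  also have "R * (P * A * Q) * T = (R * P) * (A * (Q * T))"
    using A PQ(4,5) c
    by (simp add: assoc_mult_mat[of _ n n _ n _ m] assoc_mult_mat[of _ n m _ m _ m]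
      assoc_mult_mat[of _ n n _ m _ m])
  finally have 1: "cong_mat q (R * B * T) ((R * P) * (A * (Q * T)))" .
  have "cong_mat q ((R * P) * (A * (Q * T))) (1\<^sub>m n * (A * 1\<^sub>m m))"
    using A PQ c R T by (intro cong_mat_mult cong_mat_refl) auto
  with 1 have "cong_mat q (R * B * T) A"
    using A cong_mat_trans by fastforce
  then show ?thesis
    using R(1) T(1) B by (intro equiv_modI)
qed

lemma equiv_mod_transpose:
  assumes "equiv_mod q A B"
  shows "equiv_mod q (transpose_mat A) (transpose_mat B)"
proof -
  define n m where "n = dim_row A" and "m = dim_col A"
  have A: "A \<in> carrier_mat n m" by (simp add: n_def m_def)
  obtain P Q where PQ: "invertible_mod q n P" "invertible_mod q m Q" "cong_mat q (P * A * Q) B"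
    "P \<in> carrier_mat n n" "Q \<in> carrier_mat m m"
    using assms(1) A by (rule equiv_modE)
  have "transpose_mat (P * A * Q) = transpose_mat Q * transpose_mat A * transpose_mat P"
    using A PQ(4,5) by (simp add: transpose_mult[of _ n m _ m] transpose_mult[of _ n n _ m]
      assoc_mult_mat[of _ m m _ n _ n])
  with cong_mat_transpose[OF PQ(3)] show ?thesis
    using A PQ by (intro equiv_modI[of q m "transpose_mat Q" n "transpose_mat P"]
      invertible_mod_transpose) auto
qed


lemma is_snf_iff_equiv_mod_0:
  assumes "M \<in> carrier_mat n m"
  shows "is_snf n m M D \<longleftrightarrow> D \<in> snf_mats n m \<and> equiv_mod 0 M D"
proof -
  have P: "P \<in> carrier_mat d d \<and> invertible_mat P \<longleftrightarrow> invertible_mod 0 d P" for P d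
    using invertible_mod_0_iff[of P d] invertible_mod_carrier[of 0 d P] by auto
  have "(\<exists>P \<in> carrier_mat n n. \<exists>Q \<in> carrier_mat m m.
      invertible_mat P \<and> invertible_mat Q \<and> P * M * Q = D) \<longleftrightarrow>
    (\<exists>P Q. (P \<in> carrier_mat n n \<and> invertible_mat P) \<and>
      (Q \<in> carrier_mat m m \<and> invertible_mat Q) \<and> P * M * Q = D)"
    by auto
  with assms show ?thesis
    unfolding is_snf_def equiv_mod_def cong_mat_0_iff P by auto
qed

section \<open>Elementary operations and bordered matrices\<close>

definition border :: "int \<Rightarrow> int mat \<Rightarrow> int mat" where
  "border d N = four_block_mat (d \<cdot>\<^sub>m 1\<^sub>m 1) (0\<^sub>m 1 (dim_col N)) (0\<^sub>m (dim_row N) 1) N"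

lemma border_carrier: "N \<in> carrier_mat n m \<Longrightarrow> border d N \<in> carrier_mat (Suc n) (Suc m)"
  unfolding border_def by auto

lemma dim_border [simp]:
  "dim_row (border d N) = Suc (dim_row N)" "dim_col (border d N) = Suc (dim_col N)"
  unfolding border_def by auto

lemma border_index:
  assumes "i < Suc (dim_row N)" "j < Suc (dim_col N)"
  shows "border d N $$ (i, j) =
    (if i = 0 \<and> j = 0 then d else if i = 0 \<or> j = 0 then 0 else N $$ (i - 1, j - 1))"
  using assms unfolding border_def by (subst index_mat_four_block) auto

text \<open>Block-diagonal matrices multiply blockwise; this lets equivalences of the lower block extend to
  the whole matrix.\<close>

lemma border_mult:
  assumes "A \<in> carrier_mat n k" "B \<in> carrier_mat k m"
  shows "border a A * border b B = border (a * b) (A * B)"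
proof -
  have dims: "dim_row A = n" "dim_col A = k" "dim_row B = k" "dim_col B = m"
    using assms by auto
  have "border a A * border b B = four_block_mat
     ((a \<cdot>\<^sub>m 1\<^sub>m 1) * (b \<cdot>\<^sub>m 1\<^sub>m 1) + 0\<^sub>m 1 k * 0\<^sub>m k 1) ((a \<cdot>\<^sub>m 1\<^sub>m 1) * 0\<^sub>m 1 m + 0\<^sub>m 1 k * B)
     (0\<^sub>m n 1 * (b \<cdot>\<^sub>m 1\<^sub>m 1) + A * 0\<^sub>m k 1) (0\<^sub>m n 1 * 0\<^sub>m 1 m + A * B)"
    unfolding border_def dims
    by (rule mult_four_block_mat[of _ 1 1 _ k _ n _ _ 1 _ m]) (use assms in auto)
  also have "(a \<cdot>\<^sub>m 1\<^sub>m 1) * (b \<cdot>\<^sub>m 1\<^sub>m 1) + 0\<^sub>m 1 k * 0\<^sub>m k 1 = (a * b) \<cdot>\<^sub>m (1\<^sub>m 1 :: int mat)"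
    by (rule eq_matI) (auto simp: scalar_prod_def)
  also have "(a \<cdot>\<^sub>m 1\<^sub>m 1) * 0\<^sub>m 1 m + 0\<^sub>m 1 k * B = 0\<^sub>m 1 m"
    using assms by (intro eq_matI) (auto simp: scalar_prod_def)
  also have "0\<^sub>m n 1 * (b \<cdot>\<^sub>m 1\<^sub>m 1) + A * 0\<^sub>m k 1 = 0\<^sub>m n 1"
    using assms by (intro eq_matI) (auto simp: scalar_prod_def)
  also have "0\<^sub>m n 1 * 0\<^sub>m 1 m + A * B = A * B"
    using assms by (intro eq_matI) (auto simp: scalar_prod_def)
  finally show ?thesis
    unfolding border_def by (simp add: dims)
qed

lemma border_one: "border 1 (1\<^sub>m n) = 1\<^sub>m (Suc n)"
  by (rule eq_matI) (auto simp: border_index)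

lemma cong_mat_border: "cong_mat q A B \<Longrightarrow> cong_mat q (border d A) (border d B)"
  unfolding cong_mat_def by (auto simp: border_index)

lemma invertible_mod_border:
  assumes "invertible_mod q d P"
  shows "invertible_mod q (Suc d) (border 1 P)"
proof -
  obtain R where R: "invertible_mod q d R" "cong_mat q (P * R) (1\<^sub>m d)" "cong_mat q (R * P) (1\<^sub>m d)"
    using assms by (rule invertible_mod_inverse)
  note c = assms[THEN invertible_mod_carrier] R(1)[THEN invertible_mod_carrier]
  have "cong_mat q (border 1 P * border 1 R) (1\<^sub>m (Suc d))"
    using cong_mat_border[OF R(2), of 1] border_mult[OF c(1,2), of 1 1] by (simp add: border_one)
  moreover have "cong_mat q (border 1 R * border 1 P) (1\<^sub>m (Suc d))"
    using cong_mat_border[OF R(3), of 1] border_mult[OF c(2,1), of 1 1] by (simp add: border_one)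
  ultimately show ?thesis
    unfolding invertible_mod_def using border_carrier[OF c(1)] border_carrier[OF c(2)] by blast
qed

lemma equiv_mod_border:
  assumes "equiv_mod q A B"
  shows "equiv_mod q (border d A) (border d B)"
proof -
  define n m where "n = dim_row A" and "m = dim_col A"
  have A: "A \<in> carrier_mat n m" by (simp add: n_def m_def)
  obtain P Q where PQ: "invertible_mod q n P" "invertible_mod q m Q" "cong_mat q (P * A * Q) B"
    "P \<in> carrier_mat n n" "Q \<in> carrier_mat m m"
    using assms(1) A by (rule equiv_modE)
  have "border 1 P * border d A * border 1 Q = border d (P * A * Q)"
    using border_mult[OF PQ(4) A, of 1 d] border_mult[OF mult_carrier_mat[OF PQ(4) A] PQ(5), of d 1]
    by simp
  then have "cong_mat q (border 1 P * border d A * border 1 Q) (border d B)"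
    using cong_mat_border[OF PQ(3)] by simp
  then show ?thesis
    by (rule equiv_modI[OF invertible_mod_border[OF PQ(1)] invertible_mod_border[OF PQ(2)] _
      border_carrier[OF A]])
qed

lemma equiv_mod_smult:
  assumes "equiv_mod q A B"
  shows "equiv_mod q (k \<cdot>\<^sub>m A) (k \<cdot>\<^sub>m B)"
proof -
  define n m where "n = dim_row A" and "m = dim_col A"
  have A: "A \<in> carrier_mat n m" by (simp add: n_def m_def)
  obtain P Q where PQ: "invertible_mod q n P" "invertible_mod q m Q" "cong_mat q (P * A * Q) B"
    "P \<in> carrier_mat n n" "Q \<in> carrier_mat m m"
    using assms(1) A by (rule equiv_modE)
  have "P * (k \<cdot>\<^sub>m A) * Q = k \<cdot>\<^sub>m (P * A * Q)"
    using mult_smult_distrib[OF PQ(4) A] mult_smult_assoc_mat[OF mult_carrier_mat[OF PQ(4) A] PQ(5)]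
    by metis
  moreover have "cong_mat q (k \<cdot>\<^sub>m (P * A * Q)) (k \<cdot>\<^sub>m B)"
    using PQ(3) unfolding cong_mat_def by (auto intro!: cong_mult simp del: index_mult_mat(1))
  ultimately show ?thesis
    using A PQ by (intro equiv_modI[OF PQ(1) PQ(2)]) auto
qed

lemma equiv_mod_uminus: "equiv_mod q A (-1 \<cdot>\<^sub>m A)"
proof -
  define n m where "n = dim_row A" and "m = dim_col A"
  have A: "A \<in> carrier_mat n m" by (simp add: n_def m_def)
  let ?P = "-1 \<cdot>\<^sub>m 1\<^sub>m n :: int mat"
  have 1: "?P * B = -1 \<cdot>\<^sub>m B" if B: "B \<in> carrier_mat n k" for B k
    using mult_smult_assoc_mat[OF one_carrier_mat[of n] B, of "-1"] left_mult_one_mat[OF B] by simp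
  have "?P * ?P = 1\<^sub>m n"
    by (subst 1[of _ n]) (auto intro!: eq_matI)
  then have "invertible_mod q n ?P"
    unfolding invertible_mod_def by (intro conjI bexI[of _ ?P]) auto
  moreover have "?P * A * 1\<^sub>m m = -1 \<cdot>\<^sub>m A"
    using 1[OF A] right_mult_one_mat[of "-1 \<cdot>\<^sub>m A" n m] A by simp
  ultimately show ?thesis
    by (intro equiv_modI[OF _ invertible_mod_one _ A]) auto
qed

lemma equiv_mod_addrow:
  assumes A: "A \<in> carrier_mat n m" and "k < n" "l < n" "k \<noteq> l"
  shows "equiv_mod q A (addrow a k l A)"
proof -
  have "invertible_mod q n (addrow_mat n a k l)"
    unfolding invertible_mod_def
    using addrow_mat_inv[OF assms(2-4), of a] addrow_mat_inv[OF assms(2-4), of "-a"]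
    by (intro conjI bexI[of _ "addrow_mat n (-a) k l"]) auto
  moreover have "addrow_mat n a k l * A * 1\<^sub>m m = addrow a k l A"
    using addrow_mat[OF A assms(3), of a k] right_mult_one_mat[of "addrow a k l A" n m] A by simp
  ultimately show ?thesis
    by (intro equiv_modI[OF _ invertible_mod_one _ A]) auto
qed

lemma equiv_mod_swaprows:
  assumes A: "A \<in> carrier_mat n m" and "k < n" "l < n"
  shows "equiv_mod q A (swaprows k l A)"
proof -
  have inv: "swaprows_mat n k l * swaprows_mat n k l = (1\<^sub>m n :: int mat)"
    by (rule swaprows_mat_inv[OF assms(2,3)])
  have "invertible_mod q n (swaprows_mat n k l)"
    unfolding invertible_mod_def using inv
    by (intro conjI bexI[of _ "swaprows_mat n k l"]) auto
  moreover have "swaprows_mat n k l * A * 1\<^sub>m m = swaprows k l A"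
    using swaprows_mat[OF assms] right_mult_one_mat[of "swaprows k l A" n m] A by simp
  ultimately show ?thesis
    by (intro equiv_modI[OF _ invertible_mod_one _ A]) auto
qed

lemma invertible_mod_shear:
  assumes "c \<in> carrier_mat n 1"
  shows "invertible_mod q (Suc n) (four_block_mat (1\<^sub>m 1) (0\<^sub>m 1 n) c (1\<^sub>m n))"
proof -
  let ?S = "\<lambda>c. four_block_mat (1\<^sub>m 1) (0\<^sub>m 1 n) c (1\<^sub>m n) :: int mat"
  have mult: "?S a * ?S b = ?S (a + b)" if a: "a \<in> carrier_mat n 1" and b: "b \<in> carrier_mat n 1" for a b
  proof -
    have "?S a * ?S b = four_block_mat (1\<^sub>m 1 * 1\<^sub>m 1 + 0\<^sub>m 1 n * b) (1\<^sub>m 1 * 0\<^sub>m 1 n + 0\<^sub>m 1 n * 1\<^sub>m n)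
        (a * 1\<^sub>m 1 + 1\<^sub>m n * b) (a * 0\<^sub>m 1 n + 1\<^sub>m n * 1\<^sub>m n)"
      by (rule mult_four_block_mat[of _ 1 1 _ n _ n _ _ 1 _ n]) (use a b in auto)
    with a b show ?thesis by simp
  qed
  have one: "?S (a + b) = 1\<^sub>m (Suc n)" if "a + b = 0\<^sub>m n 1" for a b
    unfolding that using four_block_one_mat[of 1 n] by simp
  have "?S c * ?S (-c) = ?S (c + -c)" "?S (-c) * ?S c = ?S (-c + c)"
    by (rule mult; use assms in simp)+
  moreover have "?S (c + -c) = 1\<^sub>m (Suc n)" "?S (-c + c) = 1\<^sub>m (Suc n)"
    by (rule one; use assms in \<open>auto intro!: eq_matI\<close>)+
  moreover have "?S c \<in> carrier_mat (Suc n) (Suc n)" for c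
    using four_block_carrier_mat[of "1\<^sub>m 1" 1 1 "1\<^sub>m n" n n] by simp
  ultimately show ?thesis
    unfolding invertible_mod_def by (intro conjI bexI[of _ "?S (-c)"]) (simp_all only: cong_mat_refl)
qed

text \<open>When the pivot \<open>d\<close> divides its row and column, one row shear and one column shear clear both at
  once. What remains of the lower block is the Schur complement.\<close>

lemma equiv_mod_clear:
  assumes c: "c \<in> carrier_mat n 1" and y: "y \<in> carrier_mat 1 m" and N: "N \<in> carrier_mat n m"
  shows "equiv_mod q (four_block_mat (d \<cdot>\<^sub>m 1\<^sub>m 1) (d \<cdot>\<^sub>m y) (d \<cdot>\<^sub>m c) N) (border d (N - d \<cdot>\<^sub>m (c * y)))"
proof -
  let ?M = "four_block_mat (d \<cdot>\<^sub>m 1\<^sub>m 1) (d \<cdot>\<^sub>m y) (d \<cdot>\<^sub>m c) N"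
  let ?P = "four_block_mat (1\<^sub>m 1) (0\<^sub>m 1 n) (-c) (1\<^sub>m n)"
  let ?Q = "four_block_mat (1\<^sub>m 1) (-y) (0\<^sub>m m 1) (1\<^sub>m m)"
  let ?N = "N - d \<cdot>\<^sub>m (c * y)"
  have "?P * ?M = four_block_mat (1\<^sub>m 1 * (d \<cdot>\<^sub>m 1\<^sub>m 1) + 0\<^sub>m 1 n * (d \<cdot>\<^sub>m c))
     (1\<^sub>m 1 * (d \<cdot>\<^sub>m y) + 0\<^sub>m 1 n * N) ((-c) * (d \<cdot>\<^sub>m 1\<^sub>m 1) + 1\<^sub>m n * (d \<cdot>\<^sub>m c))
     ((-c) * (d \<cdot>\<^sub>m y) + 1\<^sub>m n * N)"
    by (rule mult_four_block_mat[of _ 1 1 _ n _ n _ _ 1 _ m]) (use assms in auto)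
  also have "1\<^sub>m 1 * (d \<cdot>\<^sub>m 1\<^sub>m 1) + 0\<^sub>m 1 n * (d \<cdot>\<^sub>m c) = d \<cdot>\<^sub>m 1\<^sub>m 1"
    using assms by (intro eq_matI) (auto simp: scalar_prod_def)
  also have "1\<^sub>m 1 * (d \<cdot>\<^sub>m y) + 0\<^sub>m 1 n * N = d \<cdot>\<^sub>m y"
    using assms by (intro eq_matI) (auto simp: scalar_prod_def)
  also have "(-c) * (d \<cdot>\<^sub>m 1\<^sub>m 1) + 1\<^sub>m n * (d \<cdot>\<^sub>m c) = 0\<^sub>m n 1"
    using assms by (intro eq_matI) (auto simp: scalar_prod_def)
  also have "(-c) * (d \<cdot>\<^sub>m y) + 1\<^sub>m n * N = ?N"
    using assms by (intro eq_matI) (auto simp: scalar_prod_def)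
  finally have 1: "?P * ?M = four_block_mat (d \<cdot>\<^sub>m 1\<^sub>m 1) (d \<cdot>\<^sub>m y) (0\<^sub>m n 1) ?N" .
  have "four_block_mat (d \<cdot>\<^sub>m 1\<^sub>m 1) (d \<cdot>\<^sub>m y) (0\<^sub>m n 1) ?N * ?Q = four_block_mat
     ((d \<cdot>\<^sub>m 1\<^sub>m 1) * 1\<^sub>m 1 + (d \<cdot>\<^sub>m y) * 0\<^sub>m m 1) ((d \<cdot>\<^sub>m 1\<^sub>m 1) * (-y) + (d \<cdot>\<^sub>m y) * 1\<^sub>m m)
     (0\<^sub>m n 1 * 1\<^sub>m 1 + ?N * 0\<^sub>m m 1) (0\<^sub>m n 1 * (-y) + ?N * 1\<^sub>m m)"
    by (rule mult_four_block_mat[of _ 1 1 _ m _ n _ _ 1 _ m]) (use assms in auto)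
  also have "(d \<cdot>\<^sub>m 1\<^sub>m 1) * 1\<^sub>m 1 + (d \<cdot>\<^sub>m y) * 0\<^sub>m m 1 = d \<cdot>\<^sub>m 1\<^sub>m 1"
    using assms by (intro eq_matI) (auto simp: scalar_prod_def)
  also have "(d \<cdot>\<^sub>m 1\<^sub>m 1) * (-y) + (d \<cdot>\<^sub>m y) * 1\<^sub>m m = 0\<^sub>m 1 m"
    using assms by (intro eq_matI) (auto simp: scalar_prod_def)
  also have "0\<^sub>m n 1 * 1\<^sub>m 1 + ?N * 0\<^sub>m m 1 = 0\<^sub>m n 1"
    using assms by (intro eq_matI) (auto simp: scalar_prod_def)
  also have "0\<^sub>m n 1 * (-y) + ?N * 1\<^sub>m m = ?N"
  proof -
    have "?N * 1\<^sub>m m = ?N" using assms by (intro right_mult_one_mat[of _ n]) auto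
    moreover have "0\<^sub>m n 1 * (-y) = 0\<^sub>m n m" using y by (intro left_mult_zero_mat) auto
    moreover have "0\<^sub>m n m + ?N = ?N" using assms by (intro left_add_zero_mat) auto
    ultimately show ?thesis by simp
  qed
  finally have 2: "?P * ?M * ?Q = border d ?N"
    unfolding border_def 1 using assms by simp
  have "?Q = transpose_mat (four_block_mat (1\<^sub>m 1) (0\<^sub>m 1 m) (transpose_mat (-y)) (1\<^sub>m m))"
    using y by (subst transpose_four_block_mat[of _ 1 1 _ m _ m]) (auto simp: transpose_carrier_mat)
  moreover have "invertible_mod q (Suc m) (four_block_mat (1\<^sub>m 1) (0\<^sub>m 1 m) (transpose_mat (-y)) (1\<^sub>m m))"
    using y by (intro invertible_mod_shear) auto
  ultimately have Q: "invertible_mod q (Suc m) ?Q"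
    using invertible_mod_transpose by metis
  have P: "invertible_mod q (Suc n) ?P"
    using c by (intro invertible_mod_shear) auto
  have M: "?M \<in> carrier_mat (Suc n) (Suc m)"
    using four_block_carrier_mat[of "d \<cdot>\<^sub>m 1\<^sub>m 1" 1 1 N n m] N by simp
  show ?thesis
    by (rule equiv_modI[OF P Q _ M]) (simp only: 2 cong_mat_refl)
qed

section \<open>Existence of the Smith normal form over the integers\<close>

text \<open>Division with remainder: a pivot not dividing some entry of its column could be replaced by the
  remainder, contradicting minimality.\<close>

lemma minimal_pivot_dvd_column:
  assumes N: "N \<in> carrier_mat n m" and "0 < m" "i < n" and d: "N $$ (0,0) = d" "d \<noteq> 0"
    and min: "\<And>N'. equiv_mod 0 N N' \<Longrightarrow> N' $$ (0,0) \<noteq> 0 \<Longrightarrow> \<bar>d\<bar> \<le> \<bar>N' $$ (0,0)\<bar>"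
  shows "d dvd N $$ (i,0)"
proof (cases "i = 0")
  case True
  with d show ?thesis by simp
next
  case False
  define N1 where "N1 = addrow (- (N $$ (i,0) div d)) i 0 N"
  define N2 where "N2 = swaprows 0 i N1"
  have N1: "N1 \<in> carrier_mat n m" using N by (simp add: N1_def)
  have "equiv_mod 0 N N1"
    unfolding N1_def by (rule equiv_mod_addrow[OF N]) (use assms(3) False in auto)
  moreover have "equiv_mod 0 N1 N2"
    unfolding N2_def by (rule equiv_mod_swaprows[OF N1]) (use assms(3) in auto)
  ultimately have "equiv_mod 0 N N2" by (rule equiv_mod_trans)
  have "N1 $$ (i,0) = N $$ (i,0) mod d"
    using N assms(2,3) d(1) by (simp add: N1_def minus_div_mult_eq_mod[symmetric])
  moreover have "N2 $$ (0,0) = N1 $$ (i,0)"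
    using N1 assms(2,3) by (simp add: N2_def)
  ultimately have "N2 $$ (0,0) = N $$ (i,0) mod d" by simp
  moreover have "\<bar>N $$ (i,0) mod d\<bar> < \<bar>d\<bar>" using d(2) by (rule abs_mod_less)
  ultimately have "N $$ (i,0) mod d = 0"
    using min[OF \<open>equiv_mod 0 N N2\<close>] by linarith
  then show ?thesis by (simp add: dvd_eq_mod_eq_0)
qed

lemma minimal_pivot_dvd_row:
  assumes N: "N \<in> carrier_mat n m" and "0 < n" "j < m" and d: "N $$ (0,0) = d" "d \<noteq> 0"
    and min: "\<And>N'. equiv_mod 0 N N' \<Longrightarrow> N' $$ (0,0) \<noteq> 0 \<Longrightarrow> \<bar>d\<bar> \<le> \<bar>N' $$ (0,0)\<bar>"
  shows "d dvd N $$ (0,j)"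
proof -
  have "d dvd transpose_mat N $$ (j,0)"
  proof (rule minimal_pivot_dvd_column)
    show "transpose_mat N \<in> carrier_mat m n" using N by simp
    fix N' assume N': "equiv_mod 0 (transpose_mat N) N'" "N' $$ (0,0) \<noteq> 0"
    have "N' \<in> carrier_mat m n" by (rule equiv_mod_carrier[OF N'(1)]) (use N in simp)
    then have "transpose_mat N' $$ (0,0) = N' $$ (0,0)" using assms(2,3) by simp
    moreover have "equiv_mod 0 N (transpose_mat N')"
      using equiv_mod_transpose[OF N'(1)] by simp
    ultimately show "\<bar>d\<bar> \<le> \<bar>N' $$ (0,0)\<bar>" using min N'(2) by metis
  qed (use assms in auto)
  with N assms(2,3) show ?thesis by simp
qed

lemma equiv_mod_nonzero_pivot:
  assumes M: "M \<in> carrier_mat n m" and ij: "i < n" "j < m" "M $$ (i,j) \<noteq> 0"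
  shows "\<exists>N. equiv_mod 0 M N \<and> N $$ (0,0) \<noteq> 0"
proof -
  define M1 where "M1 = swaprows 0 i M"
  define M2 where "M2 = swaprows 0 j (transpose_mat M1)"
  have M1: "M1 \<in> carrier_mat n m" using M by (simp add: M1_def)
  then have M1t: "transpose_mat M1 \<in> carrier_mat m n" by simp
  then have M2: "M2 \<in> carrier_mat m n" by (simp add: M2_def)
  have "equiv_mod 0 M M1"
    unfolding M1_def by (rule equiv_mod_swaprows[OF M]) (use ij in auto)
  moreover have "equiv_mod 0 (transpose_mat M1) M2"
    unfolding M2_def by (rule equiv_mod_swaprows[OF M1t]) (use ij in auto)
  then have "equiv_mod 0 M1 (transpose_mat M2)"
    using equiv_mod_transpose by fastforce
  ultimately have "equiv_mod 0 M (transpose_mat M2)" by (rule equiv_mod_trans)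
  moreover have "transpose_mat M2 $$ (0,0) = M $$ (i,j)"
    using M M1 M1t M2 ij by (simp add: M2_def M1_def)
  ultimately show ?thesis using ij(3) by auto
qed

text \<open>Among all matrices equivalent to \<open>M\<close> choose a nonzero top left entry of least absolute value. It
  divides its row and column, which are cleared. Adding any other row to the first one keeps the
  pivot, so the pivot divides the remaining entries as well and can be pulled out.\<close>

lemma equiv_mod_minimal_pivot:
  assumes M: "M \<in> carrier_mat (Suc n) (Suc m)" "M \<noteq> 0\<^sub>m (Suc n) (Suc m)"
  obtains d N where "d > 0" "N \<in> carrier_mat n m" "equiv_mod 0 M (d \<cdot>\<^sub>m border 1 N)"
proof -
  obtain i j where "i < Suc n" "j < Suc m" "M $$ (i,j) \<noteq> 0"
    using M by (metis eq_matI carrier_matD zero_carrier_mat index_zero_mat(1))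
  from equiv_mod_nonzero_pivot[OF M(1) this]
  have "\<exists>N. equiv_mod 0 M N \<and> N $$ (0,0) \<noteq> 0" .
  then obtain N where N: "equiv_mod 0 M N" "N $$ (0,0) \<noteq> 0"
    and least: "\<forall>N'. equiv_mod 0 M N' \<and> N' $$ (0,0) \<noteq> 0 \<longrightarrow>
      nat \<bar>N $$ (0,0)\<bar> \<le> nat \<bar>N' $$ (0,0)\<bar>"
    using ex_has_least_nat[of "\<lambda>N. equiv_mod 0 M N \<and> N $$ (0,0) \<noteq> 0" _ "\<lambda>N. nat \<bar>N $$ (0,0)\<bar>"]
    by blast
  define d where "d = N $$ (0,0)"
  have min: "\<bar>d\<bar> \<le> \<bar>N' $$ (0,0)\<bar>" if "equiv_mod 0 M N'" "N' $$ (0,0) \<noteq> 0" for N'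
    using least[rule_format, of N'] that unfolding d_def by linarith
  have Nc: "N \<in> carrier_mat (Suc n) (Suc m)" using N(1) M(1) by (rule equiv_mod_carrier)
  have d0: "d \<noteq> 0" using N(2) by (simp add: d_def)
  have col: "d dvd N $$ (i,0)" if "i < Suc n" for i
    by (rule minimal_pivot_dvd_column[OF Nc _ that d_def[symmetric] d0])
      (use min equiv_mod_trans[OF N(1)] in auto)
  have row: "d dvd N $$ (0,j)" if "j < Suc m" for j
    by (rule minimal_pivot_dvd_row[OF Nc _ that d_def[symmetric] d0])
      (use min equiv_mod_trans[OF N(1)] in auto)
  define c where "c = mat n 1 (\<lambda>(i,j). N $$ (Suc i,0) div d)"
  define y where "y = mat 1 m (\<lambda>(i,j). N $$ (0,Suc j) div d)"
  define X where "X = mat n m (\<lambda>(i,j). N $$ (Suc i,Suc j))"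
  define Y where "Y = X - d \<cdot>\<^sub>m (c * y)"
  have cyX: "c \<in> carrier_mat n 1" "y \<in> carrier_mat 1 m" "X \<in> carrier_mat n m"
    by (auto simp: c_def y_def X_def)
  then have Y: "Y \<in> carrier_mat n m" by (auto simp: Y_def)
  have "N = four_block_mat (d \<cdot>\<^sub>m 1\<^sub>m 1) (d \<cdot>\<^sub>m y) (d \<cdot>\<^sub>m c) X"
    by (rule eq_matI) (use Nc col row in \<open>auto simp: c_def y_def X_def d_def\<close>)
  with equiv_mod_clear[OF cyX, of 0 d] have "equiv_mod 0 N (border d Y)"
    by (simp add: Y_def)
  with N(1) have MY: "equiv_mod 0 M (border d Y)" by (rule equiv_mod_trans)
  have bY: "border d Y \<in> carrier_mat (Suc n) (Suc m)" using Y by (rule border_carrier)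
  have dvd: "d dvd Y $$ (i,j)" if ij: "i < n" "j < m" for i j
  proof -
    \<comment> \<open>The entry to be tested is moved into the pivot row.\<close>
    define Z where "Z = addrow 1 0 (Suc i) (border d Y)"
    have Zc: "Z \<in> carrier_mat (Suc n) (Suc m)" using bY by (simp add: Z_def)
    have "equiv_mod 0 (border d Y) Z"
      unfolding Z_def by (rule equiv_mod_addrow[OF bY]) (use ij in auto)
    with MY have MZ: "equiv_mod 0 M Z" by (rule equiv_mod_trans)
    have 0: "Z $$ (0,0) = d" using Y ij by (simp add: Z_def border_index)
    have "d dvd Z $$ (0,Suc j)"
      by (rule minimal_pivot_dvd_row[OF Zc _ _ 0 d0]) (use min equiv_mod_trans[OF MZ] ij in auto)
    moreover have "Z $$ (0,Suc j) = Y $$ (i,j)" using Y ij by (simp add: Z_def border_index)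
    ultimately show ?thesis by simp
  qed
  define W where "W = mat n m (\<lambda>(i,j). Y $$ (i,j) div d)"
  have W: "W \<in> carrier_mat n m" by (simp add: W_def)
  have "border d Y = d \<cdot>\<^sub>m border 1 W"
    by (rule eq_matI) (use Y W dvd in \<open>auto simp: border_index W_def\<close>)
  with MY have 1: "equiv_mod 0 M (d \<cdot>\<^sub>m border 1 W)" by simp
  show thesis
  proof (cases "d > 0")
    case True
    with W 1 show thesis by (intro that)
  next
    case False
    have "equiv_mod 0 M (-1 \<cdot>\<^sub>m (d \<cdot>\<^sub>m border 1 W))"
      using 1 equiv_mod_uminus by (rule equiv_mod_trans)
    moreover have "-1 \<cdot>\<^sub>m (d \<cdot>\<^sub>m border 1 W) = (-d) \<cdot>\<^sub>m border 1 W"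
      by (rule eq_matI) auto
    ultimately show thesis using W False d0 by (intro that[of "-d" W]) auto
  qed
qed

lemma snf_mats_smult_border:
  assumes E: "E \<in> snf_mats n m" and "0 \<le> d" and "m \<le> n"
  shows "d \<cdot>\<^sub>m border 1 E \<in> snf_mats (Suc n) (Suc m)"
proof -
  note True = assms(3)
  have Ec: "dim_row E = n" "dim_col E = m" using E by (auto simp: snf_mats_def)
  have diag: "E $$ (i,j) = 0" if "i < n" "j < m" "i \<noteq> j" for i j
    using E that Ec by (auto simp: snf_mats_def diagonal_mat_def)
  have "(d \<cdot>\<^sub>m border 1 E) $$ (i,i) dvd (d \<cdot>\<^sub>m border 1 E) $$ (i+1,i+1)" if "i + 1 < Suc m" for i
  proof (cases i)
    case 0
    then show ?thesis using that True Ec by (auto simp: border_index)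
  next
    case (Suc k)
    have "E $$ (k,k) dvd E $$ (k+1,k+1)" using E that Suc by (auto simp: snf_mats_def)
    then show ?thesis using that True Suc Ec by (auto simp: border_index intro!: mult_dvd_mono)
  qed
  moreover have "0 \<le> (d \<cdot>\<^sub>m border 1 E) $$ (i,i)" if "i < Suc m" for i
    using that True E Ec assms(2) by (auto simp: border_index snf_mats_def)
  moreover have "diagonal_mat (d \<cdot>\<^sub>m border 1 E)"
    unfolding diagonal_mat_def using Ec by (auto simp: border_index intro!: diag)
  moreover have "d \<cdot>\<^sub>m border 1 E \<in> carrier_mat (Suc n) (Suc m)"
    using border_carrier[of E n m 1] Ec by auto
  ultimately show ?thesis unfolding snf_mats_def mem_Collect_eq by blast
qed

text \<open>Induction on the number of columns. Since the whole lower block is a multiple of the pivot, the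
  divisibility chain survives when the Smith form of that block is put back.\<close>

theorem is_snf_exists:
  assumes "m \<le> n" "M \<in> carrier_mat n m"
  shows "\<exists>E. is_snf n m M E"
  using assms
proof (induction m arbitrary: n M)
  case 0
  then have "M \<in> snf_mats n 0" by (auto simp: snf_mats_def diagonal_mat_def)
  then show ?case using 0 by (auto simp: is_snf_iff_equiv_mod_0)
next
  case (Suc m)
  then obtain n' where n: "n = Suc n'" "m \<le> n'" by (cases n) auto
  show ?case
  proof (cases "M = 0\<^sub>m n (Suc m)")
    case True
    then have "M \<in> snf_mats n (Suc m)"
      using Suc.prems by (auto simp: snf_mats_def diagonal_mat_def)
    then show ?thesis using Suc.prems(2) by (auto simp: is_snf_iff_equiv_mod_0)
  next
    case False
    obtain d N where N: "d > 0" "N \<in> carrier_mat n' m" "equiv_mod 0 M (d \<cdot>\<^sub>m border 1 N)"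
      using equiv_mod_minimal_pivot[of M n' m] Suc.prems(2) False n(1) by metis
    obtain E where "is_snf n' m N E" using Suc.IH[OF n(2) N(2)] by blast
    then have E: "E \<in> snf_mats n' m" "equiv_mod 0 N E"
      using is_snf_iff_equiv_mod_0[OF N(2)] by auto
    have "equiv_mod 0 M (d \<cdot>\<^sub>m border 1 E)"
      using N(3) equiv_mod_smult[OF equiv_mod_border[OF E(2)]] by (rule equiv_mod_trans)
    moreover have "d \<cdot>\<^sub>m border 1 E \<in> snf_mats n (Suc m)"
      using snf_mats_smult_border[OF E(1)] N(1) n by simp
    ultimately show ?thesis using is_snf_iff_equiv_mod_0[OF Suc.prems(2)] by blast
  qed
qed

section \<open>Counting matrices and kernels\<close>

lemma cong_mat_cong_left: "cong_mat q A B \<Longrightarrow> cong_mat q A C \<longleftrightarrow> cong_mat q B C"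
  using cong_mat_trans cong_mat_sym by blast

text \<open>Matrices with a prescribed set of values at each position. All counts below (residue
  matrices, kernels of diagonal matrices, fibres of reduction) are instances, computed by one
  product formula.\<close>

definition entry_mats :: "nat \<Rightarrow> nat \<Rightarrow> (nat \<Rightarrow> nat \<Rightarrow> int set) \<Rightarrow> int mat set" where
  "entry_mats n m B = {M \<in> carrier_mat n m. \<forall>i<n. \<forall>j<m. M $$ (i,j) \<in> B i j}"

lemma bij_betw_entry_mats:
  "bij_betw (mat n m) (PiE_dflt ({..<n} \<times> {..<m}) 0 (\<lambda>(i,j). B i j)) (entry_mats n m B)"
proof (rule bij_betw_imageI)
  show "inj_on (mat n m) (PiE_dflt ({..<n} \<times> {..<m}) 0 (\<lambda>(i,j). B i j))"
  proof (rule inj_onI, rule ext)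
    fix f g :: "nat \<times> nat \<Rightarrow> int" and x
    assume f: "f \<in> PiE_dflt ({..<n} \<times> {..<m}) 0 (\<lambda>(i,j). B i j)"
      and g: "g \<in> PiE_dflt ({..<n} \<times> {..<m}) 0 (\<lambda>(i,j). B i j)" and eq: "mat n m f = mat n m g"
    show "f x = g x"
    proof (cases "x \<in> {..<n} \<times> {..<m}")
      case True
      then obtain i j where x: "x = (i,j)" "i < n" "j < m" by auto
      then show ?thesis using arg_cong[OF eq, of "\<lambda>M. M $$ (i,j)"] by simp
    next
      case False
      then have "f x = 0" "g x = 0" using f g unfolding PiE_dflt_def by blast+
      then show ?thesis by simp
    qed
  qed
  show "mat n m ` PiE_dflt ({..<n} \<times> {..<m}) 0 (\<lambda>(i,j). B i j) = entry_mats n m B"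
  proof (intro equalityI subsetI)
    fix M assume "M \<in> mat n m ` PiE_dflt ({..<n} \<times> {..<m}) 0 (\<lambda>(i,j). B i j)"
    then show "M \<in> entry_mats n m B" unfolding PiE_dflt_def entry_mats_def by auto
  next
    fix M assume M: "M \<in> entry_mats n m B"
    let ?f = "\<lambda>x. if x \<in> {..<n} \<times> {..<m} then M $$ x else 0"
    have "M = mat n m ?f" using M by (intro eq_matI) (auto simp: entry_mats_def)
    moreover have "?f \<in> PiE_dflt ({..<n} \<times> {..<m}) 0 (\<lambda>(i,j). B i j)"
      using M unfolding PiE_dflt_def entry_mats_def by auto
    ultimately show "M \<in> mat n m ` PiE_dflt ({..<n} \<times> {..<m}) 0 (\<lambda>(i,j). B i j)" by (rule image_eqI)
  qed
qed

lemma card_entry_mats: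
  assumes "\<And>i j. i < n \<Longrightarrow> j < m \<Longrightarrow> finite (B i j)"
  shows "card (entry_mats n m B) = (\<Prod>i<n. \<Prod>j<m. card (B i j))"
proof -
  have "card (entry_mats n m B) = card (PiE_dflt ({..<n} \<times> {..<m}) (0::int) (\<lambda>(i,j). B i j))"
    using bij_betw_same_card[OF bij_betw_entry_mats] by metis
  also have "\<dots> = (\<Prod>x\<in>{..<n} \<times> {..<m}. card (case x of (i,j) \<Rightarrow> B i j))"
    using assms by (intro card_PiE_dflt) auto
  also have "\<dots> = (\<Prod>i<n. \<Prod>j<m. card (B i j))"
    by (simp add: prod.cartesian_product case_prod_unfold)
  finally show ?thesis .
qed

lemma finite_entry_mats:
  assumes "\<And>i j. i < n \<Longrightarrow> j < m \<Longrightarrow> finite (B i j)"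
  shows "finite (entry_mats n m B)"
proof -
  have "finite (PiE_dflt ({..<n} \<times> {..<m}) (0::int) (\<lambda>(i,j). B i j))"
    using assms by (intro finite_PiE_dflt) auto
  then show ?thesis using bij_betw_finite[OF bij_betw_entry_mats] by metis
qed

definition residue_mats :: "nat \<Rightarrow> nat \<Rightarrow> nat \<Rightarrow> int mat set" where
  "residue_mats n m q = entry_mats n m (\<lambda>_ _. {0..<int q})"

definition reduce :: "nat \<Rightarrow> int mat \<Rightarrow> int mat" where
  "reduce q M = map_mat (\<lambda>x. x mod int q) M"

lemma residue_mats_carrier: "M \<in> residue_mats n m q \<Longrightarrow> M \<in> carrier_mat n m"
  by (simp add: residue_mats_def entry_mats_def)

lemma finite_residue_mats [simp]: "finite (residue_mats n m q)"
  unfolding residue_mats_def by (rule finite_entry_mats) simp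

lemma card_residue_mats: "card (residue_mats n m q) = q ^ (n * m)"
  unfolding residue_mats_def by (subst card_entry_mats) (simp_all add: power_mult[symmetric] mult.commute)

lemma reduce_in_residue_mats: "M \<in> carrier_mat n m \<Longrightarrow> 0 < q \<Longrightarrow> reduce q M \<in> residue_mats n m q"
  by (auto simp: reduce_def residue_mats_def entry_mats_def)

lemma cong_mat_reduce: "cong_mat q (reduce q M) M"
  by (auto simp: reduce_def cong_mat_def)

lemma cong_mat_residue_mats_eq:
  assumes "cong_mat q A B" "A \<in> residue_mats n m q" "B \<in> residue_mats n m q"
  shows "A = B"
proof (rule eq_matI)
  fix i j assume ij: "i < dim_row B" "j < dim_col B"
  then have "A $$ (i,j) \<in> {0..<int q}" "B $$ (i,j) \<in> {0..<int q}"
    using assms(2,3) by (auto simp: residue_mats_def entry_mats_def)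
  moreover have "[A $$ (i,j) = B $$ (i,j)] (mod int q)"
    using assms(1) ij by (auto simp: cong_mat_def)
  ultimately show "A $$ (i,j) = B $$ (i,j)"
    by (auto simp: cong_def)
qed (use assms(1) in \<open>auto simp: cong_mat_def\<close>)

lemma card_preimage_bij_betw:
  assumes "bij_betw f A A"
  shows "card {x \<in> A. P (f x)} = card {x \<in> A. P x}"
proof (rule bij_betw_same_card)
  show "bij_betw f {x \<in> A. P (f x)} {x \<in> A. P x}"
    using assms by (auto simp: bij_betw_def inj_on_def)
qed

text \<open>Multiplication by invertible matrices preserves the uniform distribution on residue matrices. As
  the set is finite, a left inverse suffices.\<close>

lemma bij_betw_equiv_action:
  assumes P: "invertible_mod q n P" and Q: "invertible_mod q m Q" and q: "0 < q"
  shows "bij_betw (\<lambda>M. reduce q (P * M * Q)) (residue_mats n m q) (residue_mats n m q)"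
proof -
  let ?f = "\<lambda>M. reduce q (P * M * Q)"
  obtain R where R: "invertible_mod q n R" "cong_mat q (P * R) (1\<^sub>m n)" "cong_mat q (R * P) (1\<^sub>m n)"
    using P by (rule invertible_mod_inverse)
  obtain T where T: "invertible_mod q m T" "cong_mat q (Q * T) (1\<^sub>m m)" "cong_mat q (T * Q) (1\<^sub>m m)"
    using Q by (rule invertible_mod_inverse)
  note c = P[THEN invertible_mod_carrier] Q[THEN invertible_mod_carrier]
     R(1)[THEN invertible_mod_carrier] T(1)[THEN invertible_mod_carrier]
  have left_inverse: "cong_mat q (R * ?f M * T) M" if M: "M \<in> carrier_mat n m" for M
  proof -
    have PMQ: "P * M * Q \<in> carrier_mat n m" using c M by (meson mult_carrier_mat)
    then have d: "dim_row (?f M) = n" "dim_col (?f M) = m" by (auto simp: reduce_def)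
    have "cong_mat q (R * ?f M * T) (R * (P * M * Q) * T)"
      using c d by (intro cong_mat_mult cong_mat_refl cong_mat_reduce) auto
    also have "R * (P * M * Q) * T = (R * P) * (M * (Q * T))"
      using M c
      by (simp add: assoc_mult_mat[of _ n n _ n _ m] assoc_mult_mat[of _ n m _ m _ m]
        assoc_mult_mat[of _ n n _ m _ m])
    finally have 1: "cong_mat q (R * ?f M * T) ((R * P) * (M * (Q * T)))" .
    have "cong_mat q ((R * P) * (M * (Q * T))) (1\<^sub>m n * (M * 1\<^sub>m m))"
      using M c R T by (intro cong_mat_mult cong_mat_refl) auto
    moreover have "1\<^sub>m n * (M * 1\<^sub>m m) = M" using M by simp
    ultimately show ?thesis using cong_mat_trans[OF 1] by simp
  qed
  have "inj_on ?f (residue_mats n m q)"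
  proof (rule inj_onI)
    fix A B assume AB: "A \<in> residue_mats n m q" "B \<in> residue_mats n m q" "?f A = ?f B"
    have "cong_mat q (R * ?f A * T) A" by (rule left_inverse[OF AB(1)[THEN residue_mats_carrier]])
    moreover have "cong_mat q (R * ?f A * T) B"
      unfolding AB(3) by (rule left_inverse[OF AB(2)[THEN residue_mats_carrier]])
    ultimately have "cong_mat q A B" by (rule cong_mat_trans[OF cong_mat_sym])
    then show "A = B" using AB(1,2) by (rule cong_mat_residue_mats_eq)
  qed
  moreover have "?f M \<in> residue_mats n m q" if "M \<in> residue_mats n m q" for M
    by (rule reduce_in_residue_mats[OF mult_carrier_mat[OF mult_carrier_mat[OF c(1)
      residue_mats_carrier[OF that]] c(2)] q])
  ultimately show ?thesis
    using endo_inj_surj[of "residue_mats n m q" ?f] by (auto simp: bij_betw_def)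
qed

lemma equiv_mod_action:
  assumes "invertible_mod q n P" "invertible_mod q m Q" and M: "M \<in> carrier_mat n m"
  shows "equiv_mod q M (reduce q (P * M * Q))"
  by (rule equiv_modI[OF assms(1,2) _ M]) (rule cong_mat_sym[OF cong_mat_reduce])

lemma cong_mat_mult_left_zero:
  assumes "invertible_mod q n P" "X \<in> carrier_mat n k"
  shows "cong_mat q (P * X) (0\<^sub>m n k) \<longleftrightarrow> cong_mat q X (0\<^sub>m n k)"
proof -
  have imp: "cong_mat q (S * Y) (0\<^sub>m n k)"
    if "S \<in> carrier_mat n n" "Y \<in> carrier_mat n k" "cong_mat q Y (0\<^sub>m n k)" for S Y
    using cong_mat_mult[OF cong_mat_refl[of q S] that(3)] that(1,2) by simp
  obtain R where R: "invertible_mod q n R" "cong_mat q (P * R) (1\<^sub>m n)" "cong_mat q (R * P) (1\<^sub>m n)"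
    using assms(1) by (rule invertible_mod_inverse)
  note c = assms(1)[THEN invertible_mod_carrier] R(1)[THEN invertible_mod_carrier]
  have X: "cong_mat q X (R * (P * X))"
    using cong_mat_mult[OF R(3) cong_mat_refl[of q X]] c assms(2) cong_mat_sym
    by (simp add: assoc_mult_mat[of _ n n _ n _ k])
  show ?thesis
  proof
    assume "cong_mat q (P * X) (0\<^sub>m n k)"
    then have "cong_mat q (R * (P * X)) (0\<^sub>m n k)"
      by (rule imp[OF c(2) mult_carrier_mat[OF c(1) assms(2)]])
    with X show "cong_mat q X (0\<^sub>m n k)" by (rule cong_mat_trans)
  next
    assume "cong_mat q X (0\<^sub>m n k)"
    then show "cong_mat q (P * X) (0\<^sub>m n k)" by (rule imp[OF c(1) assms(2)])
  qed
qed

text \<open>Solutions of \<open>M v \<equiv> 0\<close> modulo \<open>d\<close>, with \<open>v\<close> counted modulo a multiple \<open>q\<close> of \<open>d\<close>. The case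
  \<open>q = d\<close> gives uniqueness of the Smith form, the case of a prime \<open>d\<close> gives the proportion of
  vectors with nonzero image.\<close>

definition kernel_count :: "nat \<Rightarrow> nat \<Rightarrow> int mat \<Rightarrow> nat" where
  "kernel_count q d M =
     card {v \<in> residue_mats (dim_col M) 1 q. cong_mat d (M * v) (0\<^sub>m (dim_row M) 1)}"

lemma kernel_count_equiv_mod:
  assumes "equiv_mod q M N" "d dvd q" "0 < q"
  shows "kernel_count q d M = kernel_count q d N"
proof -
  define n m where "n = dim_row M" and "m = dim_col M"
  have M: "M \<in> carrier_mat n m" by (simp add: n_def m_def)
  obtain P Q where PQ: "invertible_mod q n P" "invertible_mod q m Q" "cong_mat q (P * M * Q) N"
    "P \<in> carrier_mat n n" "Q \<in> carrier_mat m m"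
    using assms(1) M by (rule equiv_modE)
  have N: "N \<in> carrier_mat n m" using assms(1) M by (rule equiv_mod_carrier)
  let ?f = "\<lambda>v. reduce q (Q * v * 1\<^sub>m 1)"
  have iff: "cong_mat d (M * ?f v) (0\<^sub>m n 1) \<longleftrightarrow> cong_mat d (N * v) (0\<^sub>m n 1)"
    if v: "v \<in> residue_mats m 1 q" for v
  proof -
    have vc: "v \<in> carrier_mat m 1" using v by (rule residue_mats_carrier)
    have Qv: "Q * v \<in> carrier_mat m 1" using PQ(5) vc by (rule mult_carrier_mat)
    then have fv: "?f v = reduce q (Q * v)" using right_mult_one_mat[OF Qv] by simp
    have fc: "cong_mat d (?f v) (Q * v)"
      unfolding fv by (rule cong_mat_dvd[OF cong_mat_reduce assms(2)])
    have "cong_mat d (M * ?f v) (M * (Q * v))"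
      using M Qv PQ(5) by (intro cong_mat_mult[OF cong_mat_refl fc]) (simp add: fv reduce_def)
    then have 1: "cong_mat d (M * ?f v) (0\<^sub>m n 1) \<longleftrightarrow> cong_mat d (M * (Q * v)) (0\<^sub>m n 1)"
      by (rule cong_mat_cong_left)
    have "cong_mat d (M * (Q * v)) (0\<^sub>m n 1) \<longleftrightarrow> cong_mat d (P * (M * (Q * v))) (0\<^sub>m n 1)"
      using cong_mat_mult_left_zero[OF invertible_mod_dvd[OF PQ(1) assms(2)]
        mult_carrier_mat[OF M Qv]] by simp
    moreover have "P * (M * (Q * v)) = (P * M * Q) * v"
      using M PQ(4,5) vc
      by (simp add: assoc_mult_mat[of _ n n _ m _ 1] assoc_mult_mat[of _ n n _ m _ m]
        assoc_mult_mat[of _ n m _ m _ 1])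
    moreover have "cong_mat d ((P * M * Q) * v) (N * v)"
      using PQ vc by (intro cong_mat_mult[OF cong_mat_dvd[OF PQ(3) assms(2)] cong_mat_refl]) auto
    ultimately show ?thesis
      using 1 cong_mat_cong_left by presburger
  qed
  have "kernel_count q d N = card {v \<in> residue_mats m 1 q. cong_mat d (M * ?f v) (0\<^sub>m n 1)}"
    unfolding kernel_count_def using N iff by (intro arg_cong[of _ _ card]) auto
  also have "\<dots> = kernel_count q d M"
    unfolding kernel_count_def n_def[symmetric] m_def[symmetric]
    by (rule card_preimage_bij_betw[OF bij_betw_equiv_action[OF PQ(2) invertible_mod_one assms(3)]])
  finally show ?thesis by simp
qed

lemma card_multiples:
  assumes "k dvd q" "0 < q"
  shows "card {x \<in> {0..<int q}. int k dvd x} = q div k"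
proof -
  have k: "k > 0" using assms by (metis dvd_0_left_iff not_gr_zero)
  have "bij_betw (\<lambda>t. int k * int t) {..<q div k} {x \<in> {0..<int q}. int k dvd x}"
  proof (rule bij_betw_imageI)
    show "inj_on (\<lambda>t. int k * int t) {..<q div k}" using k by (auto simp: inj_on_def)
    show "(\<lambda>t. int k * int t) ` {..<q div k} = {x \<in> {0..<int q}. int k dvd x}"
    proof (intro equalityI subsetI)
      fix x assume "x \<in> (\<lambda>t. int k * int t) ` {..<q div k}"
      then obtain t where t: "t < q div k" "x = int k * int t" by auto
      have "k * t < k * (q div k)" using t k by simp
      then have "k * t < q" using assms(1) by simp
      then have "int k * int t < int q" by (metis of_nat_less_iff of_nat_mult)
      then show "x \<in> {x \<in> {0..<int q}. int k dvd x}" using t by auto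
    next
      fix x assume "x \<in> {x \<in> {0..<int q}. int k dvd x}"
      then obtain y where y: "x = int k * y" "0 \<le> x" "x < int q" by auto
      have y0: "y \<ge> 0" using y k by (simp add: zero_le_mult_iff)
      have "int k * y < int k * int (q div k)"
        using y assms(1) by (metis dvd_mult_div_cancel of_nat_mult)
      then have "nat y < q div k" using k y0 by simp
      then show "x \<in> (\<lambda>t. int k * int t) ` {..<q div k}"
        using y y0 by (intro image_eqI[of _ _ "nat y"]) auto
    qed
  qed
  then show ?thesis using bij_betw_same_card by fastforce
qed

text \<open>After division by \<open>g = gcd(e, d)\<close> the condition reads \<open>d/g\<close> divides \<open>x\<close>.\<close>

lemma card_dvd_mult_residues:
  assumes "d dvd q" "0 < q"
  shows "int (card {x \<in> {0..<int q}. int d dvd e * x}) = int (q div d) * gcd e (int d)"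
proof -
  define g where "g = nat (gcd e (int d))"
  have g: "int g = gcd e (int d)" by (simp add: g_def)
  have d: "d > 0" using assms by (metis dvd_0_left_iff not_gr_zero)
  then have g0: "g > 0" unfolding g_def by simp
  have gd: "g dvd d" using g by (metis gcd_dvd2 int_dvd_int_iff)
  define k where "k = d div g"
  have dk: "d = g * k" using gd by (simp add: k_def)
  obtain e' where e: "e = int g * e'" using g by (metis gcd_dvd1 dvdE)
  have "gcd e (int d) = int g * gcd e' (int k)"
    unfolding e dk using gcd_mult_distrib_int[of "int g" e' "int k"] by simp
  then have "int g = int g * gcd e' (int k)" using g by simp
  then have "gcd e' (int k) = 1" using g0 by simp
  then have cop: "coprime (int k) e'" by (simp add: coprime_iff_gcd_eq_1 gcd.commute)
  have "int d dvd e * x \<longleftrightarrow> int k dvd x" for x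
  proof -
    have "int d dvd e * x \<longleftrightarrow> int g * int k dvd int g * (e' * x)" by (simp add: dk e mult.assoc)
    also have "\<dots> \<longleftrightarrow> int k dvd e' * x" using g0 by simp
    also have "\<dots> \<longleftrightarrow> int k dvd x" using cop by (rule coprime_dvd_mult_right_iff)
    finally show ?thesis .
  qed
  then have "card {x \<in> {0..<int q}. int d dvd e * x} = card {x \<in> {0..<int q}. int k dvd x}"
    by simp
  also have "\<dots> = q div k"
    using assms dk by (intro card_multiples) auto
  also have "q div k = (q div d) * g"
  proof -
    obtain r where "q = d * r" using assms(1) by blast
    then show ?thesis using dk d by simp
  qed
  finally show ?thesis using g by simp
qed

lemma diagonal_mult_column:
  assumes "D \<in> carrier_mat n m" "diagonal_mat D" "v \<in> carrier_mat m 1" "i < n"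
  shows "(D * v) $$ (i,0) = (if i < m then D $$ (i,i) * v $$ (i,0) else 0)"
proof -
  have "(D * v) $$ (i,0) = (\<Sum>k<m. D $$ (i,k) * v $$ (k,0))"
    using assms by (auto simp: scalar_prod_def atLeast0LessThan intro!: sum.cong)
  also have "\<dots> = (\<Sum>k<m. if k = i then D $$ (i,i) * v $$ (i,0) else 0)"
    using assms by (intro sum.cong) (auto simp: diagonal_mat_def)
  also have "\<dots> = (if i < m then D $$ (i,i) * v $$ (i,0) else 0)" by simp
  finally show ?thesis .
qed

lemma kernel_count_diagonal:
  assumes D: "D \<in> carrier_mat n m" "diagonal_mat D" and mn: "m \<le> n" and "d dvd q" "0 < q"
  shows "int (kernel_count q d D) = (\<Prod>j<m. int (q div d) * gcd (D $$ (j,j)) (int d))"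
proof -
  have iff: "cong_mat d (D * v) (0\<^sub>m n 1) \<longleftrightarrow> (\<forall>j<m. int d dvd D $$ (j,j) * v $$ (j,0))"
    if v: "v \<in> carrier_mat m 1" for v
  proof -
    have "cong_mat d (D * v) (0\<^sub>m n 1) \<longleftrightarrow> (\<forall>i<n. [(D * v) $$ (i,0) = 0] (mod int d))"
      using D v unfolding cong_mat_def by (auto simp del: index_mult_mat(1))
    also have "\<dots> \<longleftrightarrow> (\<forall>j<m. int d dvd D $$ (j,j) * v $$ (j,0))"
      using diagonal_mult_column[OF D v] mn by (auto simp: cong_0_iff)
    finally show ?thesis .
  qed
  have "kernel_count q d D = card {v \<in> residue_mats m 1 q. cong_mat d (D * v) (0\<^sub>m n 1)}"
    unfolding kernel_count_def using D by simp
  moreover have "{v \<in> residue_mats m 1 q. cong_mat d (D * v) (0\<^sub>m n 1)} =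
      entry_mats m 1 (\<lambda>j _. {x \<in> {0..<int q}. int d dvd D $$ (j,j) * x})"
    using iff by (auto simp: residue_mats_def entry_mats_def)
  moreover have "card (entry_mats m 1 (\<lambda>j _. {x \<in> {0..<int q}. int d dvd D $$ (j,j) * x})) =
      (\<Prod>i<m. \<Prod>j<1::nat. card {x \<in> {0..<int q}. int d dvd D $$ (i,i) * x})"
    by (rule card_entry_mats, rule finite_subset[of _ "{0..<int q}"]) auto
  ultimately have "kernel_count q d D = (\<Prod>j<m. card {x \<in> {0..<int q}. int d dvd D $$ (j,j) * x})"
    by simp
  also have "int \<dots> = (\<Prod>j<m. int (q div d) * gcd (D $$ (j,j)) (int d))"
    using card_dvd_mult_residues[OF assms(4,5)] by simp
  finally show ?thesis .
qed

section \<open>Uniqueness of the Smith normal form modulo q\<close>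

text \<open>Units of \<open>\<int>/k\<int>\<close> lift to units of \<open>\<int>/q\<int>\<close>. The primes dividing \<open>q\<close> fall into those dividing \<open>w\<close>
  and the others; adding \<open>k\<close> times the product of the others avoids all of them.\<close>

lemma unit_lift:
  fixes w k q :: int
  assumes "coprime w k" "k dvd q" "q \<noteq> 0"
  obtains u where "[u = w] (mod k)" "coprime u q"
proof -
  \<comment> \<open>The correction is divisible exactly by the primes of \<open>q\<close> that do not divide \<open>w\<close>.\<close>
  define t where "t = \<Prod>{p \<in> prime_factors q. \<not> p dvd w}"
  have fin: "finite {p \<in> prime_factors q. \<not> p dvd w}" by simp
  define u where "u = w + t * k"
  have "coprime u q"
  proof (rule ccontr)
    assume "\<not> coprime u q"
    then have "\<not> is_unit (gcd u q)" by (simp add: coprime_iff_gcd_eq_1)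
    moreover have "gcd u q \<noteq> 0" using assms(3) by simp
    ultimately obtain p where p: "prime p" "p dvd gcd u q"
      using prime_divisor_exists by blast
    then have pu: "p dvd u" and pq: "p dvd q" by auto
    have pf: "p \<in> prime_factors q" using p(1) pq assms(3) by (simp add: in_prime_factors_iff)
    show False
    proof (cases "p dvd w")
      case True
      then have "p dvd t * k" using pu by (simp add: u_def dvd_add_right_iff)
      then have "p dvd t \<or> p dvd k" using p(1) by (simp add: prime_dvd_mult_iff)
      moreover have "\<not> p dvd k"
        using True assms(1) p(1) by (meson coprime_common_divisor not_prime_unit)
      ultimately have "p dvd t" by simp
      then obtain r where r: "r \<in> prime_factors q" "\<not> r dvd w" "p dvd r"
        unfolding t_def using prime_dvd_prod_iff[OF fin p(1), of "\<lambda>x. x"] by auto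
      then have "p = r" using p(1) by (simp add: primes_dvd_imp_eq in_prime_factors_iff)
      with r True show False by simp
    next
      case False
      then have "p dvd t" unfolding t_def using pf by (intro dvd_prodI[of _ p "\<lambda>x. x"]) auto
      then have "p dvd w" using pu by (simp add: u_def dvd_add_left_iff)
      with False show False by simp
    qed
  qed
  moreover have "[u = w] (mod k)" by (simp add: u_def cong_def)
  ultimately show thesis by (intro that)
qed

text \<open>After division by the common gcd both numbers become units modulo \<open>q/g\<close>, and their quotient
  there has to be lifted to a unit modulo \<open>q\<close>.\<close>

lemma gcd_eq_iff_unit_multiple:
  fixes a b q :: int
  assumes "q \<noteq> 0"
  shows "gcd a q = gcd b q \<longleftrightarrow> (\<exists>u. coprime u q \<and> [a = u * b] (mod q))"
proof
  assume eq: "gcd a q = gcd b q"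
  define g where "g = gcd a q"
  have g0: "g \<noteq> 0" using assms by (simp add: g_def)
  obtain a' where a: "a = g * a'" unfolding g_def by (metis gcd_dvd1 dvdE)
  obtain b' where b: "b = g * b'" unfolding g_def eq by (metis gcd_dvd1 dvdE)
  obtain k where k: "q = g * k" unfolding g_def by (metis gcd_dvd2 dvdE)
  have gpos: "g \<ge> 0" by (simp add: g_def)
  have "gcd (g * a') (g * k) = g" unfolding a[symmetric] k[symmetric] by (simp only: g_def)
  moreover have "gcd (g * b') (g * k) = g" unfolding b[symmetric] k[symmetric] by (simp only: g_def eq)
  moreover have "g * gcd x k = gcd (g * x) (g * k)" for x
    using gcd_mult_distrib_int[of g x k] gpos by (simp only: abs_of_nonneg)
  ultimately have "g * gcd a' k = g" "g * gcd b' k = g" by simp_all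
  then have cop: "coprime a' k" "coprime b' k" using g0 by (auto simp: coprime_iff_gcd_eq_1)
  obtain x where x: "[b' * x = 1] (mod k)" using cop(2) cong_solve_coprime_int by blast
  then have "coprime (b' * x) k" by (metis cong_imp_coprime cong_sym coprime_1_left)
  then have "coprime (a' * x) k" using cop(1) by simp
  then obtain u where u: "[u = a' * x] (mod k)" "coprime u q"
    using unit_lift[of "a' * x" k q] k assms by auto
  have "[u * b' = a' * x * b'] (mod k)" using u(1) by (rule cong_scalar_right)
  also have "[a' * x * b' = a' * 1] (mod k)"
    using cong_scalar_left[OF x, of a'] by (simp add: ac_simps)
  finally have "[u * b' = a'] (mod k)" by simp
  then have "[g * (u * b') = g * a'] (mod g * k)" by (simp only: cong_def mod_mult_mult1)
  then have "[g * a' = g * (u * b')] (mod g * k)" by (rule cong_sym)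
  then have "[a = u * b] (mod q)" unfolding a b k by (simp only: mult.left_commute[of u g b'])
  with u(2) show "\<exists>u. coprime u q \<and> [a = u * b] (mod q)" by blast
next
  assume "\<exists>u. coprime u q \<and> [a = u * b] (mod q)"
  then obtain u where u: "coprime u q" "[a = u * b] (mod q)" by blast
  have "gcd a q = gcd (u * b) q" using u(2) by (rule cong_gcd_eq)
  also have "\<dots> = gcd b q" using u(1) by (simp add: gcd_mult_left_left_cancel coprime_commute)
  finally show "gcd a q = gcd b q" .
qed

lemma diag_assoc_iff_gcd:
  "0 < q \<Longrightarrow> diag_assoc q m D E \<longleftrightarrow> (\<forall>i<m. gcd (D $$ (i,i)) (int q) = gcd (E $$ (i,i)) (int q))"
  unfolding diag_assoc_def by (subst gcd_eq_iff_unit_multiple) auto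

text \<open>The conditions that \<open>is_snf_mod\<close> imposes on the form itself.\<close>

definition snf_form :: "nat \<Rightarrow> nat \<Rightarrow> nat \<Rightarrow> int mat \<Rightarrow> bool" where
  "snf_form q n m D \<longleftrightarrow> D \<in> carrier_mat n m \<and> diagonal_mat D \<and>
     (\<forall>i. i + 1 < m \<longrightarrow> (\<exists>c. [D $$ (i+1,i+1) = c * D $$ (i,i)] (mod int q)))"

lemma is_snf_mod_iff:
  "M \<in> carrier_mat n m \<Longrightarrow> is_snf_mod q n m M E \<longleftrightarrow> snf_form q n m E \<and> equiv_mod q M E"
  unfolding is_snf_mod_def snf_form_def equiv_mod_def by auto

lemma snf_mats_imp_snf_form: "D \<in> snf_mats n m \<Longrightarrow> snf_form q n m D"
  unfolding snf_mats_def snf_form_def by (auto simp: dvd_def) (metis cong_refl mult.commute)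

lemma snf_form_dvd_mono:
  assumes "snf_form q n m D" "d dvd int q" "d dvd D $$ (i,i)" "i \<le> j" "j < m"
  shows "d dvd D $$ (j,j)"
  using assms(4,5)
proof (induction j rule: dec_induct)
  case base
  then show ?case using assms(3) by simp
next
  case (step j)
  then obtain c where "[D $$ (j+1,j+1) = c * D $$ (j,j)] (mod int q)"
    using assms(1) unfolding snf_form_def by auto
  then have "[D $$ (j+1,j+1) = c * D $$ (j,j)] (mod d)" using assms(2) by (rule cong_dvd_modulus)
  moreover have "d dvd c * D $$ (j,j)" using step by simp
  ultimately show ?case by (simp add: cong_dvd_iff)
qed

text \<open>Compare the kernels modulo \<open>d = gcd(D\<^sub>j\<^sub>j, q)\<close>. The first \<open>j\<close> factors agree by hypothesis and the
  later factors of \<open>D\<close> are all equal to \<open>d\<close>, the largest possible value; equality of the products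
  forces the factor of \<open>E\<close> at \<open>j\<close> to be \<open>d\<close> too.\<close>

lemma snf_form_dvd_step:
  assumes eq: "equiv_mod q D E" and D: "snf_form q n m D" and E: "snf_form q n m E"
    and mn: "m \<le> n" and q: "0 < q" and j: "j < m"
    and IH: "\<And>i. i < j \<Longrightarrow> gcd (D $$ (i,i)) (int q) = gcd (E $$ (i,i)) (int q)"
  shows "gcd (D $$ (j,j)) (int q) dvd E $$ (j,j)"
proof (rule ccontr)
  assume not: "\<not> gcd (D $$ (j,j)) (int q) dvd E $$ (j,j)"
  define d where "d = nat (gcd (D $$ (j,j)) (int q))"
  have d: "int d = gcd (D $$ (j,j)) (int q)" by (simp add: d_def)
  have dq: "d dvd q" using d by (metis gcd_dvd2 int_dvd_int_iff)
  have d0: "0 < d" using q unfolding d_def by simp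
  have Dc: "D \<in> carrier_mat n m" "diagonal_mat D" and Ec: "E \<in> carrier_mat n m" "diagonal_mat E"
    using D E by (auto simp: snf_form_def)
  let ?f = "\<lambda>i. gcd (D $$ (i,i)) (int d)" and ?g = "\<lambda>i. gcd (E $$ (i,i)) (int d)"
  have "kernel_count d d D = kernel_count d d E"
    by (rule kernel_count_equiv_mod[OF equiv_mod_dvd[OF eq dq] _ d0]) simp
  then have prods: "(\<Prod>i<m. ?f i) = (\<Prod>i<m. ?g i)"
    using kernel_count_diagonal[OF Dc mn _ d0, of d] kernel_count_diagonal[OF Ec mn _ d0, of d] d0
    by simp
  have le: "0 < ?g i \<and> ?g i \<le> ?f i" if "i < m" for i
  proof (cases "i < j")
    case True
    have "gcd (gcd (D $$ (i,i)) (int q)) (int d) = gcd (gcd (E $$ (i,i)) (int q)) (int d)"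
      using IH[OF True] by simp
    then have "?f i = ?g i" using dq by (simp add: gcd.assoc gcd_proj2_if_dvd)
    then show ?thesis using d0 by simp
  next
    case False
    have "int d dvd D $$ (i,i)"
      by (rule snf_form_dvd_mono[OF D _ _ _ that]) (use False d dq in auto)
    then have "?f i = int d" by (simp add: gcd_proj2_if_dvd)
    then show ?thesis using d0 by (auto intro: zdvd_imp_le)
  qed
  have "int d dvd D $$ (j,j)" unfolding d by simp
  then have fj: "?f j = int d" by (simp add: gcd_proj2_if_dvd)
  moreover have "?g j \<noteq> int d" using not d by (metis gcd_dvd1)
  ultimately have lt: "?g j < ?f j" using le[OF j] by linarith
  have "(\<Prod>i<m. ?g i) = ?g j * (\<Prod>i\<in>{..<m} - {j}. ?g i)" using j by (intro prod.remove) auto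
  also have "\<dots> < ?f j * (\<Prod>i\<in>{..<m} - {j}. ?f i)"
  proof (rule mult_less_le_imp_less[OF lt])
    show "(\<Prod>i\<in>{..<m} - {j}. ?g i) \<le> (\<Prod>i\<in>{..<m} - {j}. ?f i)"
      using le by (intro prod_mono) auto
    show "0 \<le> ?g j" by simp
    show "0 < (\<Prod>i\<in>{..<m} - {j}. ?g i)" using le by (intro prod_pos) auto
  qed
  also have "\<dots> = (\<Prod>i<m. ?f i)" using j by (intro prod.remove[symmetric]) auto
  finally show False using prods by simp
qed

theorem snf_form_unique:
  assumes "equiv_mod q D E" "snf_form q n m D" "snf_form q n m E" "m \<le> n" "0 < q" "j < m"
  shows "gcd (D $$ (j,j)) (int q) = gcd (E $$ (j,j)) (int q)"
  using assms(6)
proof (induction j rule: less_induct)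
  case (less j)
  have "gcd (D $$ (j,j)) (int q) dvd E $$ (j,j)"
    using less by (intro snf_form_dvd_step[OF assms(1-5)]) auto
  moreover have "gcd (E $$ (j,j)) (int q) dvd D $$ (j,j)"
    using less by (intro snf_form_dvd_step[OF equiv_mod_sym[OF assms(1)] assms(3,2,4,5)]) auto
  ultimately show ?case by (intro zdvd_antisym_nonneg) auto
qed

definition snf :: "int mat \<Rightarrow> int mat" where
  "snf M = (SOME E. is_snf (dim_row M) (dim_col M) M E)"

text \<open>By uniqueness this depends only on \<open>M\<close> modulo \<open>q\<close>. It is defined through one Smith form over
  \<open>\<int>\<close>, chosen independently of \<open>q\<close>, so that types modulo different \<open>q\<close> can be compared.\<close>

definition snf_type :: "nat \<Rightarrow> int mat \<Rightarrow> nat \<Rightarrow> int" where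
  "snf_type q M j = gcd (snf M $$ (j,j)) (int q)"

lemma is_snf_snf:
  assumes "m \<le> n" "M \<in> carrier_mat n m"
  shows "is_snf n m M (snf M)"
  using someI_ex[OF is_snf_exists[OF assms]] assms(2) by (auto simp: snf_def)

lemma snf_in_snf_mats: "m \<le> n \<Longrightarrow> M \<in> carrier_mat n m \<Longrightarrow> snf M \<in> snf_mats n m"
  using is_snf_snf unfolding is_snf_def by blast

lemma equiv_mod_snf:
  assumes "m \<le> n" "M \<in> carrier_mat n m"
  shows "equiv_mod q M (snf M)"
  using is_snf_snf[OF assms] assms(2) by (auto simp: is_snf_iff_equiv_mod_0 intro: equiv_mod_dvd)

lemma snf_type_eqI:
  assumes "m \<le> n" "M \<in> carrier_mat n m" "0 < q" "equiv_mod q M E" "snf_form q n m E" "j < m"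
  shows "snf_type q M j = gcd (E $$ (j,j)) (int q)"
proof -
  have "equiv_mod q (snf M) E"
    using equiv_mod_sym[OF equiv_mod_snf[OF assms(1,2)]] assms(4) by (rule equiv_mod_trans)
  then show ?thesis
    unfolding snf_type_def
    using snf_form_unique[OF _ snf_mats_imp_snf_form[OF snf_in_snf_mats[OF assms(1,2)]] assms(5,1,3,6)]
    by blast
qed

lemma snf_type_equiv_mod:
  assumes "m \<le> n" "M \<in> carrier_mat n m" "0 < q" "equiv_mod q M N" "j < m"
  shows "snf_type q M j = snf_type q N j"
proof -
  have N: "N \<in> carrier_mat n m" by (rule equiv_mod_carrier[OF assms(4,2)])
  show ?thesis
    unfolding snf_type_def[of q N]
    by (rule snf_type_eqI[OF assms(1-3) equiv_mod_trans[OF assms(4) equiv_mod_snf[OF assms(1) N]]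
      snf_mats_imp_snf_form[OF snf_in_snf_mats[OF assms(1) N]] assms(5)])
qed

text \<open>The common content of the events in \<open>mu_mod\<close> and \<open>mu_box\<close>.\<close>

definition has_type_in :: "nat \<Rightarrow> nat \<Rightarrow> int mat set \<Rightarrow> int mat \<Rightarrow> bool" where
  "has_type_in m q S M \<longleftrightarrow> (\<exists>D\<in>S. \<forall>j<m. gcd (D $$ (j,j)) (int q) = snf_type q M j)"

lemma mod_event_iff:
  assumes "m \<le> n" "M \<in> carrier_mat n m" "0 < q"
  shows "(\<exists>E. is_snf_mod q n m M E \<and> (\<exists>D\<in>S. diag_assoc q m D E)) \<longleftrightarrow> has_type_in m q S M"
proof
  assume "\<exists>E. is_snf_mod q n m M E \<and> (\<exists>D\<in>S. diag_assoc q m D E)"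
  then obtain E D where E: "snf_form q n m E" "equiv_mod q M E" and D: "D \<in> S" "diag_assoc q m D E"
    using is_snf_mod_iff[OF assms(2)] by blast
  have "gcd (D $$ (j,j)) (int q) = snf_type q M j" if "j < m" for j
    using D(2) that snf_type_eqI[OF assms E(2,1) that] by (simp add: diag_assoc_iff_gcd[OF assms(3)])
  with D(1) show "has_type_in m q S M" unfolding has_type_in_def by blast
next
  assume "has_type_in m q S M"
  then obtain D where D: "D \<in> S" "\<forall>j<m. gcd (D $$ (j,j)) (int q) = snf_type q M j"
    unfolding has_type_in_def by blast
  then have "diag_assoc q m D (snf M)" by (simp add: diag_assoc_iff_gcd[OF assms(3)] snf_type_def)
  moreover have "is_snf_mod q n m M (snf M)"
    unfolding is_snf_mod_iff[OF assms(2)]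
    using equiv_mod_snf[OF assms(1,2)] snf_mats_imp_snf_form[OF snf_in_snf_mats[OF assms(1,2)]] by blast
  ultimately show "\<exists>E. is_snf_mod q n m M E \<and> (\<exists>D\<in>S. diag_assoc q m D E)" using D(1) by blast
qed

lemma integer_event_iff:
  assumes "m \<le> n" "M \<in> carrier_mat n m" "0 < q"
  shows "(\<exists>E. is_snf n m M E \<and> (\<exists>D\<in>S. diag_assoc q m D E)) \<longleftrightarrow> has_type_in m q S M"
proof
  assume "\<exists>E. is_snf n m M E \<and> (\<exists>D\<in>S. diag_assoc q m D E)"
  then obtain E D where E: "E \<in> snf_mats n m" "equiv_mod 0 M E" and D: "D \<in> S" "diag_assoc q m D E"
    using is_snf_iff_equiv_mod_0[OF assms(2)] by blast
  have "equiv_mod q M E" using E(2) by (rule equiv_mod_dvd) simp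
  then have "is_snf_mod q n m M E"
    using snf_mats_imp_snf_form[OF E(1)] is_snf_mod_iff[OF assms(2)] by blast
  with D show "has_type_in m q S M" using mod_event_iff[OF assms] by blast
next
  assume "has_type_in m q S M"
  then obtain D where D: "D \<in> S" "\<forall>j<m. gcd (D $$ (j,j)) (int q) = snf_type q M j"
    unfolding has_type_in_def by blast
  then have "diag_assoc q m D (snf M)" by (simp add: diag_assoc_iff_gcd[OF assms(3)] snf_type_def)
  then show "\<exists>E. is_snf n m M E \<and> (\<exists>D\<in>S. diag_assoc q m D E)"
    using D(1) is_snf_snf[OF assms(1,2)] by blast
qed

lemma has_type_in_equiv_mod:
  assumes "m \<le> n" "M \<in> carrier_mat n m" "0 < q" "equiv_mod q M N"
  shows "has_type_in m q S M \<longleftrightarrow> has_type_in m q S N"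
  unfolding has_type_in_def using snf_type_equiv_mod[OF assms] by auto

section \<open>Probabilities as counts of residue matrices\<close>

lemma random_mat_eq_pmf_of_set:
  assumes "finite A" "A \<noteq> {}"
  shows "random_mat n m A = pmf_of_set (entry_mats n m (\<lambda>_ _. A))"
proof -
  let ?F = "PiE_dflt ({..<n} \<times> {..<m}) (0::int) (\<lambda>(i,j). A)"
  have F: "(\<lambda>(i,j). A) = (\<lambda>_::nat \<times> nat. A)" by auto
  have bij: "bij_betw (mat n m) ?F (entry_mats n m (\<lambda>_ _. A))" by (rule bij_betw_entry_mats)
  have fin: "finite ?F" using assms(1) by (intro finite_PiE_dflt) auto
  have "(\<lambda>x. if x \<in> {..<n} \<times> {..<m} then SOME a. a \<in> A else 0) \<in> ?F"
    using some_in_eq[of A] assms(2) by (auto simp: PiE_dflt_def)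
  then have ne: "?F \<noteq> {}" by blast
  have "random_mat n m A = map_pmf (mat n m) (pmf_of_set ?F)"
    unfolding random_mat_def using assms F by (subst Pi_pmf_of_set) auto
  also have "\<dots> = pmf_of_set (mat n m ` ?F)"
    using bij fin ne by (intro map_pmf_of_set_inj) (auto simp: bij_betw_def)
  finally show ?thesis using bij by (simp add: bij_betw_def)
qed

lemma prob_random_mat:
  assumes "finite A" "A \<noteq> {}" "\<And>M. M \<in> carrier_mat n m \<Longrightarrow> M \<in> X \<longleftrightarrow> G M"
  shows "measure_pmf.prob (random_mat n m A) X =
    real (card {M \<in> entry_mats n m (\<lambda>_ _. A). G M}) / real (card A) ^ (n * m)"
proof -
  let ?E = "entry_mats n m (\<lambda>_ _. A)"
  have fin: "finite ?E" using assms(1) by (intro finite_entry_mats)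
  have card: "card ?E = card A ^ (n * m)"
    using assms(1) by (subst card_entry_mats) (simp_all add: power_mult[symmetric] mult.commute)
  then have ne: "?E \<noteq> {}" using assms(1,2) by force
  have "?E \<inter> X = {M \<in> ?E. G M}" using assms(3) by (auto simp: entry_mats_def)
  then show ?thesis
    unfolding random_mat_eq_pmf_of_set[OF assms(1,2)] measure_pmf_of_set[OF ne fin] card by simp
qed

definition residue_prob :: "nat \<Rightarrow> nat \<Rightarrow> nat \<Rightarrow> (int mat \<Rightarrow> bool) \<Rightarrow> real" where
  "residue_prob n m q G = real (card {M \<in> residue_mats n m q. G M}) / real q ^ (n * m)"

lemma mu_mod_eq_residue_prob:
  assumes "m \<le> n" "0 < q"
  shows "mu_mod n m q S = residue_prob n m q (has_type_in m q S)"
  unfolding mu_mod_def residue_prob_def residue_mats_def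
  using prob_random_mat[of "{0..<int q}" n m
      "{M. \<exists>E. is_snf_mod q n m M E \<and> (\<exists>D\<in>S. diag_assoc q m D E)}" "has_type_in m q S"]
    mod_event_iff[OF assms(1) _ assms(2)] assms(2) by simp

lemma mu_box_eq_card:
  assumes "m \<le> n" "0 < q"
  shows "mu_box n m k q S =
    real (card {M \<in> entry_mats n m (\<lambda>_ _. {- int k..int k}). has_type_in m q S M}) /
      real (2 * k + 1) ^ (n * m)"
proof -
  have "card {- int k..int k} = 2 * k + 1" by simp
  then show ?thesis
    unfolding mu_box_def
    using prob_random_mat[of "{- int k..int k}" n m
      "{M. \<exists>E. is_snf n m M E \<and> (\<exists>D\<in>S. diag_assoc q m D E)}" "has_type_in m q S"]
      integer_event_iff[OF assms(1) _ assms(2)] by simp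
qed

text \<open>Classes correspond bijectively to the tuples of gcds realised in \<open>S\<close>, of which there are finitely
  many, and a matrix has exactly one type.\<close>

lemma mu_mod_eq_sum_classes:
  assumes "m \<le> n" "0 < q"
  shows "mu_mod n m q S = (\<Sum>C\<in>classes_mod q m S. mu_mod n m q {class_rep C})"
proof -
  define R where "R = {(D, E). D \<in> S \<and> E \<in> S \<and> diag_assoc q m D E}"
  define ty where "ty D = restrict (\<lambda>j. gcd (D $$ (j,j)) (int q)) {..<m}" for D :: "int mat"
  define st where "st M = restrict (snf_type q M) {..<m}" for M
  have assoc: "diag_assoc q m D E \<longleftrightarrow> ty D = ty E" for D E
    unfolding diag_assoc_iff_gcd[OF assms(2)] ty_def by (auto simp: restrict_def fun_eq_iff)
  have has: "has_type_in m q S' M \<longleftrightarrow> st M \<in> ty ` S'" for S' M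
  proof -
    have "(\<forall>j<m. gcd (D $$ (j,j)) (int q) = snf_type q M j) \<longleftrightarrow> st M = ty D" for D
      unfolding ty_def st_def by (auto simp: restrict_def fun_eq_iff)
    then show ?thesis unfolding has_type_in_def by auto
  qed
  have equiv: "equiv S R"
    by (rule equivI) (auto simp: R_def assoc refl_on_def sym_def trans_def)
  have R_ty: "ty D = ty E" if "(D, E) \<in> R" for D E using that by (simp add: R_def assoc)
  have classes: "classes_mod q m S = S // R" by (simp add: classes_mod_def R_def)
  have rep: "class_rep C \<in> C" if "C \<in> S // R" for C
    using in_quotient_imp_non_empty[OF equiv that] by (simp add: class_rep_def some_in_eq)
  have bij: "bij_betw (\<lambda>C. ty (class_rep C)) (S // R) (ty ` S)"
  proof (rule bij_betw_imageI)
    show "inj_on (\<lambda>C. ty (class_rep C)) (S // R)"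
    proof (rule inj_onI)
      fix C C' assume C: "C \<in> S // R" "C' \<in> S // R" "ty (class_rep C) = ty (class_rep C')"
      have "class_rep C \<in> S" "class_rep C' \<in> S"
        using rep[OF C(1)] rep[OF C(2)] in_quotient_imp_subset[OF equiv] C(1,2) by blast+
      then have "(class_rep C, class_rep C') \<in> R" using C(3) by (simp add: R_def assoc)
      then show "C = C'" by (rule quotient_eqI[OF equiv C(1,2) rep[OF C(1)] rep[OF C(2)]])
    qed
    show "(\<lambda>C. ty (class_rep C)) ` (S // R) = ty ` S"
    proof (intro equalityI subsetI)
      fix t assume "t \<in> (\<lambda>C. ty (class_rep C)) ` (S // R)"
      then show "t \<in> ty ` S" using rep in_quotient_imp_subset[OF equiv] by blast
    next
      fix t assume "t \<in> ty ` S"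
      then obtain D where D: "D \<in> S" "t = ty D" by blast
      have C: "R `` {D} \<in> S // R" using D(1) by (rule quotientI)
      have "(D, class_rep (R `` {D})) \<in> R" using rep[OF C] by blast
      then have "t = ty (class_rep (R `` {D}))" unfolding D(2) by (rule R_ty)
      then show "t \<in> (\<lambda>C. ty (class_rep C)) ` (S // R)" using C by blast
    qed
  qed
  have fin: "finite (ty ` S)"
  proof (rule finite_subset)
    show "ty ` S \<subseteq> {..<m} \<rightarrow>\<^sub>E {0..int q}"
    proof (rule image_subsetI)
      fix D show "ty D \<in> {..<m} \<rightarrow>\<^sub>E {0..int q}"
        unfolding ty_def restrict_PiE_iff using assms(2) by (auto intro: zdvd_imp_le)
    qed
    show "finite ({..<m} \<rightarrow>\<^sub>E {0..int q})" by (intro finite_PiE) auto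
  qed
  let ?N = "\<lambda>t. card {M \<in> residue_mats n m q. st M = t}"
  have "{M \<in> residue_mats n m q. has_type_in m q S M} =
      (\<Union>t\<in>ty ` S. {M \<in> residue_mats n m q. st M = t})"
    unfolding has by auto
  also have "card \<dots> = (\<Sum>t\<in>ty ` S. ?N t)"
    using fin by (intro card_UN_disjoint) auto
  finally have "mu_mod n m q S = (\<Sum>t\<in>ty ` S. real (?N t) / real q ^ (n * m))"
    unfolding mu_mod_eq_residue_prob[OF assms] residue_prob_def by (simp add: sum_divide_distrib)
  also have "\<dots> = (\<Sum>C\<in>S // R. real (?N (ty (class_rep C))) / real q ^ (n * m))"
    by (rule sum.reindex_bij_betw[OF bij, symmetric])
  also have "\<dots> = (\<Sum>C\<in>S // R. mu_mod n m q {class_rep C})"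
    unfolding mu_mod_eq_residue_prob[OF assms] residue_prob_def has by simp
  finally show ?thesis by (simp add: classes)
qed

section \<open>Equidistribution of large boxes\<close>

lemma card_residue_class_interval:
  assumes "0 \<le> a" "a < int q" "q \<le> k"
  shows "int (card {x \<in> {- int k..int k}. x mod int q = a}) =
    (int k - a) div int q + (int k + a) div int q + 1"
proof -
  have q: "0 < int q" using assms by linarith
  have bij: "bij_betw (\<lambda>t. a + int q * t) {- ((int k + a) div int q)..(int k - a) div int q}
      {x \<in> {- int k..int k}. x mod int q = a}"
  proof (rule bij_betw_imageI)
    show "inj_on (\<lambda>t. a + int q * t) {- ((int k + a) div int q)..(int k - a) div int q}"
      using q by (auto simp: inj_on_def)
    have le_div: "t \<le> x div int q \<longleftrightarrow> int q * t \<le> x" for t x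
    proof
      assume "t \<le> x div int q"
      then have "int q * t \<le> int q * (x div int q)" by (rule mult_left_mono) simp
      also have "\<dots> \<le> x" using mult_div_mod_eq[of "int q" x] pos_mod_sign[OF q, of x] by linarith
      finally show "int q * t \<le> x" .
    next
      assume "int q * t \<le> x"
      then have "(int q * t) div int q \<le> x div int q" using q by (rule zdiv_mono1)
      then show "t \<le> x div int q" using q by simp
    qed
    have iff: "t \<in> {- ((int k + a) div int q)..(int k - a) div int q} \<longleftrightarrow>
        a + int q * t \<in> {- int k..int k}" for t
    proof -
      have "t \<le> (int k - a) div int q \<longleftrightarrow> a + int q * t \<le> int k"
        unfolding le_div by linarith
      moreover have "- t \<le> (int k + a) div int q \<longleftrightarrow> - int k \<le> a + int q * t"
        unfolding le_div by (simp add: algebra_simps, linarith)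
      ultimately show ?thesis by auto
    qed
    show "(\<lambda>t. a + int q * t) ` {- ((int k + a) div int q)..(int k - a) div int q} =
        {x \<in> {- int k..int k}. x mod int q = a}"
    proof (intro equalityI subsetI)
      fix x assume "x \<in> (\<lambda>t. a + int q * t) ` {- ((int k + a) div int q)..(int k - a) div int q}"
      then obtain t where t: "x = a + int q * t" "a + int q * t \<in> {- int k..int k}"
        by (elim imageE) (simp only: iff)
      moreover have "(a + int q * t) mod int q = a" using assms(1,2) by simp
      ultimately show "x \<in> {x \<in> {- int k..int k}. x mod int q = a}" by simp
    next
      fix x assume x: "x \<in> {x \<in> {- int k..int k}. x mod int q = a}"
      then have eq: "x = a + int q * (x div int q)"
        using mod_mult_div_eq[of x "int q"] by simp
      have "a + int q * (x div int q) \<in> {- int k..int k}" using x unfolding eq[symmetric] by blast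
      then have "x div int q \<in> {- ((int k + a) div int q)..(int k - a) div int q}"
        by (simp only: iff)
      with eq show "x \<in> (\<lambda>t. a + int q * t) ` {- ((int k + a) div int q)..(int k - a) div int q}"
        by blast
    qed
  qed
  have "0 \<le> (int k - a) div int q" "0 \<le> (int k + a) div int q"
    using q assms by (auto simp: pos_imp_zdiv_nonneg_iff)
  then show ?thesis using bij_betw_same_card[OF bij] by simp
qed

lemma residue_class_density:
  assumes "0 \<le> a" "a < int q"
  shows "(\<lambda>k. real (card {x \<in> {- int k..int k}. x mod int q = a}) / real (2 * k + 1))
    \<longlonglongrightarrow> 1 / real q"
proof -
  have q: "0 < real q" using assms by simp
  let ?c = "\<lambda>k. real (card {x \<in> {- int k..int k}. x mod int q = a})"
  \<comment> \<open>The count is one plus two rounded-down quotients, so it is off by at most 2.\<close>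
  have bound: "\<bar>?c k / real (2 * k + 1) - 1 / real q\<bar> \<le> 2 / real (2 * k + 1)" if k: "q \<le> k" for k
  proof -
    let ?u = "(int k - a) div int q" and ?v = "(int k + a) div int q"
    have c: "?c k = of_int ?u + of_int ?v + 1"
      using arg_cong[OF card_residue_class_interval[OF assms k], of real_of_int]
      by (simp only: of_int_of_nat_eq of_int_add of_int_1)
    have s: "(real k - of_int a) / real q + (real k + of_int a) / real q = 2 * real k / real q"
      by (simp add: add_divide_distrib diff_divide_distrib)
    have "real_of_int ?u \<le> (real k - of_int a) / real q" "real_of_int ?v \<le> (real k + of_int a) / real q"
      using real_of_int_div4[of "int k - a" "int q"] real_of_int_div4[of "int k + a" "int q"] by simp_all
    moreover have "(real k - of_int a) / real q - real_of_int ?u \<le> 1"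
        "(real k + of_int a) / real q - real_of_int ?v \<le> 1"
      using real_of_int_div3[of "int k - a" "int q"] real_of_int_div3[of "int k + a" "int q"] by simp_all
    ultimately have "2 * real k / real q - 1 \<le> ?c k" "?c k \<le> 2 * real k / real q + 1"
      unfolding c s[symmetric] by linarith+
    moreover have "1 / real q \<le> 1" "0 \<le> 1 / real q" using q by auto
    moreover have "real (2 * k + 1) / real q = 2 * real k / real q + 1 / real q"
      by (simp add: add_divide_distrib)
    ultimately have "\<bar>?c k - real (2 * k + 1) / real q\<bar> \<le> 2" by linarith
    then have "\<bar>?c k - real (2 * k + 1) / real q\<bar> / real (2 * k + 1) \<le> 2 / real (2 * k + 1)"
      by (intro divide_right_mono) auto
    moreover have "?c k / real (2 * k + 1) - 1 / real q =
        (?c k - real (2 * k + 1) / real q) / real (2 * k + 1)"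
      by (simp add: diff_divide_distrib)
    ultimately show ?thesis by (simp add: abs_divide)
  qed
  have "(\<lambda>k. 2 / real (2 * k + 1)) \<longlonglongrightarrow> 0"
    by real_asymp
  moreover have "\<forall>\<^sub>F k in sequentially. norm (?c k / real (2 * k + 1) - 1 / real q) \<le> 2 / real (2 * k + 1)"
    using eventually_ge_at_top[of q] by eventually_elim (use bound in auto)
  ultimately have "(\<lambda>k. ?c k / real (2 * k + 1) - 1 / real q) \<longlonglongrightarrow> 0"
    by (rule Lim_null_comparison[rotated])
  then show ?thesis by (simp add: LIM_zero_iff)
qed

text \<open>A predicate depending on residues only is a disjoint union of residue classes of matrices, each
  of which is a product over the entries.\<close>

lemma card_entry_mats_by_residue:
  assumes q: "0 < q" and A: "finite A"
    and G: "\<And>M N. M \<in> carrier_mat n m \<Longrightarrow> cong_mat q M N \<Longrightarrow> G M \<longleftrightarrow> G N"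
  shows "card {M \<in> entry_mats n m (\<lambda>_ _. A). G M} =
    (\<Sum>N | N \<in> residue_mats n m q \<and> G N. \<Prod>i<n. \<Prod>j<m. card {x \<in> A. x mod int q = N $$ (i,j)})"
proof -
  let ?E = "entry_mats n m (\<lambda>_ _. A)" and ?T = "{N \<in> residue_mats n m q. G N}"
  let ?F = "\<lambda>N. entry_mats n m (\<lambda>i j. {x \<in> A. x mod int q = N $$ (i,j)})"
  have "?F N = {M \<in> ?E. reduce q M = N}" if "N \<in> ?T" for N
  proof -
    have N: "N \<in> carrier_mat n m" using that residue_mats_carrier by blast
    have "reduce q M = N \<longleftrightarrow> (\<forall>i<n. \<forall>j<m. M $$ (i,j) mod int q = N $$ (i,j))"
      if "M \<in> carrier_mat n m" for M
      using that N by (auto simp: reduce_def mat_eq_iff)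
    then show ?thesis unfolding entry_mats_def by blast
  qed
  note F = this
  have "{M \<in> ?E. G M} = (\<Union>N\<in>?T. ?F N)"
  proof (intro equalityI subsetI)
    fix M assume M: "M \<in> {M \<in> ?E. G M}"
    then have c: "M \<in> carrier_mat n m" by (simp add: entry_mats_def)
    have "reduce q M \<in> ?T"
      using reduce_in_residue_mats[OF c q] G[OF c cong_mat_sym[OF cong_mat_reduce]] M by simp
    with M F show "M \<in> (\<Union>N\<in>?T. ?F N)" by blast
  next
    fix M assume "M \<in> (\<Union>N\<in>?T. ?F N)"
    then obtain N where N: "N \<in> ?T" "M \<in> ?E" "reduce q M = N" using F by blast
    then have c: "M \<in> carrier_mat n m" by (simp add: entry_mats_def)
    show "M \<in> {M \<in> ?E. G M}" using G[OF c cong_mat_sym[OF cong_mat_reduce]] N by auto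
  qed
  moreover have "card (\<Union>N\<in>?T. ?F N) = (\<Sum>N\<in>?T. card (?F N))"
  proof (rule card_UN_disjoint)
    show "\<forall>N\<in>?T. finite (?F N)" using A by (intro ballI finite_entry_mats) auto
    show "\<forall>N\<in>?T. \<forall>N'\<in>?T. N \<noteq> N' \<longrightarrow> ?F N \<inter> ?F N' = {}"
    proof (intro ballI impI)
      fix N N' assume N: "N \<in> ?T" "N' \<in> ?T" "N \<noteq> N'"
      show "?F N \<inter> ?F N' = {}" unfolding F[OF N(1)] F[OF N(2)] using N(3) by blast
    qed
  qed simp
  moreover have "card (?F N) = (\<Prod>i<n. \<Prod>j<m. card {x \<in> A. x mod int q = N $$ (i,j)})" for N
    using A by (intro card_entry_mats) auto
  ultimately show ?thesis by simp
qed

lemma mu_box_tendsto_mu_mod: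
  assumes mn: "m \<le> n" and q: "0 < q"
  shows "(\<lambda>k. mu_box n m k q S) \<longlonglongrightarrow> mu_mod n m q S"
proof -
  let ?T = "{N \<in> residue_mats n m q. has_type_in m q S N}"
  let ?c = "\<lambda>k a. real (card {x \<in> {- int k..int k}. x mod int q = a})"
  have G: "has_type_in m q S M \<longleftrightarrow> has_type_in m q S N"
    if "M \<in> carrier_mat n m" "cong_mat q M N" for M N
    by (rule has_type_in_equiv_mod[OF mn that(1) q cong_mat_imp_equiv_mod[OF that(2)]])
  have box: "mu_box n m k q S =
      (\<Sum>N\<in>?T. \<Prod>i<n. \<Prod>j<m. ?c k (N $$ (i,j)) / real (2 * k + 1))" for k
    unfolding mu_box_eq_card[OF mn q]
    by (subst card_entry_mats_by_residue[OF q _ G])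
      (auto simp: sum_divide_distrib prod_dividef power_mult[symmetric] mult.commute)
  have lim: "(\<Sum>N\<in>?T. \<Prod>i<n. \<Prod>j<m. 1 / real q) = mu_mod n m q S"
    unfolding mu_mod_eq_residue_prob[OF mn q] residue_prob_def
    by (simp add: power_mult[symmetric] power_one_over mult.commute[of n m] divide_inverse power_inverse)
  show ?thesis
    unfolding box lim[symmetric]
    by (intro tendsto_sum tendsto_prod residue_class_density)
      (auto simp: residue_mats_def entry_mats_def)
qed

section \<open>Coprime moduli\<close>

lemma restricted_image_prod:
  assumes "(\<lambda>x. (f x, g x)) ` A = B \<times> C"
    and "\<And>x. x \<in> A \<Longrightarrow> P (f x) \<longleftrightarrow> P' x" "\<And>x. x \<in> A \<Longrightarrow> Q (g x) \<longleftrightarrow> Q' x"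
  shows "(\<lambda>x. (f x, g x)) ` {x \<in> A. P' x \<and> Q' x} = {y \<in> B. P y} \<times> {z \<in> C. Q z}"
proof -
  have "{y \<in> B. P y} \<times> {z \<in> C. Q z} = {w \<in> B \<times> C. P (fst w) \<and> Q (snd w)}" by auto
  also have "\<dots> = (\<lambda>x. (f x, g x)) ` {x \<in> A. P (f x) \<and> Q (g x)}"
    unfolding assms(1)[symmetric] by auto
  also have "{x \<in> A. P (f x) \<and> Q (g x)} = {x \<in> A. P' x \<and> Q' x}" using assms(2,3) by blast
  finally show ?thesis ..
qed

text \<open>The Chinese remainder theorem for matrices. Injectivity of the pair of reductions is enough, since
  both sides have \<open>(q r)\<^sup>n\<^sup>m\<close> elements.\<close>

lemma card_residue_mats_coprime:
  assumes cop: "coprime q r" and q: "0 < q" and r: "0 < r"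
    and G: "\<And>M N. M \<in> carrier_mat n m \<Longrightarrow> cong_mat q M N \<Longrightarrow> G M \<longleftrightarrow> G N"
    and H: "\<And>M N. M \<in> carrier_mat n m \<Longrightarrow> cong_mat r M N \<Longrightarrow> H M \<longleftrightarrow> H N"
  shows "card {M \<in> residue_mats n m (q * r). G M \<and> H M} =
    card {M \<in> residue_mats n m q. G M} * card {M \<in> residue_mats n m r. H M}"
proof -
  let ?f = "\<lambda>M. (reduce q M, reduce r M)"
  have inj: "inj_on ?f (residue_mats n m (q * r))"
  proof (rule inj_onI)
    fix A B assume AB: "A \<in> residue_mats n m (q * r)" "B \<in> residue_mats n m (q * r)" "?f A = ?f B"
    have "cong_mat q A B" "cong_mat r A B"
      using AB(3) cong_mat_trans[OF cong_mat_sym[OF cong_mat_reduce[of q A]], of B]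
        cong_mat_trans[OF cong_mat_sym[OF cong_mat_reduce[of r A]], of B]
        cong_mat_reduce[of q B] cong_mat_reduce[of r B] by simp_all
    then have "cong_mat (q * r) A B"
      unfolding cong_mat_def using cop by (auto intro!: coprime_cong_mult)
    then show "A = B" using AB(1,2) by (rule cong_mat_residue_mats_eq)
  qed
  have "?f ` residue_mats n m (q * r) = residue_mats n m q \<times> residue_mats n m r"
  proof (rule card_subset_eq)
    show "?f ` residue_mats n m (q * r) \<subseteq> residue_mats n m q \<times> residue_mats n m r"
      using reduce_in_residue_mats[OF residue_mats_carrier] q r by blast
    show "card (?f ` residue_mats n m (q * r)) = card (residue_mats n m q \<times> residue_mats n m r)"
      unfolding card_image[OF inj] card_cartesian_product card_residue_mats
      by (rule power_mult_distrib)
  qed simp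
  moreover have "G (reduce q M) \<longleftrightarrow> G M" "H (reduce r M) \<longleftrightarrow> H M"
    if "M \<in> residue_mats n m (q * r)" for M
    using G[OF residue_mats_carrier[OF that] cong_mat_sym[OF cong_mat_reduce]]
      H[OF residue_mats_carrier[OF that] cong_mat_sym[OF cong_mat_reduce]] by simp_all
  ultimately have "?f ` {M \<in> residue_mats n m (q * r). G M \<and> H M} =
      {M \<in> residue_mats n m q. G M} \<times> {M \<in> residue_mats n m r. H M}"
    by (intro restricted_image_prod) simp_all
  then have "card (?f ` {M \<in> residue_mats n m (q * r). G M \<and> H M}) =
      card {M \<in> residue_mats n m q. G M} * card {M \<in> residue_mats n m r. H M}"
    by (simp only: card_cartesian_product)
  moreover have "inj_on ?f {M \<in> residue_mats n m (q * r). G M \<and> H M}"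
    by (rule inj_on_subset[OF inj]) blast
  ultimately show ?thesis by (simp only: card_image)
qed

lemma residue_prob_prod:
  assumes "finite I" and q: "\<And>i. i \<in> I \<Longrightarrow> 0 < q i"
    and cop: "\<And>i j. i \<in> I \<Longrightarrow> j \<in> I \<Longrightarrow> i \<noteq> j \<Longrightarrow> coprime (q i) (q j)"
    and G: "\<And>i M N. i \<in> I \<Longrightarrow> M \<in> carrier_mat n m \<Longrightarrow> cong_mat (q i) M N \<Longrightarrow> G i M \<longleftrightarrow> G i N"
  shows "residue_prob n m (\<Prod>i\<in>I. q i) (\<lambda>M. \<forall>i\<in>I. G i M) = (\<Prod>i\<in>I. residue_prob n m (q i) (G i))"
  using assms
proof (induction I rule: finite_induct)
  case empty
  then show ?case by (simp add: residue_prob_def card_residue_mats)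
next
  case (insert i I)
  have cop: "coprime (q i) (\<Prod>i\<in>I. q i)"
    using insert.hyps insert.prems(2) by (intro prod_coprime_right) auto
  have inv: "(\<forall>i\<in>I. G i M) \<longleftrightarrow> (\<forall>i\<in>I. G i N)"
    if "M \<in> carrier_mat n m" "cong_mat (\<Prod>i\<in>I. q i) M N" for M N
  proof (rule ball_cong[OF refl])
    fix j assume j: "j \<in> I"
    have "q j dvd (\<Prod>i\<in>I. q i)" using insert.hyps(1) j by (rule dvd_prodI)
    then show "G j M \<longleftrightarrow> G j N"
      using insert.prems(3)[OF _ that(1) cong_mat_dvd[OF that(2)]] j by blast
  qed
  have pos: "0 < (\<Prod>i\<in>I. q i)" using insert.prems(1) by (intro prod_pos) auto
  have "card {M \<in> residue_mats n m (q i * (\<Prod>i\<in>I. q i)). G i M \<and> (\<forall>i\<in>I. G i M)} =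
      card {M \<in> residue_mats n m (q i). G i M} *
      card {M \<in> residue_mats n m (\<Prod>i\<in>I. q i). \<forall>i\<in>I. G i M}"
    by (rule card_residue_mats_coprime[OF cop _ pos _ inv])
      (use insert.prems(1,3) in auto)
  then have "residue_prob n m (\<Prod>i\<in>insert i I. q i) (\<lambda>M. \<forall>i\<in>insert i I. G i M) =
      residue_prob n m (q i) (G i) * residue_prob n m (\<Prod>i\<in>I. q i) (\<lambda>M. \<forall>i\<in>I. G i M)"
    using insert.hyps by (simp add: residue_prob_def power_mult_distrib)
  also have "residue_prob n m (\<Prod>i\<in>I. q i) (\<lambda>M. \<forall>i\<in>I. G i M) = (\<Prod>i\<in>I. residue_prob n m (q i) (G i))"
    using insert.prems by (intro insert.IH) auto
  finally show ?case using insert.hyps by simp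
qed

text \<open>The right-hand side is the gcd of \<open>a a\<close>, \<open>a c\<close>, \<open>b a\<close> and \<open>b c\<close>, all multiples of the left.\<close>

lemma gcd_mult_dvd: "gcd a (b * c) dvd gcd a b * gcd a c" for a b c :: int
proof -
  let ?g = "gcd a (b * c)"
  have "?g dvd gcd (c * a) (c * b)" by (simp add: mult.commute)
  then have "?g dvd c * gcd a b" by (simp add: gcd_mult_left)
  then have 1: "?g dvd gcd a b * c" by (simp add: mult.commute)
  have "?g dvd gcd a b * a" by simp
  with 1 have "?g dvd gcd (gcd a b * a) (gcd a b * c)" by simp
  then show ?thesis by (simp add: gcd_mult_left)
qed

text \<open>What makes membership in a class modulo \<open>q\<^sub>1 \<cdots> q\<^sub>r\<close> a conjunction of conditions modulo the
  factors.\<close>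

lemma gcd_eq_prod_iff:
  fixes a b :: int
  assumes "finite I" and cop: "\<And>i j. i \<in> I \<Longrightarrow> j \<in> I \<Longrightarrow> i \<noteq> j \<Longrightarrow> coprime (q i) (q j)"
  shows "gcd a (\<Prod>i\<in>I. q i) = gcd b (\<Prod>i\<in>I. q i) \<longleftrightarrow> (\<forall>i\<in>I. gcd a (q i) = gcd b (q i))"
proof
  assume eq: "gcd a (\<Prod>i\<in>I. q i) = gcd b (\<Prod>i\<in>I. q i)"
  show "\<forall>i\<in>I. gcd a (q i) = gcd b (q i)"
  proof
    fix i assume "i \<in> I"
    then have "q i dvd (\<Prod>i\<in>I. q i)" using assms(1) by (intro dvd_prodI)
    then have "gcd (\<Prod>i\<in>I. q i) (q i) = normalize (q i)" by (rule gcd_proj2_if_dvd)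
    then show "gcd a (q i) = gcd b (q i)"
      using arg_cong[OF eq, of "\<lambda>x. gcd x (q i)"] by (simp add: gcd.assoc)
  qed
next
  have dvd: "gcd x (\<Prod>i\<in>J. q i) dvd y"
    if "finite J" "J \<subseteq> I" "\<forall>i\<in>J. gcd x (q i) = gcd y (q i)" for x y J
    using that
  proof (induction J rule: finite_induct)
    case (insert j J)
    have "coprime (q j) (\<Prod>i\<in>J. q i)"
      using insert.hyps(2) insert.prems(1) by (intro prod_coprime_right cop) auto
    then have "coprime (gcd y (q j)) (gcd x (\<Prod>i\<in>J. q i))"
      by (meson coprime_divisors gcd_dvd2)
    moreover have "gcd x (\<Prod>i\<in>J. q i) dvd y" using insert by simp
    ultimately have "gcd y (q j) * gcd x (\<Prod>i\<in>J. q i) dvd y" by (intro divides_mult) auto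
    moreover have "gcd x (q j) = gcd y (q j)" using insert.prems(2) by simp
    ultimately have "gcd x (q j * (\<Prod>i\<in>J. q i)) dvd y"
      using gcd_mult_dvd[of x "q j" "\<Prod>i\<in>J. q i"] dvd_trans by metis
    then show ?case using insert.hyps by simp
  qed simp
  assume "\<forall>i\<in>I. gcd a (q i) = gcd b (q i)"
  then have "gcd a (\<Prod>i\<in>I. q i) dvd gcd b (\<Prod>i\<in>I. q i)" "gcd b (\<Prod>i\<in>I. q i) dvd gcd a (\<Prod>i\<in>I. q i)"
    using dvd[OF assms(1) subset_refl, of a b] dvd[OF assms(1) subset_refl, of b a] by simp_all
  then show "gcd a (\<Prod>i\<in>I. q i) = gcd b (\<Prod>i\<in>I. q i)" by (intro zdvd_antisym_nonneg) auto
qed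

section \<open>Matrices of a given type modulo a prime power\<close>

definition type_mats :: "nat \<Rightarrow> nat \<Rightarrow> nat \<Rightarrow> (nat \<Rightarrow> int) \<Rightarrow> int mat set" where
  "type_mats n m q g = {M \<in> residue_mats n m q. \<forall>j<m. snf_type q M j = g j}"

lemma equiv_mod_zero:
  assumes "equiv_mod q A B" "A \<in> carrier_mat n m" "cong_mat q A (0\<^sub>m n m)"
  shows "cong_mat q B (0\<^sub>m n m)"
proof -
  obtain P Q where PQ: "cong_mat q (P * A * Q) B" "P \<in> carrier_mat n n" "Q \<in> carrier_mat m m"
    using assms(1,2) by (rule equiv_modE)
  have "cong_mat q (P * A * Q) (P * 0\<^sub>m n m * Q)"
    using PQ(2,3) assms(2) by (intro cong_mat_mult cong_mat_refl assms(3)) auto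
  moreover have "P * 0\<^sub>m n m * Q = 0\<^sub>m n m" using PQ(2,3) by simp
  ultimately have "cong_mat q (P * A * Q) (0\<^sub>m n m)" by simp
  then show ?thesis using cong_mat_cong_left[OF PQ(1)] by blast
qed

lemma snf_type_smult:
  assumes "m \<le> n" "M \<in> carrier_mat n m" "0 < k" "0 < q" "j < m"
  shows "snf_type (k * q) (int k \<cdot>\<^sub>m M) j = int k * snf_type q M j"
proof -
  let ?E = "int k \<cdot>\<^sub>m snf M"
  have E: "snf M \<in> snf_mats n m" by (rule snf_in_snf_mats[OF assms(1,2)])
  have Ec: "snf M \<in> carrier_mat n m" using E by (simp add: snf_mats_def)
  have "?E \<in> snf_mats n m"
    using E assms(1) unfolding snf_mats_def diagonal_mat_def by auto
  then have "snf_form (k * q) n m ?E" by (rule snf_mats_imp_snf_form)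
  moreover have "equiv_mod (k * q) (int k \<cdot>\<^sub>m M) ?E"
    by (rule equiv_mod_smult[OF equiv_mod_snf[OF assms(1,2)]])
  ultimately have "snf_type (k * q) (int k \<cdot>\<^sub>m M) j = gcd (?E $$ (j,j)) (int (k * q))"
    using assms by (intro snf_type_eqI) auto
  also have "?E $$ (j,j) = int k * snf M $$ (j,j)" using Ec assms(1,5) by simp
  finally show ?thesis by (simp add: snf_type_def gcd_mult_left abs_mult)
qed

text \<open>If \<open>k\<close> divides every entry of the type, the Smith form vanishes modulo \<open>k\<close>, hence so does the
  matrix, and it can be divided by \<open>k\<close>.\<close>

lemma card_type_mats_smult:
  assumes "m \<le> n" "0 < k" "0 < q"
  shows "card (type_mats n m (k * q) (\<lambda>j. int k * g j)) = card (type_mats n m q g)"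
proof -
  have "bij_betw (\<lambda>M. int k \<cdot>\<^sub>m M) (type_mats n m q g) (type_mats n m (k * q) (\<lambda>j. int k * g j))"
  proof (rule bij_betw_imageI)
    show "inj_on (\<lambda>M. int k \<cdot>\<^sub>m M) (type_mats n m q g)"
    proof (rule inj_onI)
      fix A B assume AB: "A \<in> type_mats n m q g" "B \<in> type_mats n m q g" "int k \<cdot>\<^sub>m A = int k \<cdot>\<^sub>m B"
      then have c: "A \<in> carrier_mat n m" "B \<in> carrier_mat n m"
        by (auto simp: type_mats_def residue_mats_def entry_mats_def)
      show "A = B"
      proof (rule eq_matI)
        fix i j assume "i < dim_row B" "j < dim_col B"
        then show "A $$ (i,j) = B $$ (i,j)"
          using arg_cong[OF AB(3), of "\<lambda>M. M $$ (i,j)"] c assms(2) by simp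
      qed (use c in auto)
    qed
    show "(\<lambda>M. int k \<cdot>\<^sub>m M) ` type_mats n m q g = type_mats n m (k * q) (\<lambda>j. int k * g j)"
    proof (intro equalityI subsetI)
      fix X assume "X \<in> (\<lambda>M. int k \<cdot>\<^sub>m M) ` type_mats n m q g"
      then obtain M where M: "M \<in> residue_mats n m q" "\<forall>j<m. snf_type q M j = g j" "X = int k \<cdot>\<^sub>m M"
        by (auto simp: type_mats_def)
      have c: "M \<in> carrier_mat n m" using M(1) by (rule residue_mats_carrier)
      have "X \<in> residue_mats n m (k * q)"
        using M(1) assms(2) c unfolding M(3) residue_mats_def entry_mats_def by auto
      then show "X \<in> type_mats n m (k * q) (\<lambda>j. int k * g j)"
        using snf_type_smult[OF assms(1) c assms(2,3)] M(2,3) by (simp add: type_mats_def)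
    next
      fix X assume X: "X \<in> type_mats n m (k * q) (\<lambda>j. int k * g j)"
      then have Xr: "X \<in> residue_mats n m (k * q)"
        and ty: "\<forall>j<m. snf_type (k * q) X j = int k * g j" by (auto simp: type_mats_def)
      have c: "X \<in> carrier_mat n m" using Xr by (rule residue_mats_carrier)
      have E: "snf X \<in> snf_mats n m" by (rule snf_in_snf_mats[OF assms(1) c])
      have Ec: "snf X \<in> carrier_mat n m" using E by (simp add: snf_mats_def)
      have "int k dvd snf X $$ (j,j)" if "j < m" for j
        using ty that unfolding snf_type_def by (metis dvd_triv_left dvd_trans gcd_dvd1)
      then have "cong_mat k (snf X) (0\<^sub>m n m)"
        using E Ec unfolding cong_mat_def snf_mats_def diagonal_mat_def cong_0_iff
        by (auto simp: cong_0_iff) (metis dvd_0_right)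
      then have "cong_mat k X (0\<^sub>m n m)"
        by (rule equiv_mod_zero[OF equiv_mod_sym[OF equiv_mod_snf[OF assms(1) c]] Ec])
      then have dvd: "int k dvd X $$ (i,j)" if "i < n" "j < m" for i j
        using that c by (auto simp: cong_mat_def cong_0_iff)
      define M where "M = map_mat (\<lambda>x. x div int k) X"
      have Mc: "M \<in> carrier_mat n m" using c by (simp add: M_def)
      have XM: "X = int k \<cdot>\<^sub>m M"
        by (rule eq_matI) (use c dvd in \<open>auto simp: M_def\<close>)
      have "M $$ (i,j) \<in> {0..<int q}" if ij: "i < n" "j < m" for i j
      proof -
        have "0 \<le> X $$ (i,j)" "X $$ (i,j) < int k * int q"
          using Xr ij by (auto simp: residue_mats_def entry_mats_def)
        moreover have "X $$ (i,j) = int k * M $$ (i,j)" using XM Mc ij by simp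
        ultimately show ?thesis using assms(2) by (simp add: zero_le_mult_iff)
      qed
      then have "M \<in> residue_mats n m q" using Mc by (simp add: residue_mats_def entry_mats_def)
      moreover have "snf_type q M j = g j" if "j < m" for j
        using ty[rule_format, OF that] snf_type_smult[OF assms(1) Mc assms(2,3) that] assms(2)
        by (simp add: XM)
      ultimately show "X \<in> (\<lambda>M. int k \<cdot>\<^sub>m M) ` type_mats n m q g"
        using XM by (auto simp: type_mats_def)
    qed
  qed
  then show ?thesis using bij_betw_same_card by metis
qed

definition first_unit :: "nat \<Rightarrow> int mat" where
  "first_unit n = mat n 1 (\<lambda>(i,j). if i = 0 then 1 else 0)"

lemma first_unit_carrier: "first_unit n \<in> carrier_mat n 1"
  by (simp add: first_unit_def)

lemma first_unit_carrier_Suc [simp]: "first_unit n \<in> carrier_mat n (Suc 0)"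
  by (simp add: first_unit_def)

lemma mult_first_unit_index:
  assumes "M \<in> carrier_mat n m" "0 < m" "i < n"
  shows "(M * first_unit m) $$ (i,0) = M $$ (i,0)"
proof -
  have "(M * first_unit m) $$ (i,0) = (\<Sum>k<m. M $$ (i,k) * (if k = 0 then 1 else 0))"
    using assms by (auto simp: scalar_prod_def first_unit_def atLeast0LessThan intro!: sum.cong)
  also have "\<dots> = (\<Sum>k<m. if k = 0 then M $$ (i,0) else 0)"
    by (intro sum.cong) auto
  also have "\<dots> = M $$ (i,0)" using assms(2) by simp
  finally show ?thesis .
qed

lemma invertible_mod_smult:
  assumes "invertible_mod q d P" "coprime k (int q)"
  shows "invertible_mod q d (k \<cdot>\<^sub>m P)"
proof -
  obtain R where R: "invertible_mod q d R" "cong_mat q (P * R) (1\<^sub>m d)" "cong_mat q (R * P) (1\<^sub>m d)"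
    using assms(1) by (rule invertible_mod_inverse)
  note c = assms(1)[THEN invertible_mod_carrier] R(1)[THEN invertible_mod_carrier]
  obtain x where x: "[k * x = 1] (mod int q)" using assms(2) cong_solve_coprime_int by blast
  have smult: "cong_mat q ((k * x) \<cdot>\<^sub>m X) (1\<^sub>m d)" if "cong_mat q X (1\<^sub>m d)" for X
    using that cong_mult[OF x] unfolding cong_mat_def by (metis index_smult_mat mult_1)
  have prod: "(a \<cdot>\<^sub>m A) * (b \<cdot>\<^sub>m B) = (a * b) \<cdot>\<^sub>m (A * B)"
    if A: "A \<in> carrier_mat d d" and B: "B \<in> carrier_mat d d" for a b :: int and A B
  proof -
    have "(a \<cdot>\<^sub>m A) * (b \<cdot>\<^sub>m B) = b \<cdot>\<^sub>m ((a \<cdot>\<^sub>m A) * B)"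
      using A by (intro mult_smult_distrib[of "a \<cdot>\<^sub>m A" d d B d b] B) simp
    also have "(a \<cdot>\<^sub>m A) * B = a \<cdot>\<^sub>m (A * B)" by (rule mult_smult_assoc_mat[OF A B])
    also have "b \<cdot>\<^sub>m (a \<cdot>\<^sub>m (A * B)) = (a * b) \<cdot>\<^sub>m (A * B)" by (rule eq_matI) auto
    finally show ?thesis .
  qed
  have "(k \<cdot>\<^sub>m P) * (x \<cdot>\<^sub>m R) = (k * x) \<cdot>\<^sub>m (P * R)" by (rule prod[OF c])
  moreover have "(x \<cdot>\<^sub>m R) * (k \<cdot>\<^sub>m P) = (k * x) \<cdot>\<^sub>m (R * P)"
    using prod[OF c(2,1), of x k] by (simp only: mult.commute)
  ultimately have "cong_mat q ((k \<cdot>\<^sub>m P) * (x \<cdot>\<^sub>m R)) (1\<^sub>m d)" "cong_mat q ((x \<cdot>\<^sub>m R) * (k \<cdot>\<^sub>m P)) (1\<^sub>m d)"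
    using smult[OF R(2)] smult[OF R(3)] by simp_all
  then show ?thesis
    unfolding invertible_mod_def using c by (intro conjI bexI[of _ "x \<cdot>\<^sub>m R"]) auto
qed

text \<open>A column is equivalent over \<open>\<int>\<close> to \<open>g\<close> times the first unit vector, where \<open>g\<close> is the gcd of its
  entries. If the column is nonzero modulo \<open>p\<close>, then \<open>g\<close> is a unit modulo \<open>p\<^sup>s\<close> and can be moved into
  the transforming matrix.\<close>

lemma column_from_first_unit:
  assumes p: "prime p" and q: "q = p ^ s" "0 < s" and c: "c \<in> carrier_mat n 1" and n: "0 < n"
    and nz: "\<not> cong_mat p c (0\<^sub>m n 1)"
  obtains P where "invertible_mod q n P" "cong_mat q (P * first_unit n) c"
proof -
  have n1: "1 \<le> n" using n by simp
  have pq: "p dvd q" using q by simp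
  \<comment> \<open>The Smith form of a column has a single entry, at the top.\<close>
  define g where "g = snf c $$ (0,0)"
  have E: "snf c \<in> snf_mats n 1" by (rule snf_in_snf_mats[OF n1 c])
  have "snf c = g \<cdot>\<^sub>m first_unit n"
  proof (rule eq_matI)
    fix i j assume "i < dim_row (g \<cdot>\<^sub>m first_unit n)" "j < dim_col (g \<cdot>\<^sub>m first_unit n)"
    then have "i < n" "j = 0" by (auto simp: first_unit_def)
    then show "snf c $$ (i,j) = (g \<cdot>\<^sub>m first_unit n) $$ (i,j)"
      using E n by (cases "i = 0") (auto simp: first_unit_def g_def snf_mats_def diagonal_mat_def)
  qed (use E in \<open>auto simp: snf_mats_def first_unit_def\<close>)
  then have eq: "equiv_mod q (g \<cdot>\<^sub>m first_unit n) c"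
    using equiv_mod_sym[OF equiv_mod_snf[OF n1 c]] by metis
  have gc: "g \<cdot>\<^sub>m first_unit n \<in> carrier_mat n 1" by simp
  obtain P Q where PQ: "invertible_mod q n P" "invertible_mod q 1 Q"
      "cong_mat q (P * (g \<cdot>\<^sub>m first_unit n) * Q) c" "P \<in> carrier_mat n n" "Q \<in> carrier_mat 1 1"
    using eq gc by (rule equiv_modE)
  \<comment> \<open>The right factor is a \<open>1 \<times> 1\<close> unit, hence a scalar.\<close>
  define u where "u = Q $$ (0,0)"
  have Q: "Q = u \<cdot>\<^sub>m 1\<^sub>m 1" by (rule eq_matI) (use PQ(5) in \<open>auto simp: u_def\<close>)
  have "\<not> int p dvd g"
  proof
    assume "int p dvd g"
    then have "cong_mat p (g \<cdot>\<^sub>m first_unit n) (0\<^sub>m n 1)" by (auto simp: cong_mat_def first_unit_def cong_0_iff)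
    then have "cong_mat p c (0\<^sub>m n 1)" by (rule equiv_mod_zero[OF equiv_mod_dvd[OF eq pq] gc])
    with nz show False by simp
  qed
  then have "coprime (int p) g" using p by (intro prime_imp_coprime) auto
  then have cg: "coprime g (int q)" unfolding q(1) by (simp add: coprime_commute)
  obtain R where R: "invertible_mod q 1 R" "cong_mat q (Q * R) (1\<^sub>m 1)"
    using PQ(2) by (rule invertible_mod_inverse)
  have "(Q * R) $$ (0,0) = u * R $$ (0,0)"
    using invertible_mod_carrier[OF R(1)] PQ(5) by (simp add: scalar_prod_def u_def)
  then have "[u * R $$ (0,0) = 1] (mod int q)"
    using R(2) invertible_mod_carrier[OF R(1)] PQ(5) by (auto simp: cong_mat_def)
  then have "coprime u (int q)" by (metis coprime_iff_invertible_int)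
  with cg have k: "coprime (u * g) (int q)" by simp
  have "P * (g \<cdot>\<^sub>m first_unit n) * Q = ((u * g) \<cdot>\<^sub>m P) * first_unit n"
  proof -
    have Pe: "P * first_unit n \<in> carrier_mat n 1" using PQ(4) by (rule mult_carrier_mat) simp
    have "P * (g \<cdot>\<^sub>m first_unit n) = g \<cdot>\<^sub>m (P * first_unit n)" by (rule mult_smult_distrib[OF PQ(4) first_unit_carrier])
    moreover have X: "g \<cdot>\<^sub>m (P * first_unit n) \<in> carrier_mat n 1" using Pe by simp
    have "g \<cdot>\<^sub>m (P * first_unit n) * Q = u \<cdot>\<^sub>m (g \<cdot>\<^sub>m (P * first_unit n))"
      unfolding Q mult_smult_distrib[OF X one_carrier_mat] right_mult_one_mat[OF X] ..
    ultimately have "P * (g \<cdot>\<^sub>m first_unit n) * Q = u \<cdot>\<^sub>m (g \<cdot>\<^sub>m (P * first_unit n))" by (simp only:)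
    also have "\<dots> = (u * g) \<cdot>\<^sub>m (P * first_unit n)" by (rule eq_matI) (auto simp: mult.assoc)
    also have "\<dots> = ((u * g) \<cdot>\<^sub>m P) * first_unit n"
      by (rule mult_smult_assoc_mat[OF PQ(4) first_unit_carrier, symmetric])
    finally show ?thesis .
  qed
  with PQ(3) have "cong_mat q (((u * g) \<cdot>\<^sub>m P) * first_unit n) c" by simp
  with invertible_mod_smult[OF PQ(1) k] show thesis by (rule that)
qed

lemma snf_type_unit_corner:
  assumes "m \<le> n" "0 < q" and y: "y \<in> carrier_mat 1 m" and N: "N \<in> carrier_mat n m"
  defines "M \<equiv> four_block_mat (1\<^sub>m 1) y (0\<^sub>m n 1) N"
  shows "snf_type q M 0 = 1" "\<And>j. j < m \<Longrightarrow> snf_type q M (Suc j) = snf_type q N j"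
proof -
  have M: "M \<in> carrier_mat (Suc n) (Suc m)"
    unfolding M_def using four_block_carrier_mat[of "1\<^sub>m 1" 1 1 N n m] N by simp
  let ?E = "border 1 (snf N)"
  have E: "snf N \<in> snf_mats n m" by (rule snf_in_snf_mats[OF assms(1) N])
  have Ec: "dim_row (snf N) = n" "dim_col (snf N) = m" using E by (auto simp: snf_mats_def)
  have "M = four_block_mat (1 \<cdot>\<^sub>m 1\<^sub>m 1) (1 \<cdot>\<^sub>m y) (1 \<cdot>\<^sub>m 0\<^sub>m n 1) N"
    unfolding M_def by (intro cong_four_block_mat refl eq_matI) auto
  moreover have "N - 1 \<cdot>\<^sub>m (0\<^sub>m n 1 * y) = N"
    using y N by (intro eq_matI) auto
  ultimately have "equiv_mod q M (border 1 N)"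
    using equiv_mod_clear[OF zero_carrier_mat y N, of q 1] by simp
  then have eq: "equiv_mod q M ?E"
    using equiv_mod_border[OF equiv_mod_snf[OF assms(1) N]] by (rule equiv_mod_trans)
  have "1 \<cdot>\<^sub>m ?E \<in> snf_mats (Suc n) (Suc m)"
    by (rule snf_mats_smult_border[OF E _ assms(1)]) simp
  moreover have "1 \<cdot>\<^sub>m ?E = ?E" by (rule eq_matI) auto
  ultimately have sf: "snf_form q (Suc n) (Suc m) ?E" by (simp add: snf_mats_imp_snf_form)
  have ty: "snf_type q M j = gcd (?E $$ (j,j)) (int q)" if "j < Suc m" for j
    using assms(1) by (intro snf_type_eqI[OF _ M assms(2) eq sf that]) simp
  show "snf_type q M 0 = 1" by (simp add: ty border_index)
  show "snf_type q M (Suc j) = snf_type q N j" if "j < m" for j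
  proof -
    have "?E $$ (Suc j, Suc j) = snf N $$ (j,j)"
      using that assms(1) Ec by (simp add: border_index)
    then show ?thesis using ty[of "Suc j"] that by (simp add: snf_type_def[of q N])
  qed
qed

text \<open>The first row to the right of the corner is cleared without touching the lower block, so that row
  is free and the lower block carries the remaining type.\<close>

lemma card_type_mats_unit_column:
  assumes mn: "m \<le> n" and q: "1 < q" and g: "g 0 = 1"
  shows "card {M \<in> type_mats (Suc n) (Suc m) q g. reduce q (M * first_unit (Suc m)) = first_unit (Suc n)} =
    q ^ m * card (type_mats n m q (\<lambda>j. g (Suc j)))"
proof -
  let ?f = "\<lambda>(y, N). four_block_mat (1\<^sub>m 1) y (0\<^sub>m n 1) N"
  let ?X = "residue_mats 1 m q \<times> type_mats n m q (\<lambda>j. g (Suc j))"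
  let ?Y = "{M \<in> type_mats (Suc n) (Suc m) q g. reduce q (M * first_unit (Suc m)) = first_unit (Suc n)}"
  have col: "reduce q (M * first_unit (Suc m)) = first_unit (Suc n) \<longleftrightarrow>
      (\<forall>i<Suc n. M $$ (i,0) = (if i = 0 then 1 else 0))"
    if M: "M \<in> residue_mats (Suc n) (Suc m) q" for M
  proof -
    have c: "M \<in> carrier_mat (Suc n) (Suc m)" using M by (rule residue_mats_carrier)
    have d: "reduce q (M * first_unit (Suc m)) \<in> carrier_mat (Suc n) 1"
      using c mult_carrier_mat[OF c first_unit_carrier] by (simp add: reduce_def)
    have idx: "reduce q (M * first_unit (Suc m)) $$ (i,0) = M $$ (i,0)" if "i < Suc n" for i
    proof -
      have "reduce q (M * first_unit (Suc m)) $$ (i,0) = (M * first_unit (Suc m)) $$ (i,0) mod int q"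
        using carrier_matD[OF mult_carrier_mat[OF c first_unit_carrier]] that
        by (simp add: reduce_def del: index_mult_mat(1))
      also have "\<dots> = M $$ (i,0) mod int q" using mult_first_unit_index[OF c _ that] by simp
      also have "\<dots> = M $$ (i,0)" using M that by (auto simp: residue_mats_def entry_mats_def)
      finally show ?thesis .
    qed
    show ?thesis
    proof
      assume "reduce q (M * first_unit (Suc m)) = first_unit (Suc n)"
      then show "\<forall>i<Suc n. M $$ (i,0) = (if i = 0 then 1 else 0)"
        using idx by (auto simp: first_unit_def)
    next
      assume "\<forall>i<Suc n. M $$ (i,0) = (if i = 0 then 1 else 0)"
      then show "reduce q (M * first_unit (Suc m)) = first_unit (Suc n)"
        using idx d by (intro eq_matI) (auto simp: first_unit_def)
    qed
  qed
  have "bij_betw ?f ?X ?Y"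
  proof (rule bij_betw_imageI)
    have block0: "four_block_mat (1\<^sub>m 1) y (0\<^sub>m n 1) N $$ (0, Suc j) = y $$ (0,j)"
      if "y \<in> carrier_mat 1 m" "N \<in> carrier_mat n m" "j < m" for y N :: "int mat" and j
      using that by auto
    have block1: "four_block_mat (1\<^sub>m 1) y (0\<^sub>m n 1) N $$ (Suc i, Suc j) = N $$ (i,j)"
      if "y \<in> carrier_mat 1 m" "N \<in> carrier_mat n m" "i < n" "j < m" for y N :: "int mat" and i j
      using that by auto
    show "inj_on ?f ?X"
    proof (rule inj_onI, clarify)
      fix y N y' N'
      assume a: "y \<in> residue_mats 1 m q" "N \<in> type_mats n m q (\<lambda>j. g (Suc j))"
        "y' \<in> residue_mats 1 m q" "N' \<in> type_mats n m q (\<lambda>j. g (Suc j))"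
        and eq: "four_block_mat (1\<^sub>m 1) y (0\<^sub>m n 1) N = four_block_mat (1\<^sub>m 1) y' (0\<^sub>m n 1) N'"
      then have c: "y \<in> carrier_mat 1 m" "N \<in> carrier_mat n m" "y' \<in> carrier_mat 1 m" "N' \<in> carrier_mat n m"
        by (auto simp: type_mats_def residue_mats_carrier)
      have "y = y'"
      proof (rule eq_matI)
        fix i j assume "i < dim_row y'" "j < dim_col y'"
        then have ij: "i = 0" "j < m" using c by auto
        have "y $$ (0,j) = four_block_mat (1\<^sub>m 1) y (0\<^sub>m n 1) N $$ (0, Suc j)"
          by (rule block0[OF c(1,2) ij(2), symmetric])
        also have "\<dots> = y' $$ (0,j)" unfolding eq by (rule block0[OF c(3,4) ij(2)])
        finally show "y $$ (i,j) = y' $$ (i,j)" by (simp only: ij(1))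
      qed (use c in auto)
      moreover have "N = N'"
      proof (rule eq_matI)
        fix i j assume "i < dim_row N'" "j < dim_col N'"
        then have ij: "i < n" "j < m" using c by auto
        have "N $$ (i,j) = four_block_mat (1\<^sub>m 1) y (0\<^sub>m n 1) N $$ (Suc i, Suc j)"
          by (rule block1[OF c(1,2) ij, symmetric])
        also have "\<dots> = N' $$ (i,j)" unfolding eq by (rule block1[OF c(3,4) ij])
        finally show "N $$ (i,j) = N' $$ (i,j)" .
      qed (use c in auto)
      ultimately show "y = y' \<and> N = N'" ..
    qed
    show "?f ` ?X = ?Y"
    proof (intro equalityI subsetI)
      fix M assume "M \<in> ?f ` ?X"
      then obtain y N where yN: "y \<in> residue_mats 1 m q" "N \<in> residue_mats n m q"
        "\<forall>j<m. snf_type q N j = g (Suc j)" and M: "M = four_block_mat (1\<^sub>m 1) y (0\<^sub>m n 1) N"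
        by (auto simp: type_mats_def)
      have c: "y \<in> carrier_mat 1 m" "N \<in> carrier_mat n m"
        using yN by (auto intro: residue_mats_carrier)
      have Mc: "M \<in> carrier_mat (Suc n) (Suc m)"
        unfolding M using four_block_carrier_mat[of "1\<^sub>m 1" 1 1 N n m] c by simp
      have entry: "M $$ (i,j) \<in> {0..<int q}" if "i < Suc n" "j < Suc m" for i j
        using yN(1,2) that q c unfolding M residue_mats_def entry_mats_def
        by (subst index_mat_four_block) auto
      then have Mr: "M \<in> residue_mats (Suc n) (Suc m) q"
        using Mc by (simp add: residue_mats_def entry_mats_def)
      have "M $$ (i,0) = (if i = 0 then 1 else 0)" if "i < Suc n" for i
        unfolding M using that c by (subst index_mat_four_block) auto
      then have "reduce q (M * first_unit (Suc m)) = first_unit (Suc n)" using col[OF Mr] by simp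
      moreover have "snf_type q M j = g j" if "j < Suc m" for j
        using that snf_type_unit_corner[OF mn _ c, of q] q g yN(3)
        unfolding M by (cases j) auto
      ultimately show "M \<in> ?Y" using Mr by (simp add: type_mats_def)
    next
      fix M assume M: "M \<in> ?Y"
      then have Mr: "M \<in> residue_mats (Suc n) (Suc m) q"
        and ty: "\<forall>j<Suc m. snf_type q M j = g j"
        and c0: "\<forall>i<Suc n. M $$ (i,0) = (if i = 0 then 1 else 0)"
        using col by (auto simp: type_mats_def)
      have Mc: "M \<in> carrier_mat (Suc n) (Suc m)" using Mr by (rule residue_mats_carrier)
      define y where "y = mat 1 m (\<lambda>(i,j). M $$ (0,Suc j))"
      define N where "N = mat n m (\<lambda>(i,j). M $$ (Suc i,Suc j))"
      have c: "y \<in> carrier_mat 1 m" "N \<in> carrier_mat n m" by (auto simp: y_def N_def)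
      have eq: "M = four_block_mat (1\<^sub>m 1) y (0\<^sub>m n 1) N"
        by (rule eq_matI) (use Mc c0 in \<open>auto simp: y_def N_def\<close>)
      have "y \<in> residue_mats 1 m q" "N \<in> residue_mats n m q"
        using Mr by (auto simp: residue_mats_def entry_mats_def y_def N_def)
      moreover have "snf_type q N j = g (Suc j)" if "j < m" for j
        using snf_type_unit_corner(2)[OF mn _ c that, of q] q ty that by (simp add: eq)
      ultimately have "(y, N) \<in> ?X" by (simp add: type_mats_def)
      with eq show "M \<in> ?f ` ?X" by (intro image_eqI[of _ _ "(y, N)"]) auto
    qed
  qed
  then have "card ?X = card ?Y" by (rule bij_betw_same_card)
  then show ?thesis by (simp add: card_cartesian_product card_residue_mats)
qed

lemma card_filter_add_card_filter_not:
  assumes "finite A"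
  shows "card A = card {x \<in> A. P x} + card {x \<in> A. \<not> P x}"
proof -
  have "A = {x \<in> A. P x} \<union> {x \<in> A. \<not> P x}" by blast
  moreover have "card ({x \<in> A. P x} \<union> {x \<in> A. \<not> P x}) = card {x \<in> A. P x} + card {x \<in> A. \<not> P x}"
    using assms by (intro card_Un_disjoint) auto
  ultimately show ?thesis by simp
qed

lemma reduce_eq_iff_cong_mat:
  assumes "c \<in> residue_mats n m q" "X \<in> carrier_mat n m" "0 < q"
  shows "reduce q X = c \<longleftrightarrow> cong_mat q X c"
proof
  assume "reduce q X = c"
  then show "cong_mat q X c" using cong_mat_sym[OF cong_mat_reduce[of q X]] by simp
next
  assume "cong_mat q X c"
  with cong_mat_reduce have "cong_mat q (reduce q X) c" by (rule cong_mat_trans)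
  then show "reduce q X = c"
    using reduce_in_residue_mats[OF assms(2,3)] assms(1) by (rule cong_mat_residue_mats_eq)
qed

lemma first_unit_in_residue_mats: "1 < q \<Longrightarrow> first_unit n \<in> residue_mats n 1 q"
  by (auto simp: first_unit_def residue_mats_def entry_mats_def)

text \<open>Choosing \<open>P\<close> and \<open>Q\<close> with first columns \<open>c\<close> and \<open>v\<close>, the map \<open>M \<mapsto> P\<^sup>-\<^sup>1 M Q\<close> preserves types and turns
  \<open>M v = c\<close> into the same equation for the first unit vectors.\<close>

lemma card_type_mats_column_eq:
  assumes mn: "m \<le> n" and p: "prime p" and q: "q = p ^ s" "0 < s" and "0 < n" "0 < m"
    and v: "v \<in> residue_mats m 1 q" "\<not> cong_mat p v (0\<^sub>m m 1)"
    and c: "c \<in> residue_mats n 1 q" "\<not> cong_mat p c (0\<^sub>m n 1)"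
  shows "card {M \<in> type_mats n m q g. reduce q (M * v) = c} =
    card {M \<in> type_mats n m q g. reduce q (M * first_unit m) = first_unit n}"
proof -
  have q1: "1 < q" using one_less_power[OF prime_gt_1_nat[OF p] q(2)] q(1) by simp
  then have q0: "0 < q" by simp
  note vc = residue_mats_carrier[OF v(1)] and cc = residue_mats_carrier[OF c(1)]
  obtain P where P: "invertible_mod q n P" "cong_mat q (P * first_unit n) c"
    using column_from_first_unit[OF p q cc \<open>0 < n\<close> c(2)] by blast
  obtain Q where Q: "invertible_mod q m Q" "cong_mat q (Q * first_unit m) v"
    using column_from_first_unit[OF p q vc \<open>0 < m\<close> v(2)] by blast
  obtain R where R: "invertible_mod q n R" "cong_mat q (P * R) (1\<^sub>m n)" "cong_mat q (R * P) (1\<^sub>m n)"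
    using P(1) by (rule invertible_mod_inverse)
  note Pc = invertible_mod_carrier[OF P(1)] and Qc = invertible_mod_carrier[OF Q(1)]
    and Rc = invertible_mod_carrier[OF R(1)]
  have PR: "P * R \<in> carrier_mat n n" using Pc Rc by (rule mult_carrier_mat)
  have RP: "R * P \<in> carrier_mat n n" using Rc Pc by (rule mult_carrier_mat)
  let ?f = "\<lambda>M. reduce q (R * M * Q)"
  have iff: "reduce q (?f M * first_unit m) = first_unit n \<longleftrightarrow> reduce q (M * v) = c"
    if M: "M \<in> carrier_mat n m" for M
  proof -
    have RM: "R * M \<in> carrier_mat n m" using Rc M by (rule mult_carrier_mat)
    have RMQ: "R * M * Q \<in> carrier_mat n m" using RM Qc by (rule mult_carrier_mat)
    have fc: "?f M \<in> carrier_mat n m" using RMQ by (simp add: reduce_def)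
    have Mv: "M * v \<in> carrier_mat n 1" using M vc by (rule mult_carrier_mat)
    have RMv: "R * (M * v) \<in> carrier_mat n 1" using Rc Mv by (rule mult_carrier_mat)
    have Qe: "Q * first_unit m \<in> carrier_mat m 1" using Qc first_unit_carrier by (rule mult_carrier_mat)
    have "cong_mat q (?f M * first_unit m) ((R * M * Q) * first_unit m)"
      by (rule cong_mat_mult[OF cong_mat_reduce cong_mat_refl])
        (simp only: carrier_matD[OF fc] carrier_matD[OF first_unit_carrier])
    also have "(R * M * Q) * first_unit m = (R * M) * (Q * first_unit m)"
      by (rule assoc_mult_mat[OF RM Qc first_unit_carrier])
    finally have 1: "cong_mat q (?f M * first_unit m) ((R * M) * (Q * first_unit m))" .
    have "cong_mat q ((R * M) * (Q * first_unit m)) ((R * M) * v)"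
      by (rule cong_mat_mult[OF cong_mat_refl Q(2)]) (simp only: carrier_matD[OF RM] carrier_matD[OF Qe])
    moreover have "(R * M) * v = R * (M * v)" by (rule assoc_mult_mat[OF Rc M vc])
    ultimately have "cong_mat q ((R * M) * (Q * first_unit m)) (R * (M * v))" by simp
    with 1 have 2: "cong_mat q (?f M * first_unit m) (R * (M * v))" by (rule cong_mat_trans)
    have "cong_mat q (R * (M * v)) (first_unit n) \<longleftrightarrow> cong_mat q (M * v) c"
    proof
      assume "cong_mat q (R * (M * v)) (first_unit n)"
      then have "cong_mat q (P * (R * (M * v))) (P * first_unit n)"
        by (rule cong_mat_mult[OF cong_mat_refl]) (simp only: carrier_matD[OF Pc] carrier_matD[OF RMv])
      also have "P * (R * (M * v)) = (P * R) * (M * v)" by (rule assoc_mult_mat[OF Pc Rc Mv, symmetric])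
      finally have c': "cong_mat q ((P * R) * (M * v)) c" using P(2) by (rule cong_mat_trans)
      have "cong_mat q ((P * R) * (M * v)) (1\<^sub>m n * (M * v))"
        by (rule cong_mat_mult[OF R(2) cong_mat_refl]) (simp only: carrier_matD[OF PR] carrier_matD[OF Mv])
      moreover have "1\<^sub>m n * (M * v) = M * v" by (rule left_mult_one_mat[OF Mv])
      ultimately have "cong_mat q ((P * R) * (M * v)) (M * v)" by simp
      then show "cong_mat q (M * v) c" using cong_mat_trans[OF cong_mat_sym c'] by blast
    next
      assume "cong_mat q (M * v) c"
      then have "cong_mat q (M * v) (P * first_unit n)" using cong_mat_sym[OF P(2)] by (rule cong_mat_trans)
      then have "cong_mat q (R * (M * v)) (R * (P * first_unit n))"
        by (rule cong_mat_mult[OF cong_mat_refl]) (simp only: carrier_matD[OF Rc] carrier_matD[OF Mv])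
      also have "R * (P * first_unit n) = (R * P) * first_unit n"
        by (rule assoc_mult_mat[OF Rc Pc first_unit_carrier, symmetric])
      finally have 3: "cong_mat q (R * (M * v)) ((R * P) * first_unit n)" .
      have "cong_mat q ((R * P) * first_unit n) (1\<^sub>m n * first_unit n)"
        by (rule cong_mat_mult[OF R(3) cong_mat_refl])
          (simp only: carrier_matD[OF RP] carrier_matD[OF first_unit_carrier])
      moreover have "1\<^sub>m n * first_unit n = first_unit n" by (rule left_mult_one_mat[OF first_unit_carrier])
      ultimately show "cong_mat q (R * (M * v)) (first_unit n)" using cong_mat_trans[OF 3] by simp
    qed
    then show ?thesis
      unfolding reduce_eq_iff_cong_mat[OF first_unit_in_residue_mats[OF q1] mult_carrier_mat[OF fc first_unit_carrier] q0]
        reduce_eq_iff_cong_mat[OF c(1) Mv q0] using cong_mat_cong_left[OF 2, of "first_unit n"] by (simp only:)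
  qed
  have ty: "snf_type q (?f M) j = snf_type q M j" if "M \<in> carrier_mat n m" "j < m" for M j
    using snf_type_equiv_mod[OF mn that(1) q0 equiv_mod_action[OF R(1) Q(1) that(1)] that(2)] by simp
  let ?G = "\<lambda>M. (\<forall>j<m. snf_type q M j = g j) \<and> reduce q (M * first_unit m) = first_unit n"
  have G: "(\<forall>j<m. snf_type q M j = g j) \<and> reduce q (M * v) = c \<longleftrightarrow> ?G (?f M)"
    if "M \<in> residue_mats n m q" for M
  proof -
    note Mc = residue_mats_carrier[OF that]
    have "(\<forall>j<m. snf_type q M j = g j) \<longleftrightarrow> (\<forall>j<m. snf_type q (?f M) j = g j)"
      by (rule all_cong) (simp only: ty[OF Mc])
    then show ?thesis by (simp only: iff[OF Mc])
  qed
  have 1: "{M \<in> type_mats n m q g. reduce q (M * v) = c} = {M \<in> residue_mats n m q. ?G (?f M)}"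
    unfolding type_mats_def mem_Collect_eq conj_assoc by (intro Collect_cong conj_cong refl G)
  have 2: "{M \<in> type_mats n m q g. reduce q (M * first_unit m) = first_unit n} = {M \<in> residue_mats n m q. ?G M}"
    unfolding type_mats_def mem_Collect_eq conj_assoc by (rule refl)
  show ?thesis
    unfolding 1 2
    by (rule card_preimage_bij_betw[where P = ?G, OF bij_betw_equiv_action[OF R(1) Q(1) q0]])
qed

lemma card_nonzero_columns:
  assumes "p dvd q" "0 < q"
  shows "real (card {v \<in> residue_mats n 1 q. \<not> cong_mat p v (0\<^sub>m n 1)}) =
    real q ^ n * (1 - (1 / real p) ^ n)"
proof -
  have "kernel_count q p (1\<^sub>m n) = card {v \<in> residue_mats n 1 q. cong_mat p v (0\<^sub>m n 1)}"
    unfolding kernel_count_def using left_mult_one_mat[OF residue_mats_carrier]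
    by (intro arg_cong[of _ _ card]) auto
  moreover have "int (kernel_count q p (1\<^sub>m n)) = int (q div p) ^ n"
    using kernel_count_diagonal[of "1\<^sub>m n" n n p q] assms by (simp add: diagonal_mat_def)
  then have "kernel_count q p (1\<^sub>m n) = (q div p) ^ n" by (metis of_nat_eq_iff of_nat_power)
  ultimately have z: "card {v \<in> residue_mats n 1 q. cong_mat p v (0\<^sub>m n 1)} = (q div p) ^ n" by simp
  have "card (residue_mats n 1 q) = card {v \<in> residue_mats n 1 q. cong_mat p v (0\<^sub>m n 1)} +
      card {v \<in> residue_mats n 1 q. \<not> cong_mat p v (0\<^sub>m n 1)}"
    by (rule card_filter_add_card_filter_not) simp
  then have "q ^ n = (q div p) ^ n + card {v \<in> residue_mats n 1 q. \<not> cong_mat p v (0\<^sub>m n 1)}"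
    unfolding card_residue_mats z by (simp only: mult_1_right)
  then have "real q ^ n = real (q div p) ^ n +
      real (card {v \<in> residue_mats n 1 q. \<not> cong_mat p v (0\<^sub>m n 1)})"
    unfolding of_nat_power[symmetric] of_nat_add[symmetric] by (simp only:)
  moreover have "real (q div p) = real q * (1 / real p)" using assms(1) by (simp add: real_of_nat_div)
  then have "real (q div p) ^ n = real q ^ n * (1 / real p) ^ n"
    by (simp only: power_mult_distrib)
  ultimately show ?thesis unfolding right_diff_distrib mult_1_right by linarith
qed

text \<open>The kernel modulo \<open>p\<close> may be computed on the diagonal form, where each entry prime to \<open>p\<close> cuts the
  number of solutions by the factor \<open>p\<close>.\<close>

lemma card_nonzero_images:
  assumes mn: "m \<le> n" and p: "prime p" "p dvd q" "0 < q" and M: "M \<in> type_mats n m q g"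
  shows "real (card {v \<in> residue_mats m 1 q. \<not> cong_mat p (M * v) (0\<^sub>m n 1)}) =
    real q ^ m * (1 - (1 / real p) ^ card {j. j < m \<and> \<not> int p dvd g j})"
proof -
  have c: "M \<in> carrier_mat n m" and ty: "\<forall>j<m. snf_type q M j = g j"
    using M by (auto simp: type_mats_def residue_mats_carrier)
  let ?E = "snf M"
  have E: "?E \<in> carrier_mat n m" "diagonal_mat ?E"
    using snf_in_snf_mats[OF mn c] by (auto simp: snf_mats_def)
  have "kernel_count q p M = kernel_count q p ?E"
    by (rule kernel_count_equiv_mod[OF equiv_mod_snf[OF mn c] p(2,3)])
  then have "int (kernel_count q p M) = (\<Prod>j<m. int (q div p) * gcd (?E $$ (j,j)) (int p))"
    using kernel_count_diagonal[OF E mn p(2,3)] by simp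
  then have "real_of_int (int (kernel_count q p M)) =
      real_of_int (\<Prod>j<m. int (q div p) * gcd (?E $$ (j,j)) (int p))" by (rule arg_cong)
  then have "real (kernel_count q p M) = (\<Prod>j<m. real (q div p) * of_int (gcd (?E $$ (j,j)) (int p)))"
    by (simp only: of_int_prod of_int_mult of_int_of_nat_eq)
  also have "\<dots> = (\<Prod>j<m. real q * (if \<not> int p dvd g j then 1 / real p else 1))"
  proof (rule prod.cong[OF refl])
    fix j assume j: "j \<in> {..<m}"
    have "int p dvd ?E $$ (j,j) \<longleftrightarrow> int p dvd g j"
    proof -
      have "g j = gcd (?E $$ (j,j)) (int q)" using ty j by (simp add: snf_type_def)
      then show ?thesis using p(2) by simp
    qed
    moreover have "gcd (?E $$ (j,j)) (int p) = (if int p dvd ?E $$ (j,j) then int p else 1)"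
    proof (cases "int p dvd ?E $$ (j,j)")
      case True
      then show ?thesis by (simp add: gcd_proj2_if_dvd)
    next
      case False
      then have "coprime (int p) (?E $$ (j,j))" using p(1) by (intro prime_imp_coprime) auto
      then show ?thesis using False by (simp add: gcd.commute coprime_iff_gcd_eq_1)
    qed
    moreover have "real (q div p) = real q * (1 / real p)" using p(2) by (simp add: real_of_nat_div)
    moreover have "real p \<noteq> 0" using p(1) by (auto simp: prime_gt_0_nat)
    ultimately show "real (q div p) * of_int (gcd (?E $$ (j,j)) (int p)) =
        real q * (if \<not> int p dvd g j then 1 / real p else 1)" by simp
  qed
  also have "\<dots> = real q ^ m * (\<Prod>j<m. if \<not> int p dvd g j then 1 / real p else 1)"
    by (simp add: prod.distrib)
  also have "(\<Prod>j<m. if \<not> int p dvd g j then 1 / real p else 1) =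
      (1 / real p) ^ card {j. j < m \<and> \<not> int p dvd g j}"
  proof -
    have "(\<Prod>j<m. if \<not> int p dvd g j then 1 / real p else 1) =
        (\<Prod>j\<in>{j \<in> {..<m}. \<not> int p dvd g j}. 1 / real p)"
      by (rule prod.inter_filter[symmetric]) simp
    then show ?thesis by simp
  qed
  finally have k: "real (kernel_count q p M) =
      real q ^ m * (1 / real p) ^ card {j. j < m \<and> \<not> int p dvd g j}" .
  have "card (residue_mats m 1 q) = card {v \<in> residue_mats m 1 q. cong_mat p (M * v) (0\<^sub>m n 1)} +
      card {v \<in> residue_mats m 1 q. \<not> cong_mat p (M * v) (0\<^sub>m n 1)}"
    by (rule card_filter_add_card_filter_not) simp
  moreover have "card {v \<in> residue_mats m 1 q. cong_mat p (M * v) (0\<^sub>m n 1)} = kernel_count q p M"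
    unfolding kernel_count_def using c by simp
  ultimately have "q ^ m = kernel_count q p M +
      card {v \<in> residue_mats m 1 q. \<not> cong_mat p (M * v) (0\<^sub>m n 1)}"
    unfolding card_residue_mats by (simp only: mult_1_right)
  then have "real q ^ m = real (kernel_count q p M) +
      real (card {v \<in> residue_mats m 1 q. \<not> cong_mat p (M * v) (0\<^sub>m n 1)})"
    unfolding of_nat_power[symmetric] of_nat_add[symmetric] by (simp only:)
  then show ?thesis unfolding k by (simp add: right_diff_distrib)
qed

lemma card_nonzero_image_fibre:
  fixes g :: "nat \<Rightarrow> int"
  assumes mn: "m \<le> n" and p: "prime p" and q: "q = p ^ s" "0 < s" and nm: "0 < n" "0 < m"
    and v: "v \<in> residue_mats m 1 q"
  defines "K \<equiv> card {M \<in> type_mats n m q g. reduce q (M * first_unit m) = first_unit n}"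
    and "U \<equiv> {c \<in> residue_mats n 1 q. \<not> cong_mat p c (0\<^sub>m n 1)}"
  shows "card {M \<in> type_mats n m q g. \<not> cong_mat p (M * v) (0\<^sub>m n 1)} =
    (if cong_mat p v (0\<^sub>m m 1) then 0 else card U * K)"
proof (cases "cong_mat p v (0\<^sub>m m 1)")
  case True
  have "cong_mat p (M * v) (0\<^sub>m n 1)" if "M \<in> type_mats n m q g" for M
  proof -
    have c: "M \<in> carrier_mat n m" using that by (auto simp: type_mats_def residue_mats_carrier)
    have "cong_mat p (M * v) (M * 0\<^sub>m m 1)"
      using c residue_mats_carrier[OF v] by (intro cong_mat_mult True cong_mat_refl) auto
    then show ?thesis using c by simp
  qed
  then have "{M \<in> type_mats n m q g. \<not> cong_mat p (M * v) (0\<^sub>m n 1)} = {}" by blast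
  then show ?thesis using True by (simp only: card.empty if_True)
next
  case False
  have q0: "0 < q" and pq: "p dvd q" using p q by (auto simp: prime_gt_0_nat)
  have red: "cong_mat p (M * v) (0\<^sub>m n 1) \<longleftrightarrow> cong_mat p (reduce q (M * v)) (0\<^sub>m n 1)" for M
    by (rule cong_mat_cong_left[OF cong_mat_sym[OF cong_mat_dvd[OF cong_mat_reduce pq]]])
  have "{M \<in> type_mats n m q g. \<not> cong_mat p (M * v) (0\<^sub>m n 1)} =
      (\<Union>c\<in>U. {M \<in> type_mats n m q g. reduce q (M * v) = c})"
  proof (intro equalityI subsetI)
    fix M assume M: "M \<in> {M \<in> type_mats n m q g. \<not> cong_mat p (M * v) (0\<^sub>m n 1)}"
    then have c: "M \<in> carrier_mat n m" by (auto simp: type_mats_def residue_mats_carrier)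
    have "reduce q (M * v) \<in> U"
      unfolding U_def using M red
        reduce_in_residue_mats[OF mult_carrier_mat[OF c residue_mats_carrier[OF v]] q0] by blast
    with M show "M \<in> (\<Union>c\<in>U. {M \<in> type_mats n m q g. reduce q (M * v) = c})" by blast
  next
    fix M assume "M \<in> (\<Union>c\<in>U. {M \<in> type_mats n m q g. reduce q (M * v) = c})"
    then have "M \<in> type_mats n m q g" "reduce q (M * v) \<in> U" by blast+
    then show "M \<in> {M \<in> type_mats n m q g. \<not> cong_mat p (M * v) (0\<^sub>m n 1)}"
      unfolding U_def using red by blast
  qed
  also have "card \<dots> = (\<Sum>c\<in>U. card {M \<in> type_mats n m q g. reduce q (M * v) = c})"
    by (rule card_UN_disjoint) (auto simp: U_def type_mats_def)
  also have "\<dots> = (\<Sum>c\<in>U. K)"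
    unfolding K_def using card_type_mats_column_eq[OF mn p q nm v False]
    by (intro sum.cong) (auto simp: U_def)
  finally show ?thesis using False by simp
qed

text \<open>The double count of the pairs \<open>(M, v)\<close> with \<open>M\<close> of type \<open>g\<close> and \<open>M v\<close> nonzero modulo \<open>p\<close>. The
  exponent of \<open>1/p\<close> on the left is the rank of \<open>M\<close> modulo \<open>p\<close>.\<close>

theorem card_type_mats_remove_unit:
  assumes mn: "m \<le> n" and p: "prime p" and q: "q = p ^ s" "0 < s" and g: "g 0 = 1"
  shows "real (card (type_mats (Suc n) (Suc m) q g)) *
      (1 - (1 / real p) ^ card {j. j < Suc m \<and> \<not> int p dvd g j}) =
    real q ^ (n + m + 1) * (1 - (1 / real p) ^ Suc n) * (1 - (1 / real p) ^ Suc m) *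
      real (card (type_mats n m q (\<lambda>j. g (Suc j))))"
proof -
  have q1: "1 < q" using one_less_power[OF prime_gt_1_nat[OF p] q(2)] q(1) by simp
  have pq: "p dvd q" using q by simp
  have q0: "0 < q" using q1 by simp
  let ?O = "type_mats (Suc n) (Suc m) q g" and ?V = "residue_mats (Suc m) 1 q"
  let ?P = "\<lambda>M v. \<not> cong_mat p (M * v) (0\<^sub>m (Suc n) 1)"
  let ?U = "\<lambda>k. {c \<in> residue_mats k 1 q. \<not> cong_mat p c (0\<^sub>m k 1)}"
  let ?K = "card {M \<in> ?O. reduce q (M * first_unit (Suc m)) = first_unit (Suc n)}"
  have fin: "finite ?O" by (simp add: type_mats_def)
  \<comment> \<open>Count the pairs first by \<open>M\<close>, then by \<open>v\<close>.\<close>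
  have "(\<Sum>M\<in>?O. card {v \<in> ?V. ?P M v}) = (\<Sum>v\<in>?V. card {M \<in> ?O. ?P M v})"
    by (rule sum_multicount_gen[OF fin finite_residue_mats]) simp
  then have "real (\<Sum>M\<in>?O. card {v \<in> ?V. ?P M v}) = real (\<Sum>v\<in>?V. card {M \<in> ?O. ?P M v})"
    by (rule arg_cong)
  then have dc: "(\<Sum>M\<in>?O. real (card {v \<in> ?V. ?P M v})) = (\<Sum>v\<in>?V. real (card {M \<in> ?O. ?P M v}))"
    by (simp only: of_nat_sum)
  have "(\<Sum>M\<in>?O. real (card {v \<in> ?V. ?P M v})) = (\<Sum>M\<in>?O. real q ^ Suc m *
      (1 - (1 / real p) ^ card {j. j < Suc m \<and> \<not> int p dvd g j}))"
    using mn by (intro sum.cong refl card_nonzero_images[OF _ p pq q0]) auto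
  moreover have "(\<Sum>v\<in>?V. real (card {M \<in> ?O. ?P M v})) =
      (\<Sum>v\<in>?V. if \<not> cong_mat p v (0\<^sub>m (Suc m) 1) then real (card (?U (Suc n)) * ?K) else 0)"
    using mn by (intro sum.cong refl) (subst card_nonzero_image_fibre[OF _ p q], auto)
  moreover have "\<dots> = (\<Sum>v\<in>?U (Suc m). real (card (?U (Suc n)) * ?K))"
    by (rule sum.inter_filter[symmetric]) simp
  ultimately have "real (card ?O) * (real q ^ Suc m *
      (1 - (1 / real p) ^ card {j. j < Suc m \<and> \<not> int p dvd g j})) =
      real (card (?U (Suc m))) * (real (card (?U (Suc n))) * real ?K)"
    using dc by simp
  also have "\<dots> = (real q ^ Suc m * (1 - (1 / real p) ^ Suc m)) *
      ((real q ^ Suc n * (1 - (1 / real p) ^ Suc n)) *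
        (real q ^ m * real (card (type_mats n m q (\<lambda>j. g (Suc j))))))"
    unfolding card_nonzero_columns[OF pq q0] card_type_mats_unit_column[of m n q g, OF mn q1 g]
    by simp
  finally have eq: "real q ^ Suc m * (real (card ?O) *
      (1 - (1 / real p) ^ card {j. j < Suc m \<and> \<not> int p dvd g j})) =
    real q ^ Suc m * (real q ^ (n + m + 1) * (1 - (1 / real p) ^ Suc n) * (1 - (1 / real p) ^ Suc m) *
      real (card (type_mats n m q (\<lambda>j. g (Suc j)))))"
    by (simp only: power_add power_Suc power_one_right mult_ac)
  have "real q ^ Suc m \<noteq> 0" using q0 by simp
  then show ?thesis by (rule iffD1[OF mult_left_cancel, OF _ eq])
qed

section \<open>The probability of a type\<close>

lemma qbracket_0 [simp]: "qbracket p 0 = 1"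
  by (simp add: qbracket_def)

lemma qbracket_Suc: "qbracket p (Suc l) = qbracket p l * (1 - (1 / real p) ^ Suc l)"
proof -
  have "real p powi (- int j) = (1 / real p) ^ j" for j
    by (simp add: power_int_minus divide_inverse power_inverse)
  then show ?thesis unfolding qbracket_def by simp
qed

lemma qbracket_pos:
  assumes "1 < p"
  shows "0 < qbracket p l"
proof (induction l)
  case (Suc l)
  have "(1 / real p) ^ Suc l < 1" using assms by (intro power_Suc_less_one) auto
  with Suc show ?case by (simp add: qbracket_Suc)
qed simp

text \<open>The exponent of the \<open>j\<close>-th diagonal entry of \<open>D\<^sub>a\<close>: exactly \<open>a k\<close> entries have exponent below \<open>k\<close>.\<close>

definition type_exponent :: "nat \<Rightarrow> (nat \<Rightarrow> nat) \<Rightarrow> nat \<Rightarrow> nat" where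
  "type_exponent s a j = card {k \<in> {1..s}. a k \<le> j}"

text \<open>The claimed probability of the type described by \<open>a\<close>.\<close>

definition type_density :: "nat \<Rightarrow> nat \<Rightarrow> nat \<Rightarrow> nat \<Rightarrow> (nat \<Rightarrow> nat) \<Rightarrow> real" where
  "type_density p n m s a =
    real p powi (- (\<Sum>i=1..s. (int n - int (a i)) * (int m - int (a i)))) *
      (qbracket p n * qbracket p m /
        (qbracket p (n - a s) * qbracket p (m - a s) * (\<Prod>i=1..s. qbracket p (a i - a (i - 1)))))"

lemma sum_from_1_Suc: "(\<Sum>i=1..Suc s. f i) = f 1 + (\<Sum>i=1..s. f (Suc i))" for f :: "nat \<Rightarrow> int"
  using sum.atLeast_Suc_atMost[of 1 "Suc s" f] sum.shift_bounds_cl_Suc_ivl[of f 1 s] by simp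

lemma prod_from_1_Suc: "(\<Prod>i=1..Suc s. f i) = f 1 * (\<Prod>i=1..s. f (Suc i))" for f :: "nat \<Rightarrow> real"
  using prod.atLeast_Suc_atMost[of 1 "Suc s" f] prod.shift_bounds_cl_Suc_ivl[of f 1 s] by simp

lemma type_density_shift:
  assumes "0 < p" "a 0 = 0" "a 1 = 0"
  shows "type_density p n m (Suc s) a = type_density p n m s (\<lambda>i. a (Suc i)) / real p ^ (n * m)"
proof -
  let ?S = "\<Sum>i=1..s. (int n - int (a (Suc i))) * (int m - int (a (Suc i)))"
  have "(\<Sum>i=1..Suc s. (int n - int (a i)) * (int m - int (a i))) = int (n * m) + ?S"
    unfolding sum_from_1_Suc using assms(3) by simp
  then have "real p powi (- (\<Sum>i=1..Suc s. (int n - int (a i)) * (int m - int (a i)))) =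
      real p powi (- int (n * m)) * real p powi (- ?S)"
    using assms(1) by (simp add: power_int_add[symmetric])
  moreover have "real p powi (- int (n * m)) = 1 / real p ^ (n * m)"
    by (simp add: power_int_minus divide_inverse del: of_nat_mult)
  moreover have "(\<Prod>i=1..s. qbracket p (a (Suc i) - a (Suc i - 1))) =
      (\<Prod>i=1..s. qbracket p (a (Suc i) - a (Suc (i - 1))))"
    by (intro prod.cong) auto
  then have "(\<Prod>i=1..Suc s. qbracket p (a i - a (i - 1))) =
      (\<Prod>i=1..s. qbracket p (a (Suc i) - a (Suc (i - 1))))"
    unfolding prod_from_1_Suc using assms(2,3) by simp
  ultimately show ?thesis unfolding type_density_def by simp
qed

lemma type_density_remove_unit:
  assumes p: "1 < p" and s: "0 < s" and a0: "a 0 = 0" and a1: "\<And>i. 1 \<le> i \<Longrightarrow> i \<le> s \<Longrightarrow> 0 < a i"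
  shows "type_density p (Suc n) (Suc m) s a * (1 - (1 / real p) ^ a 1) =
    (1 - (1 / real p) ^ Suc n) * (1 - (1 / real p) ^ Suc m) * type_density p n m s (\<lambda>i. a i - 1)"
proof -
  obtain s' where s': "s = Suc s'" using s by (cases s) auto
  obtain r where r: "a 1 = Suc r" using a1[of 1] s by (cases "a 1") auto
  have "a s > 0" using a1[of s] s by simp
  then have sub: "Suc n - a s = n - (a s - 1)" "Suc m - a s = m - (a s - 1)" by auto
  have sum: "(\<Sum>i=1..s. (int (Suc n) - int (a i)) * (int (Suc m) - int (a i))) =
      (\<Sum>i=1..s. (int n - int (a i - 1)) * (int m - int (a i - 1)))"
  proof (intro sum.cong refl)
    fix i assume "i \<in> {1..s}"
    then have "0 < a i" using a1[of i] by simp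
    then have "int (Suc n) - int (a i) = int n - int (a i - 1)"
      "int (Suc m) - int (a i) = int m - int (a i - 1)" by linarith+
    then show "(int (Suc n) - int (a i)) * (int (Suc m) - int (a i)) =
        (int n - int (a i - 1)) * (int m - int (a i - 1))" by (simp only:)
  qed
  let ?T = "\<Prod>i=1..s'. qbracket p (a (Suc i) - a i)"
  have 1: "(\<Prod>i=1..s. qbracket p (a i - a (i - 1))) = qbracket p (Suc r) * ?T"
    unfolding s' prod_from_1_Suc using a0 r by simp
  have "(\<Prod>i=1..s'. qbracket p (a (Suc i) - 1 - (a (Suc i - 1) - 1))) = ?T"
  proof (intro prod.cong refl)
    fix i assume "i \<in> {1..s'}"
    then have "0 < a i" "0 < a (Suc i)" using a1[of i] a1[of "Suc i"] s' by auto
    then have "a (Suc i) - 1 - (a (Suc i - 1) - 1) = a (Suc i) - a i" by simp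
    then show "qbracket p (a (Suc i) - 1 - (a (Suc i - 1) - 1)) = qbracket p (a (Suc i) - a i)"
      by (simp only:)
  qed
  then have 2: "(\<Prod>i=1..s. qbracket p (a i - 1 - (a (i - 1) - 1))) = qbracket p r * ?T"
    unfolding s' prod_from_1_Suc using a0 r by simp
  have x: "(1 / real p) ^ Suc r < 1" using p by (intro power_Suc_less_one) auto
  have frac: "Z * (B * u * (C * v) / (D * E * (A * w * T'))) * w =
      u * v * (Z * (B * C / (D * E * (A * T'))))"
    if "w \<noteq> 0" for A B C D E T' Z u v w :: real
    using that by (simp add: field_simps)
  show ?thesis
    unfolding type_density_def sum 1 2 sub r qbracket_Suc
    using x by (intro frac) linarith
qed

text \<open>Induction on \<open>s + m\<close> along the two recursions: \<open>a 1 = 0\<close> means that there is no unit, so a factor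
  \<open>p\<close> is removed; otherwise a unit is removed and all \<open>a k\<close> drop by one.\<close>

theorem type_mats_density:
  assumes "prime p" "m \<le> n" "a 0 = 0" "\<And>i. i < s \<Longrightarrow> a i \<le> a (Suc i)" "a s \<le> m"
  shows "real (card (type_mats n m (p ^ s) (\<lambda>j. int p ^ type_exponent s a j))) /
    real (p ^ s) ^ (n * m) = type_density p n m s a"
  using assms
proof (induction "s + m" arbitrary: s m n a rule: less_induct)
  case less
  have p1: "1 < p" using less.prems(1) by (rule prime_gt_1_nat)
  have mono: "a i \<le> a j" if "i \<le> j" "j \<le> s" for i j
    using that
  proof (induction j rule: dec_induct)
    case (step j)
    then show ?case using less.prems(4)[of j] by simp
  qed simp
  consider "s = 0" | s' where "s = Suc s'" "a 1 = 0" | "0 < s" "0 < a 1"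
    by (metis gr0_conv_Suc neq0_conv)
  then show ?case
  proof cases
    case 1
    have "type_mats n m (p ^ s) (\<lambda>j. int p ^ type_exponent s a j) = residue_mats n m 1"
      unfolding 1 type_mats_def type_exponent_def snf_type_def by auto
    moreover have "card (residue_mats n m 1) = 1" unfolding card_residue_mats by simp
    moreover have "type_density p n m s a = 1"
      unfolding type_density_def 1 less.prems(3)
      using qbracket_pos[OF p1, of n] qbracket_pos[OF p1, of m] by simp
    ultimately show ?thesis using 1 by simp
  next
    case (2 s')
    let ?a = "\<lambda>i. a (Suc i)"
    have ex: "type_exponent s a j = Suc (type_exponent s' ?a j)" for j
    proof -
      have "{k \<in> {1..s}. a k \<le> j} = insert 1 (Suc ` {k \<in> {1..s'}. a (Suc k) \<le> j})"
        (is "?L = insert 1 (Suc ` ?R)")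
      proof (intro equalityI subsetI)
        fix k assume k: "k \<in> ?L"
        then obtain l where l: "k = Suc l" by (cases k) auto
        show "k \<in> insert 1 (Suc ` ?R)"
          using k 2(1) unfolding l by (cases "l = 0") auto
      next
        fix k assume "k \<in> insert 1 (Suc ` ?R)"
        then show "k \<in> ?L" using 2 by auto
      qed
      then show ?thesis unfolding type_exponent_def by (simp add: card_insert_if card_image image_iff)
    qed
    have "card (type_mats n m (p ^ s) (\<lambda>j. int p ^ type_exponent s a j)) =
        card (type_mats n m (p * p ^ s') (\<lambda>j. int p * int p ^ type_exponent s' ?a j))"
      unfolding ex unfolding 2(1) by simp
    also have "\<dots> = card (type_mats n m (p ^ s') (\<lambda>j. int p ^ type_exponent s' ?a j))"
      using p1 by (intro card_type_mats_smult less.prems) auto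
    finally have card: "card (type_mats n m (p ^ s) (\<lambda>j. int p ^ type_exponent s a j)) =
      card (type_mats n m (p ^ s') (\<lambda>j. int p ^ type_exponent s' ?a j))" .
    have IH: "real (card (type_mats n m (p ^ s') (\<lambda>j. int p ^ type_exponent s' ?a j))) /
        real (p ^ s') ^ (n * m) = type_density p n m s' ?a"
      using 2 less.prems by (intro less.hyps) auto
    have split: "real (p ^ Suc s') ^ (n * m) = real (p ^ s') ^ (n * m) * real p ^ (n * m)"
      by (simp add: power_mult_distrib mult.commute)
    have "type_density p n m (Suc s') a = type_density p n m s' ?a / real p ^ (n * m)"
      using p1 less.prems(3) 2(2) by (intro type_density_shift) auto
    then show ?thesis
      unfolding card unfolding 2(1) split divide_divide_eq_left[symmetric] IH by (rule sym)
  next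
    case 3
    have apos: "0 < a i" if "1 \<le> i" "i \<le> s" for i
      using mono[OF that] 3(2) by simp
    have "0 < a s" using apos[of s] 3(1) by simp
    then have "0 < m" using less.prems(5) by simp
    then obtain m' where m: "m = Suc m'" by (cases m) auto
    obtain n' where n: "n = Suc n'" using less.prems(2) m by (cases n) auto
    have mn: "m' \<le> n'" using less.prems(2) m n by simp
    let ?a = "\<lambda>i. a i - 1" and ?q = "p ^ s"
    let ?g = "\<lambda>j. int p ^ type_exponent s a j"
    have ex: "type_exponent s a (Suc j) = type_exponent s ?a j" for j
      unfolding type_exponent_def by (simp add: le_diff_conv)
    have ex0: "type_exponent s a j = 0 \<longleftrightarrow> j < a 1" for j
    proof
      assume "type_exponent s a j = 0"
      then have "1 \<notin> {k \<in> {1..s}. a k \<le> j}" unfolding type_exponent_def by auto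
      then show "j < a 1" using 3(1) by auto
    next
      assume "j < a 1"
      then have "{k \<in> {1..s}. a k \<le> j} = {}" using mono[of 1] by fastforce
      then show "type_exponent s a j = 0" unfolding type_exponent_def by (simp only: card.empty)
    qed
    have g0: "?g 0 = 1" using ex0[of 0] 3(2) by simp
    have "a 1 \<le> m" using mono[of 1 s] 3(1) less.prems(5) by simp
    have "\<not> int p dvd ?g j \<longleftrightarrow> j < a 1" for j
      unfolding ex0[symmetric] using p1 by (cases "type_exponent s a j") auto
    then have "{j. j < Suc m' \<and> \<not> int p dvd ?g j} = {j. j < Suc m' \<and> j < a 1}"
      by (simp only:)
    also have "\<dots> = {..<a 1}" using \<open>a 1 \<le> m\<close> unfolding m by auto
    finally have r: "card {j. j < Suc m' \<and> \<not> int p dvd ?g j} = a 1" by (simp only: card_lessThan)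
    let ?N = "real (card (type_mats n m ?q ?g))"
    let ?N' = "real (card (type_mats n' m' ?q (\<lambda>j. int p ^ type_exponent s ?a j)))"
    let ?x = "1 - (1 / real p) ^ a 1" and ?y = "(1 - (1 / real p) ^ Suc n') * (1 - (1 / real p) ^ Suc m')"
    have rec: "?N * ?x = real ?q ^ (n' + m' + 1) * ?y * ?N'"
      using card_type_mats_remove_unit[OF mn less.prems(1) refl 3(1), of ?g, OF g0]
      unfolding r ex m n by (simp add: mult.assoc)
    have IH: "?N' / real ?q ^ (n' * m') = type_density p n' m' s ?a"
    proof (rule less.hyps)
      show "s + m' < s + m" using m by simp
      show "a 0 - 1 = 0" using less.prems(3) by simp
      show "a s - 1 \<le> m'" using less.prems(5) m by simp
      show "a i - 1 \<le> a (Suc i) - 1" if "i < s" for i using less.prems(4)[OF that] by simp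
    qed (use less.prems(1) mn in auto)
    have nm: "n * m = n' * m' + (n' + m' + 1)" using n m by simp
    have q0: "real ?q > 0" using p1 by simp
    have cancel: "c * y * N / (r * c) = y * (N / r)" if "c \<noteq> 0" for c y N r :: real
      using that by simp
    have "?N / real ?q ^ (n * m) * ?x = ?N * ?x / (real ?q ^ (n' * m') * real ?q ^ (n' + m' + 1))"
      unfolding nm power_add by simp
    also have "\<dots> = ?y * (?N' / real ?q ^ (n' * m'))"
      unfolding rec by (rule cancel) (use zero_less_power[OF q0, of "n' + m' + 1"] in linarith)
    also have "\<dots> = type_density p n m s a * ?x"
      unfolding IH using type_density_remove_unit[of p s a n' m', OF p1 3(1) less.prems(3) apos] n m by simp
    finally have eq: "?N / real ?q ^ (n * m) * ?x = type_density p n m s a * ?x" .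
    obtain r where r: "a 1 = Suc r" using 3(2) by (cases "a 1") auto
    have "(1 / real p) ^ a 1 < 1" unfolding r using p1 by (intro power_Suc_less_one) auto
    then have "?x \<noteq> 0" by simp
    then show ?thesis by (rule iffD1[OF mult_right_cancel, OF _ eq])
  qed
qed

lemma downward_closed_eq_lessThan:
  fixes A :: "nat set"
  assumes "finite A" "\<And>i j. j \<in> A \<Longrightarrow> i \<le> j \<Longrightarrow> i \<in> A"
  shows "A = {..<card A}"
proof (rule card_subset_eq)
  show "A \<subseteq> {..<card A}"
  proof
    fix j assume "j \<in> A"
    then have "{..j} \<subseteq> A" using assms(2) by auto
    then have "card {..j} \<le> card A" using assms(1) by (rule card_mono[rotated])
    then show "j \<in> {..<card A}" by simp
  qed
qed auto

section \<open>Probabilities of single forms and of coprime products\<close>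

text \<open>\<open>is_D_a\<close> prescribes only how often each value occurs. The prescribed counts add up to \<open>m\<close>, so each
  diagonal entry is one of the listed values, and the divisibility chain sorts them: the positions
  with exponent below \<open>k\<close> form an initial segment of length \<open>a k\<close>.\<close>

lemma is_D_a_gcd:
  assumes p: "prime p" and a0: "a 0 = 0" and mono: "\<And>i. i < s \<Longrightarrow> a i \<le> a (Suc i)" and as: "a s \<le> m"
    and D: "is_D_a n m p s a D" and j: "j < m"
  shows "gcd (D $$ (j,j)) (int (p ^ s)) = int p ^ type_exponent s a j"
proof -
  have p1: "1 < p" using p by (rule prime_gt_1_nat)
  let ?q = "int (p ^ s)"
  let ?A = "\<lambda>i. {j. j < m \<and> [D $$ (j,j) = int p ^ (i - 1)] (mod ?q)}"
  let ?Z = "{j. j < m \<and> [D $$ (j,j) = 0] (mod ?q)}"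
  have cA: "card (?A i) = a i - a (i - 1)" if "i \<in> {1..s}" for i
    using D that unfolding is_D_a_def by blast
  have snf: "D \<in> snf_mats n m" and cZ: "card ?Z = m - a s"
    using D unfolding is_D_a_def by auto
  have gA: "gcd (D $$ (j,j)) ?q = int p ^ (i - 1)" if "j \<in> ?A i" "i \<in> {1..s}" for i j
  proof -
    have "gcd (D $$ (j,j)) ?q = gcd (int p ^ (i - 1)) ?q" using that(1) by (intro cong_gcd_eq) simp
    also have "\<dots> = int p ^ (i - 1)"
    proof -
      have "int p ^ (i - 1) dvd ?q" unfolding of_nat_power using that(2) by (intro le_imp_power_dvd) auto
      then show ?thesis by (simp add: gcd_proj1_if_dvd)
    qed
    finally show ?thesis .
  qed
  have gZ: "gcd (D $$ (j,j)) ?q = int p ^ s" if "j \<in> ?Z" for j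
  proof -
    have "gcd (D $$ (j,j)) ?q = gcd 0 ?q" using that by (intro cong_gcd_eq) simp
    then show ?thesis by simp
  qed
  have inj: "t = u" if "int p ^ t = int p ^ u" for t u
    using that p1 by simp
  have dA: "?A i \<inter> ?A k = {}" if "i \<in> {1..s}" "k \<in> {1..s}" "i \<noteq> k" for i k
  proof (rule ccontr)
    assume "?A i \<inter> ?A k \<noteq> {}"
    then obtain j where j: "j \<in> ?A i" "j \<in> ?A k" by blast
    have "int p ^ (i - 1) = int p ^ (k - 1)"
      unfolding gA[OF j(1) that(1), symmetric] by (rule gA[OF j(2) that(2)])
    then have "i - 1 = k - 1" by (rule inj)
    with that show False by auto
  qed
  have dZ: "?A i \<inter> ?Z = {}" if "i \<in> {1..s}" for i
  proof (rule ccontr)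
    assume "?A i \<inter> ?Z \<noteq> {}"
    then obtain j where j: "j \<in> ?A i" "j \<in> ?Z" by blast
    have "int p ^ (i - 1) = int p ^ s"
      unfolding gA[OF j(1) that, symmetric] by (rule gZ[OF j(2)])
    then have "i - 1 = s" by (rule inj)
    with that show False by auto
  qed
  \<comment> \<open>The counts \<open>a k - a (k - 1)\<close> telescope.\<close>
  have cU: "card (\<Union>k\<in>{1..i}. ?A k) = a i" if "i \<le> s" for i
  proof -
    have "card (\<Union>k\<in>{1..i}. ?A k) = (\<Sum>k\<in>{1..i}. card (?A k))"
      using that dA by (intro card_UN_disjoint) auto
    also have "\<dots> = (\<Sum>k\<in>{1..i}. a k - a (k - 1))" using that cA by (intro sum.cong) auto
    also have "\<dots> = a i" using that
    proof (induction i)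
      case (Suc i)
      then show ?case using mono[of i] by simp
    qed (simp add: a0)
    finally show ?thesis .
  qed
  have "(\<Union>k\<in>{1..s}. ?A k) \<union> ?Z = {..<m}"
  proof (rule card_subset_eq)
    have "(\<Union>k\<in>{1..s}. ?A k) \<inter> ?Z = {}" using dZ by blast
    then have "card ((\<Union>k\<in>{1..s}. ?A k) \<union> ?Z) = card (\<Union>k\<in>{1..s}. ?A k) + card ?Z"
      by (intro card_Un_disjoint) simp_all
    then show "card ((\<Union>k\<in>{1..s}. ?A k) \<union> ?Z) = card {..<m}" using cU[of s] cZ as by simp
  qed auto
  then have cover: "(\<exists>k\<in>{1..s}. j \<in> ?A k) \<or> j \<in> ?Z" if "j < m" for j
    using that by blast
  define P where "P j t \<longleftrightarrow> t \<le> s \<and> gcd (D $$ (j,j)) ?q = int p ^ t \<and> (t < s \<longrightarrow> j \<in> ?A (Suc t))"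
    for j t
  have "\<exists>t. P j t" if "j < m" for j
    using cover[OF that]
  proof
    assume "\<exists>k\<in>{1..s}. j \<in> ?A k"
    then obtain k where k: "k \<in> {1..s}" "j \<in> ?A k" by blast
    then have "P j (k - 1)" unfolding P_def using gA[OF k(2,1)] by auto
    then show ?thesis ..
  next
    assume "j \<in> ?Z"
    then have "P j s" unfolding P_def using gZ[of j] by simp
    then show ?thesis ..
  qed
  then have "\<exists>v. \<forall>j\<in>{..<m}. P j (v j)" by (intro bchoice) simp
  then obtain v where Pv: "\<And>j. j < m \<Longrightarrow> P j (v j)" by auto
  have v: "v j \<le> s" "gcd (D $$ (j,j)) ?q = int p ^ v j" "v j < s \<Longrightarrow> j \<in> ?A (Suc (v j))"
    if "j < m" for j
    using Pv[OF that] unfolding P_def by simp_all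
  have v_mono: "v i \<le> v j" if "i \<le> j" "j < m" for i j
  proof -
    have i: "i < m" using that by simp
    have "gcd (D $$ (i,i)) ?q dvd D $$ (j,j)"
      by (rule snf_form_dvd_mono[OF snf_mats_imp_snf_form[OF snf] gcd_dvd2 gcd_dvd1 that])
    then have "gcd (D $$ (i,i)) ?q dvd gcd (D $$ (j,j)) ?q" by (rule gcd_greatest) (rule gcd_dvd2)
    then have "int (p ^ v i) dvd int (p ^ v j)"
      unfolding v(2)[OF i] v(2)[OF that(2)] unfolding of_nat_power .
    then have "p ^ v i dvd p ^ v j" by (simp only: int_dvd_int_iff)
    then show ?thesis using p1 by (rule power_dvd_imp_le)
  qed
  have lt: "v j < i \<longleftrightarrow> j < a i" if "i \<le> s" "j < m" for i j
  proof -
    have eq: "{j. j < m \<and> v j < i} = (\<Union>k\<in>{1..i}. ?A k)"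
    proof (intro equalityI subsetI)
      fix j assume "j \<in> {j. j < m \<and> v j < i}"
      then have j: "j < m" "v j < i" by simp_all
      have "j \<in> ?A (Suc (v j))" using j that(1) by (intro v(3)) simp_all
      moreover have "Suc (v j) \<in> {1..i}" using j by simp
      ultimately show "j \<in> (\<Union>k\<in>{1..i}. ?A k)" by blast
    next
      fix j assume "j \<in> (\<Union>k\<in>{1..i}. ?A k)"
      then obtain k where k: "k \<in> {1..i}" "j \<in> ?A k" by blast
      then have j: "j < m" by simp
      have "k \<in> {1..s}" using k(1) that(1) by simp
      then have "int p ^ v j = int p ^ (k - 1)"
        unfolding v(2)[OF j, symmetric] by (rule gA[OF k(2)])
      then have "v j = k - 1" by (rule inj)
      then show "j \<in> {j. j < m \<and> v j < i}" using k(1) j by auto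
    qed
    have "{j. j < m \<and> v j < i} = {..<card {j. j < m \<and> v j < i}}"
    proof (rule downward_closed_eq_lessThan)
      show "\<And>k l. l \<in> {j. j < m \<and> v j < i} \<Longrightarrow> k \<le> l \<Longrightarrow> k \<in> {j. j < m \<and> v j < i}"
        using v_mono by fastforce
    qed simp
    also have "card {j. j < m \<and> v j < i} = a i" unfolding eq by (rule cU[OF that(1)])
    finally have "j \<in> {j. j < m \<and> v j < i} \<longleftrightarrow> j \<in> {..<a i}" by (simp only:)
    then show ?thesis using that(2) by simp
  qed
  have "a k \<le> j \<longleftrightarrow> k \<le> v j" if "k \<le> s" for k
    using lt[OF that j] by linarith
  then have "{k \<in> {1..s}. a k \<le> j} = {1..v j}" using v(1)[OF j] by auto
  then have "type_exponent s a j = v j" unfolding type_exponent_def by simp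
  then show ?thesis using v(2)[OF j] by simp
qed

theorem mu_mod_prime_power:
  assumes "m \<le> n" "prime p" "a 0 = 0" "\<And>i. i < s \<Longrightarrow> a i \<le> a (Suc i)" "a s \<le> m" "is_D_a n m p s a D"
  shows "mu_mod n m (p ^ s) {D} = type_density p n m s a"
proof -
  have q: "0 < p ^ s" using assms(2) by (simp add: prime_gt_0_nat)
  have "has_type_in m (p ^ s) {D} M \<longleftrightarrow> (\<forall>j<m. snf_type (p ^ s) M j = int p ^ type_exponent s a j)" for M
    unfolding has_type_in_def by (auto simp: is_D_a_gcd[OF assms(2-6)] simp del: of_nat_power)
  then have types: "{M \<in> residue_mats n m (p ^ s). has_type_in m (p ^ s) {D} M} =
      type_mats n m (p ^ s) (\<lambda>j. int p ^ type_exponent s a j)"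
    unfolding type_mats_def by (simp only:)
  show ?thesis
    unfolding mu_mod_eq_residue_prob[OF assms(1) q] residue_prob_def types
    by (rule type_mats_density[OF assms(2,1,3-5)])
qed

lemma has_type_in_prod_iff:
  assumes "finite I" "\<And>i j. i \<in> I \<Longrightarrow> j \<in> I \<Longrightarrow> i \<noteq> j \<Longrightarrow> coprime (q i) (q j)"
  shows "has_type_in m (\<Prod>i\<in>I. q i) S M \<longleftrightarrow> (\<exists>D\<in>S. \<forall>i\<in>I. has_type_in m (q i) {D} M)"
proof -
  have eq: "gcd x (int (\<Prod>i\<in>I. q i)) = gcd y (int (\<Prod>i\<in>I. q i)) \<longleftrightarrow>
      (\<forall>i\<in>I. gcd x (int (q i)) = gcd y (int (q i)))" for x y
    unfolding of_nat_prod using assms by (intro gcd_eq_prod_iff) auto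
  show ?thesis unfolding has_type_in_def snf_type_def eq by blast
qed

text \<open>The hypothesis \<open>local\<close> turns the event into an intersection of events that depend on coprime
  moduli and are therefore independent.\<close>

lemma mu_mod_prod:
  assumes "m \<le> n" "finite I" "\<And>i. i \<in> I \<Longrightarrow> 0 < q i"
    "\<And>i j. i \<in> I \<Longrightarrow> j \<in> I \<Longrightarrow> i \<noteq> j \<Longrightarrow> coprime (q i) (q j)"
    and local: "\<And>M. has_type_in m (\<Prod>i\<in>I. q i) S M \<longleftrightarrow> (\<forall>i\<in>I. has_type_in m (q i) S M)"
  shows "mu_mod n m (\<Prod>i\<in>I. q i) S = (\<Prod>i\<in>I. mu_mod n m (q i) S)"
proof -
  have pos: "0 < (\<Prod>i\<in>I. q i)" using assms(3) by (intro prod_pos) auto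
  have "has_type_in m (\<Prod>i\<in>I. q i) S = (\<lambda>M. \<forall>i\<in>I. has_type_in m (q i) S M)"
    using local by (rule ext)
  then have "mu_mod n m (\<Prod>i\<in>I. q i) S =
      residue_prob n m (\<Prod>i\<in>I. q i) (\<lambda>M. \<forall>i\<in>I. has_type_in m (q i) S M)"
    unfolding mu_mod_eq_residue_prob[OF assms(1) pos] by (simp only:)
  also have "\<dots> = (\<Prod>i\<in>I. residue_prob n m (q i) (has_type_in m (q i) S))"
    using has_type_in_equiv_mod[OF assms(1) _ assms(3) cong_mat_imp_equiv_mod]
    by (intro residue_prob_prod assms(2-4)) auto
  also have "\<dots> = (\<Prod>i\<in>I. mu_mod n m (q i) S)"
    using mu_mod_eq_residue_prob[OF assms(1,3)] by (intro prod.cong) auto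
  finally show ?thesis .
qed

text \<open>What is left is to check the local condition for \<open>modulus \<P>\<close>. For a locally determined \<open>S\<close> one
  chooses a member of \<open>S\<close> matching \<open>M\<close> at each prime power and glues these choices.\<close>

theorem theorem3p2:
  fixes n m :: nat
  assumes "0 < m" and "m \<le> n"
  shows
    "(\<forall>(p::nat) (s::nat) (a :: nat \<Rightarrow> nat) (D :: int mat).
        prime p \<and> 0 < s \<and> a 0 = 0 \<and> (\<forall>i\<le>s. a i \<le> a (i + 1)) \<and> a (s + 1) = m \<and>
        is_D_a n m p s a D \<longrightarrow>
        mu_mod n m (p ^ s) {D} =
          real p powi (- (\<Sum>i=1..s. (int n - int (a i)) * (int m - int (a i)))) *
          (qbracket p n * qbracket p m /
            (qbracket p (n - a s) * qbracket p (m - a s) *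
              (\<Prod>i=1..s. qbracket p (a i - a (i - 1))))))
     \<and>
     (\<forall>(\<P> :: (nat \<times> nat) set) (S :: int mat set).
        finite \<P> \<and> (\<forall>(p,s)\<in>\<P>. prime p \<and> 0 < s) \<and> S \<subseteq> snf_mats n m \<longrightarrow>
        mu_mod n m (modulus \<P>) S =
          (\<Sum>C\<in>classes_mod (modulus \<P>) m S. mu_mod n m (modulus \<P>) {class_rep C}) \<and>
        (\<lambda>k. mu_box n m k (modulus \<P>) S) \<longlonglongrightarrow> mu_mod n m (modulus \<P>) S \<and>
        (inj_on fst \<P> \<longrightarrow>
          mu_mod n m (modulus \<P>) S =
            (\<Sum>C\<in>classes_mod (modulus \<P>) m S. \<Prod>(p,s)\<in>\<P>. mu_mod n m (p ^ s) {class_rep C})) \<and>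
        (inj_on fst \<P> \<and> locally_determined m \<P> S \<longrightarrow>
          mu_mod n m (modulus \<P>) S = (\<Prod>(p,s)\<in>\<P>. mu_mod n m (p ^ s) S)))"
proof (intro conjI allI impI)
  fix p s :: nat and a :: "nat \<Rightarrow> nat" and D :: "int mat"
  assume H: "prime p \<and> 0 < s \<and> a 0 = 0 \<and> (\<forall>i\<le>s. a i \<le> a (i + 1)) \<and> a (s + 1) = m \<and>
    is_D_a n m p s a D"
  then have mono: "a i \<le> a (Suc i)" if "i \<le> s" for i using that by simp
  have prem: "prime p" "a 0 = 0" "is_D_a n m p s a D" "a s \<le> m" using H mono[of s] by auto
  have "mu_mod n m (p ^ s) {D} = type_density p n m s a"
    by (rule mu_mod_prime_power[OF assms(2) prem(1,2) _ prem(4,3)]) (simp add: mono)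
  then show "mu_mod n m (p ^ s) {D} =
      real p powi (- (\<Sum>i=1..s. (int n - int (a i)) * (int m - int (a i)))) *
      (qbracket p n * qbracket p m /
        (qbracket p (n - a s) * qbracket p (m - a s) *
          (\<Prod>i=1..s. qbracket p (a i - a (i - 1)))))"
    unfolding type_density_def .
next
  fix \<P> :: "(nat \<times> nat) set" and S :: "int mat set"
  assume H: "finite \<P> \<and> (\<forall>(p,s)\<in>\<P>. prime p \<and> 0 < s) \<and> S \<subseteq> snf_mats n m"
  define q :: "nat \<times> nat \<Rightarrow> nat" where "q x = fst x ^ snd x" for x
  have fin: "finite \<P>" using H by simp
  have prime: "prime (fst x)" "0 < snd x" if "x \<in> \<P>" for x
    using H that by (auto simp: case_prod_beta)
  have modulus: "modulus \<P> = (\<Prod>x\<in>\<P>. q x)"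
    unfolding modulus_def q_def by (simp add: case_prod_beta)
  have q: "0 < q x" if "x \<in> \<P>" for x
    using prime(1)[OF that] unfolding q_def by (simp add: prime_gt_0_nat)
  then have pos: "0 < modulus \<P>" unfolding modulus by (intro prod_pos) auto
  have coprime: "coprime (q x) (q y)" if "inj_on fst \<P>" "x \<in> \<P>" "y \<in> \<P>" "x \<noteq> y" for x y
  proof -
    have "fst x \<noteq> fst y" using that by (auto dest: inj_onD)
    then have "coprime (fst x) (fst y)"
      using prime(1)[OF that(2)] prime(1)[OF that(3)] by (intro primes_coprime)
    then show ?thesis unfolding q_def by simp
  qed
  have pairs: "(\<Prod>(p,s)\<in>\<P>. f (p ^ s)) = (\<Prod>x\<in>\<P>. f (q x))" for f :: "nat \<Rightarrow> real"
    unfolding q_def by (simp add: case_prod_beta)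
  show sum: "mu_mod n m (modulus \<P>) S =
      (\<Sum>C\<in>classes_mod (modulus \<P>) m S. mu_mod n m (modulus \<P>) {class_rep C})"
    by (rule mu_mod_eq_sum_classes[OF assms(2) pos])
  show "(\<lambda>k. mu_box n m k (modulus \<P>) S) \<longlonglongrightarrow> mu_mod n m (modulus \<P>) S"
    by (rule mu_box_tendsto_mu_mod[OF assms(2) pos])
  show "mu_mod n m (modulus \<P>) S =
      (\<Sum>C\<in>classes_mod (modulus \<P>) m S. \<Prod>(p,s)\<in>\<P>. mu_mod n m (p ^ s) {class_rep C})"
    if inj: "inj_on fst \<P>"
  proof -
    have "mu_mod n m (modulus \<P>) {D} = (\<Prod>x\<in>\<P>. mu_mod n m (q x) {D})" for D
      unfolding modulus
    proof (rule mu_mod_prod[OF assms(2) fin q coprime[OF inj]])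
      show "has_type_in m (prod q \<P>) {D} M \<longleftrightarrow> (\<forall>x\<in>\<P>. has_type_in m (q x) {D} M)" for M
        using has_type_in_prod_iff[OF fin coprime[OF inj]] by simp
    qed
    then show ?thesis unfolding sum pairs[of "\<lambda>r. mu_mod n m r {D}" for D] by (simp only:)
  qed
  show "mu_mod n m (modulus \<P>) S = (\<Prod>(p,s)\<in>\<P>. mu_mod n m (p ^ s) S)"
    if L: "inj_on fst \<P> \<and> locally_determined m \<P> S"
    unfolding modulus pairs[of "\<lambda>r. mu_mod n m r S"]
  proof (rule mu_mod_prod[OF assms(2) fin q coprime[OF conjunct1[OF L]]])
    fix M
    have iff: "has_type_in m (prod q \<P>) S M \<longleftrightarrow> (\<exists>D\<in>S. \<forall>x\<in>\<P>. has_type_in m (q x) {D} M)"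
      by (rule has_type_in_prod_iff[OF fin coprime[OF conjunct1[OF L]]])
    show "has_type_in m (prod q \<P>) S M \<longleftrightarrow> (\<forall>x\<in>\<P>. has_type_in m (q x) S M)"
    proof
      assume "has_type_in m (prod q \<P>) S M"
      then show "\<forall>x\<in>\<P>. has_type_in m (q x) S M"
        unfolding iff by (auto simp: has_type_in_def)
    next
      assume "\<forall>x\<in>\<P>. has_type_in m (q x) S M"
      then have "\<forall>x\<in>\<P>. \<exists>D. D \<in> S \<and> has_type_in m (q x) {D} M"
        by (auto simp: has_type_in_def)
      then obtain F where F: "\<forall>x\<in>\<P>. F x \<in> S \<and> has_type_in m (q x) {F x} M"
        using bchoice[of \<P> "\<lambda>x D. D \<in> S \<and> has_type_in m (q x) {D} M"] by blast
      then obtain D where D: "D \<in> S" "\<forall>(p,s)\<in>\<P>. diag_assoc (p ^ s) m D (F (p,s))"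
        using L unfolding locally_determined_def by blast
      have "has_type_in m (q x) {D} M" if x: "x \<in> \<P>" for x
      proof -
        have "diag_assoc (q x) m D (F x)" using D(2) x unfolding q_def by (auto simp: case_prod_beta)
        then show ?thesis
          using F x unfolding diag_assoc_iff_gcd[OF q[OF x]] has_type_in_def by auto
      qed
      with D(1) show "has_type_in m (prod q \<P>) S M" unfolding iff by blast
    qed
  qed
qed

end
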